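(* Let $X$ be a topological space, $A$ an abelian coefficient group, and $c\in C^2_{\mathrm{sing}}(X;A)$ a singular cocycle representing an atoroidal cohomology class, i.e. $f^*[c]=0\in H^2(T^2;A)$ for every continuous map $f\colon T^2\to X$. Let $b_c\in C^1_{\mathrm{sing}}(PX;A)$ be the cochain associated to $c$ (see context), let $a_c:=r_1^*b_c-r_2^*b_c\in C^1_{\mathrm{sing}}(LX;A)$ (which is a cocycle), and let $\overline c:=\operatorname{pr}_2^*c-\operatorname{pr}_1^*c\in C^2_{\mathrm{sing}}(X\times X;A)$. Then $$[a_c]=0\in H^1(LX;A).$$ In particular, then also $\pi_2^*[\overline c]=0\in H^2_{\mathrm{sing}}(P_2X;A)$, and the class $[\overline c]\in H^2(X\times X;A)$ has $\operatorname{TC}$-weight $\operatorname{wgt}([\overline c])=2$.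
   Context: $PX=C([0,1],X)$ with the compact-open topology; $\pi\colon PX\to X\times X$, $\gamma\mapsto(\gamma(0),\gamma(1))$; $LX=\{\gamma\in PX\mid\gamma(0)=\gamma(1)\}$; $T^2$ is the 2-dimensional torus; $\operatorname{pr}_1,\operatorname{pr}_2\colon X\times X\to X$ are the projections. The maps $r_1,r_2\colon LX\to PX$ are $r_1(\gamma)(s)=\gamma(s/2)$ and $r_2(\gamma)(s)=\gamma(1-s/2)$; they satisfy $\pi\circ r_1=\pi\circ r_2$. $P_2X$ is the double mapping cylinder of $r_1$ and $r_2$: $P_2X=\big((LX\times[1,2])\amalg(PX\times\{1\})\amalg(PX\times\{2\})\big)/\sim$, with $\sim$ generated by $(\gamma,1)\sim(r_1(\gamma),1)$ and $(\gamma,2)\sim(r_2(\gamma),2)$ for $\gamma\in LX$. The map $\pi_2\colon P_2X\to X\times X$ sends $[\gamma,t]$ to $(\gamma(0),\gamma(\tfrac12))$ if $\gamma\in LX$, and to $(\gamma(0),\gamma(1))$ if $\gamma\in PX$. Definition of $b_c$ for $c\in C^2_{\mathrm{sing}}(X;A)$: for a singular simplex $\sigma\colon\Delta_1\to PX$ let $\Psi(\sigma)\colon\Delta_1\times[0,1]\to X$, $\Psi(\sigma)(x,s)=\sigma(x)(s)$. For $j=0,1$ let $\iota_j\colon\Delta_2\to\Delta_1\times[0,1]$ be the affine linear map with $\iota_j(v_i)=(v_i,0)$ for $i\le j$ and $\iota_j(v_i)=(v_{i-1},1)$ for $i>j$, where $v_0,v_1,\dots$ are the vertices of the standard simplices.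 Set $T(\sigma)=\Psi(\sigma)\circ\iota_0-\Psi(\sigma)\circ\iota_1$, extended linearly to $T\colon C_1^{\mathrm{sing}}(PX)\to C_2^{\mathrm{sing}}(X)$, and $b_c:=c\circ T$. $\operatorname{TC}$-weight: for $u\in H^*(X\times X;A)$, $\operatorname{wgt}(u)\in\{0,1,\dots\}\cup\{\infty\}$ is the largest $k$ such that $f^*u=0\in H^*(Y;A)$ for every continuous map $f\colon Y\to X\times X$ for which there exist an open covering $\{U_1,\dots,U_k\}$ of $Y$ and continuous maps $f_i\colon U_i\to PX$ with $\pi\circ f_i=f|_{U_i}$ for $i=1,\dots,k$.
   Formalization: The equality wgt([c̄]) = 2 is proved when [c̄] ≠ 0 (for [c̄] = 0, e.g. c = 0, the weight is ∞); wgt([c̄]) ≥ 2 is proved always. Test spaces Y have points in a fixed but arbitrary type: ≥ 2 for every type, = 2 for every sufficiently large one. *)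

theory Defs
  imports "HOL-Homology.Homology" "HOL-Library.Extended_Nat"
begin

section \<open>Singular cohomology with coefficients in an abelian group\<close>

text \<open>A singular \<open>p\<close>-cochain is an additive function on the singular \<open>p\<close>-chains. To make cochains
  on \<open>X\<close> equal as functions as soon as they agree on chains of \<open>X\<close>, they vanish by convention on
  everything that is not a singular \<open>p\<close>-chain of \<open>X\<close>.\<close>

definition singular_cochains :: "nat \<Rightarrow> 'a topology \<Rightarrow> ('a chain \<Rightarrow> 'g::ab_group_add) set" where
  "singular_cochains p X =
     {c. (\<forall>x y. singular_chain p X x \<longrightarrow> singular_chain p X y \<longrightarrow> c (x + y) = c x + c y) \<and>
         (\<forall>x. \<not> singular_chain p X x \<longrightarrow> c x = 0)}"

definition coboundary :: "nat \<Rightarrow> 'a topology \<Rightarrow> ('a chain \<Rightarrow> 'g) \<Rightarrow> 'a chain \<Rightarrow> 'g::ab_group_add" where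
  "coboundary p X c =
     (\<lambda>x. if singular_chain (Suc p) X x then c (chain_boundary (Suc p) x) else 0)"

definition singular_cocycles :: "nat \<Rightarrow> 'a topology \<Rightarrow> ('a chain \<Rightarrow> 'g::ab_group_add) set" where
  "singular_cocycles p X = {c \<in> singular_cochains p X. coboundary p X c = (\<lambda>x. 0)}"

definition singular_coboundaries :: "nat \<Rightarrow> 'a topology \<Rightarrow> ('a chain \<Rightarrow> 'g::ab_group_add) set" where
  "singular_coboundaries p X =
     (case p of 0 \<Rightarrow> {\<lambda>x. 0} | Suc q \<Rightarrow> coboundary q X ` singular_cochains q X)"

definition cocycle_group :: "nat \<Rightarrow> 'a topology \<Rightarrow> ('a chain \<Rightarrow> 'g::ab_group_add) monoid" where
  "cocycle_group p X =
     \<lparr>carrier = singular_cocycles p X, monoid.mult = (\<lambda>c d x. c x + d x), one = (\<lambda>x. 0)\<rparr>"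

definition cohomology_group :: "nat \<Rightarrow> 'a topology \<Rightarrow> ('a chain \<Rightarrow> 'g::ab_group_add) set monoid" where
  "cohomology_group p X = cocycle_group p X Mod singular_coboundaries p X"

definition cohomology_class ::
  "nat \<Rightarrow> 'a topology \<Rightarrow> ('a chain \<Rightarrow> 'g) \<Rightarrow> ('a chain \<Rightarrow> 'g::ab_group_add) set" where
  "cohomology_class p X c = singular_coboundaries p X #>\<^bsub>cocycle_group p X\<^esub> c"

definition cochain_pullback ::
  "nat \<Rightarrow> 'b topology \<Rightarrow> ('b \<Rightarrow> 'a) \<Rightarrow> ('a chain \<Rightarrow> 'g) \<Rightarrow> 'b chain \<Rightarrow> 'g::ab_group_add" where
  "cochain_pullback p Y f c = (\<lambda>x. if singular_chain p Y x then c (chain_map p f x) else 0)"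

text \<open>The map induced on cohomology by \<open>f : Y \<rightarrow> X\<close>. All sets in the union coincide; see
  \<open>cohomology_induced_class\<close> below.\<close>

definition cohomology_induced ::
  "nat \<Rightarrow> 'b topology \<Rightarrow> ('b \<Rightarrow> 'a) \<Rightarrow> ('a chain \<Rightarrow> 'g) set \<Rightarrow> ('b chain \<Rightarrow> 'g::ab_group_add) set" where
  "cohomology_induced p Y f u = (\<Union>c\<in>u. cohomology_class p Y (cochain_pullback p Y f c))"

lemma singular_cochainsI:
  assumes "\<And>x y. singular_chain p X x \<Longrightarrow> singular_chain p X y \<Longrightarrow> c (x + y) = c x + c y"
    and "\<And>x. \<not> singular_chain p X x \<Longrightarrow> c x = 0"
  shows "c \<in> singular_cochains p X"
  using assms by (simp add: singular_cochains_def)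

lemma singular_cochains_add:
  "c \<in> singular_cochains p X \<Longrightarrow> singular_chain p X x \<Longrightarrow> singular_chain p X y \<Longrightarrow> c (x + y) = c x + c y"
  by (simp add: singular_cochains_def)

lemma singular_cochains_outside:
  "c \<in> singular_cochains p X \<Longrightarrow> \<not> singular_chain p X x \<Longrightarrow> c x = 0"
  by (simp add: singular_cochains_def)

lemma singular_cochains_0:
  assumes "c \<in> singular_cochains p X" shows "c 0 = 0"
  using singular_cochains_add[OF assms, of 0 0] by simp

lemma coboundary_in_cochains:
  assumes "c \<in> singular_cochains p X"
  shows "coboundary p X c \<in> singular_cochains (Suc p) X"
  by (rule singular_cochainsI)
     (simp_all add: coboundary_def singular_chain_add chain_boundary_add
        singular_cochains_add[OF assms] singular_chain_boundary_alt)

lemma coboundary_in_cocycles: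
  assumes "c \<in> singular_cochains p X"
  shows "coboundary p X c \<in> singular_cocycles (Suc p) X"
proof -
  have "coboundary (Suc p) X (coboundary p X c) x = 0" for x
  proof (cases "singular_chain (Suc (Suc p)) X x")
    case True
    then have "chain_boundary (Suc p) (chain_boundary (Suc (Suc p)) x) = 0"
      using chain_boundary_boundary_alt by blast
    then show ?thesis
      using True singular_cochains_0[OF assms] by (simp add: coboundary_def)
  qed (simp add: coboundary_def)
  then show ?thesis
    using coboundary_in_cochains[OF assms] by (auto simp: singular_cocycles_def)
qed

lemma zero_in_cocycles: "(\<lambda>x. 0) \<in> singular_cocycles p X"
  by (simp add: singular_cocycles_def singular_cochains_def coboundary_def)

lemma cochains_diff:
  assumes "c \<in> singular_cochains p X" "d \<in> singular_cochains p X"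
  shows "(\<lambda>x. c x - d x) \<in> singular_cochains p X"
  using assms by (auto simp: singular_cochains_def)

lemma cocycles_diff:
  assumes "c \<in> singular_cocycles p X" "d \<in> singular_cocycles p X"
  shows "(\<lambda>x. c x - d x) \<in> singular_cocycles p X"
proof -
  have "coboundary p X (\<lambda>x. c x - d x) = (\<lambda>x. coboundary p X c x - coboundary p X d x)"
    by (auto simp: coboundary_def)
  then show ?thesis
    using assms cochains_diff[of c p X d] by (simp add: singular_cocycles_def)
qed

lemma coboundaries_diff:
  assumes "c \<in> singular_coboundaries p X" "d \<in> singular_coboundaries p X"
  shows "(\<lambda>x. c x - d x) \<in> singular_coboundaries p X"
proof (cases p)
  case 0
  then show ?thesis using assms by (simp add: singular_coboundaries_def)
next
  case (Suc q)
  then obtain a b where ab: "a \<in> singular_cochains q X" "c = coboundary q X a"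
    "b \<in> singular_cochains q X" "d = coboundary q X b"
    using assms by (auto simp: singular_coboundaries_def)
  then have "(\<lambda>x. c x - d x) = coboundary q X (\<lambda>x. a x - b x)"
    by (auto simp: coboundary_def)
  then show ?thesis
    using Suc ab cochains_diff[of a q X b] by (simp add: singular_coboundaries_def)
qed

lemma zero_in_coboundaries: "(\<lambda>x. 0) \<in> singular_coboundaries p X"
  by (cases p) (auto simp: singular_coboundaries_def coboundary_def singular_cochains_def
      intro!: image_eqI[where x = "\<lambda>x. 0"])

lemma coboundaries_subset_cocycles: "singular_coboundaries p X \<subseteq> singular_cocycles p X"
  by (cases p) (auto simp: singular_coboundaries_def zero_in_cocycles coboundary_in_cocycles)

lemma cocycles_uminus: "c \<in> singular_cocycles p X \<Longrightarrow> (\<lambda>x. - c x) \<in> singular_cocycles p X"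
  using cocycles_diff[OF zero_in_cocycles, of c] by simp

lemma cocycles_plus:
  assumes "c \<in> singular_cocycles p X" "d \<in> singular_cocycles p X"
  shows "(\<lambda>x. c x + d x) \<in> singular_cocycles p X"
  using cocycles_diff[OF assms(1) cocycles_uminus[OF assms(2)]] by simp

lemma coboundaries_uminus:
  "c \<in> singular_coboundaries p X \<Longrightarrow> (\<lambda>x. - c x) \<in> singular_coboundaries p X"
  using coboundaries_diff[OF zero_in_coboundaries, of c] by simp

lemma coboundaries_plus:
  assumes "c \<in> singular_coboundaries p X" "d \<in> singular_coboundaries p X"
  shows "(\<lambda>x. c x + d x) \<in> singular_coboundaries p X"
  using coboundaries_diff[OF assms(1) coboundaries_uminus[OF assms(2)]] by simp

lemma comm_group_cocycle_group: "comm_group (cocycle_group p X)"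
proof (rule comm_groupI)
  fix c assume "c \<in> carrier (cocycle_group p X)"
  then show "\<exists>d\<in>carrier (cocycle_group p X). d \<otimes>\<^bsub>cocycle_group p X\<^esub> c = \<one>\<^bsub>cocycle_group p X\<^esub>"
    by (intro bexI[of _ "\<lambda>x. - c x"]) (auto simp: cocycle_group_def cocycles_uminus)
qed (auto simp: cocycle_group_def cocycles_plus zero_in_cocycles algebra_simps)

lemma inv_cocycle_group:
  assumes "c \<in> singular_cocycles p X"
  shows "inv\<^bsub>cocycle_group p X\<^esub> c = (\<lambda>x. - c x)"
proof -
  interpret comm_group "cocycle_group p X" by (rule comm_group_cocycle_group)
  show ?thesis
    by (rule inv_equality) (use assms in \<open>auto simp: cocycle_group_def cocycles_uminus\<close>)
qed

lemma subgroup_coboundaries: "subgroup (singular_coboundaries p X) (cocycle_group p X)"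
proof -
  interpret comm_group "cocycle_group p X" by (rule comm_group_cocycle_group)
  show ?thesis
  proof (rule subgroupI)
    fix c assume c: "c \<in> singular_coboundaries p X"
    then show "inv\<^bsub>cocycle_group p X\<^esub> c \<in> singular_coboundaries p X"
      using coboundaries_subset_cocycles inv_cocycle_group[of c p X] coboundaries_uminus
      by fastforce
  next
    show "singular_coboundaries p X \<noteq> {}" using zero_in_coboundaries by blast
  qed (use coboundaries_subset_cocycles in \<open>auto simp: cocycle_group_def coboundaries_plus\<close>)
qed

lemma comm_group_cohomology_group: "comm_group (cohomology_group p X)"
  unfolding cohomology_group_def
  by (rule comm_group.abelian_FactGroup[OF comm_group_cocycle_group subgroup_coboundaries])

lemma cohomology_class_alt:
  "cohomology_class p X c = {d. (\<lambda>x. d x - c x) \<in> singular_coboundaries p X}"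
proof -
  have "\<exists>h\<in>singular_coboundaries p X. d = (\<lambda>x. h x + c x)"
    if "(\<lambda>x. d x - c x) \<in> singular_coboundaries p X" for d
    by (rule bexI[OF _ that]) auto
  then show ?thesis
    unfolding cohomology_class_def r_coset_def cocycle_group_def by auto
qed

lemma cohomology_class_carrier:
  "c \<in> singular_cocycles p X \<Longrightarrow> cohomology_class p X c \<in> carrier (cohomology_group p X)"
  by (auto simp: cohomology_group_def FactGroup_def RCOSETS_def cohomology_class_def cocycle_group_def)

lemma cohomology_class_eq_iff:
  "cohomology_class p X c = cohomology_class p X d \<longleftrightarrow>
     (\<lambda>x. c x - d x) \<in> singular_coboundaries p X"
proof
  assume "cohomology_class p X c = cohomology_class p X d"
  moreover have "c \<in> cohomology_class p X c"
    by (simp add: cohomology_class_alt zero_in_coboundaries)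
  ultimately show "(\<lambda>x. c x - d x) \<in> singular_coboundaries p X"
    by (simp add: cohomology_class_alt)
next
  assume cd: "(\<lambda>x. c x - d x) \<in> singular_coboundaries p X"
  have "(\<lambda>x. e x - d x) \<in> singular_coboundaries p X"
    if "(\<lambda>x. e x - c x) \<in> singular_coboundaries p X" for e
    using coboundaries_plus[OF that cd] by simp
  moreover have "(\<lambda>x. e x - c x) \<in> singular_coboundaries p X"
    if "(\<lambda>x. e x - d x) \<in> singular_coboundaries p X" for e
    using coboundaries_diff[OF that cd] by simp
  ultimately show "cohomology_class p X c = cohomology_class p X d"
    by (auto simp: cohomology_class_alt)
qed

lemma cohomology_class_eq_zero_iff:
  fixes c :: "'a chain \<Rightarrow> 'g::ab_group_add"
  shows "cohomology_class p X c = \<one>\<^bsub>cohomology_group p X\<^esub> \<longleftrightarrow> c \<in> singular_coboundaries p X"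
proof -
  have "\<one>\<^bsub>cohomology_group p X\<^esub> = cohomology_class p X (\<lambda>x. 0 :: 'g)"
    by (simp add: cohomology_group_def FactGroup_def cohomology_class_alt)
  then show ?thesis by (simp add: cohomology_class_eq_iff)
qed

lemma cochain_pullback_in_cochains:
  assumes "continuous_map Y X f" "c \<in> singular_cochains p X"
  shows "cochain_pullback p Y f c \<in> singular_cochains p Y"
  by (rule singular_cochainsI)
     (simp_all add: cochain_pullback_def singular_chain_add chain_map_add
        singular_cochains_add[OF assms(2)] singular_chain_chain_map[OF _ assms(1)])

lemma coboundary_cochain_pullback:
  assumes "continuous_map Y X f"
  shows "coboundary p Y (cochain_pullback p Y f c) = cochain_pullback (Suc p) Y f (coboundary p X c)"
proof
  fix x
  show "coboundary p Y (cochain_pullback p Y f c) x =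
        cochain_pullback (Suc p) Y f (coboundary p X c) x"
    using singular_chain_boundary_alt[of p Y x] chain_boundary_chain_map[of "Suc p" Y x f]
      singular_chain_chain_map[OF _ assms, of "Suc p" x]
    by (auto simp: coboundary_def cochain_pullback_def)
qed

lemma cochain_pullback_in_cocycles:
  assumes "continuous_map Y X f" "c \<in> singular_cocycles p X"
  shows "cochain_pullback p Y f c \<in> singular_cocycles p Y"
  using assms cochain_pullback_in_cochains[of Y X f c p] coboundary_cochain_pullback[of Y X f p c]
  by (auto simp: singular_cocycles_def cochain_pullback_def fun_eq_iff)

lemma cochain_pullback_in_coboundaries:
  assumes "continuous_map Y X f" "c \<in> singular_coboundaries p X"
  shows "cochain_pullback p Y f c \<in> singular_coboundaries p Y"
proof (cases p)
  case 0
  then show ?thesis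
    using assms by (auto simp: singular_coboundaries_def cochain_pullback_def)
next
  case (Suc q)
  then obtain b where "b \<in> singular_cochains q X" "c = coboundary q X b"
    using assms by (auto simp: singular_coboundaries_def)
  then show ?thesis
    using Suc coboundary_cochain_pullback[OF assms(1), of q b]
      cochain_pullback_in_cochains[OF assms(1), of b q]
    by (auto simp: singular_coboundaries_def simp flip: coboundary_cochain_pullback[OF assms(1)])
qed

lemma cohomology_induced_class:
  assumes "continuous_map Y X f"
  shows "cohomology_induced p Y f (cohomology_class p X c) =
           cohomology_class p Y (cochain_pullback p Y f c)"
proof -
  have "cohomology_class p Y (cochain_pullback p Y f d) =
        cohomology_class p Y (cochain_pullback p Y f c)"
    if "d \<in> cohomology_class p X c" for d
  proof -
    have "(\<lambda>x. cochain_pullback p Y f d x - cochain_pullback p Y f c x) =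
          cochain_pullback p Y f (\<lambda>x. d x - c x)"
      by (auto simp: cochain_pullback_def)
    then show ?thesis
      using that cochain_pullback_in_coboundaries[OF assms]
      unfolding cohomology_class_eq_iff by (simp add: cohomology_class_alt)
  qed
  moreover have "c \<in> cohomology_class p X c"
    by (simp add: cohomology_class_alt zero_in_coboundaries)
  ultimately show ?thesis
    unfolding cohomology_induced_def by blast
qed

section \<open>Path spaces\<close>

text \<open>Maps are represented by functions that are \<open>undefined\<close> outside of the domain.\<close>

definition compact_open_topology :: "'b topology \<Rightarrow> 'a topology \<Rightarrow> ('b \<Rightarrow> 'a) topology" where
  "compact_open_topology Y X =
     topology_generated_by
       {{f \<in> extensional (topspace Y). continuous_map Y X f \<and> f ` K \<subseteq> U} | K U.
          compactin Y K \<and> openin X U}"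

lemma topspace_compact_open_topology:
  "topspace (compact_open_topology Y X) = {f \<in> extensional (topspace Y). continuous_map Y X f}"
  unfolding compact_open_topology_def topology_generated_by_topspace
  using compactin_empty openin_empty by blast

definition path_space :: "'a topology \<Rightarrow> (real \<Rightarrow> 'a) topology" where
  "path_space X = compact_open_topology (top_of_set {0..1}) X"

lemma topspace_path_space: "topspace (path_space X) = {\<gamma> \<in> extensional {0..1}. pathin X \<gamma>}"
  by (simp add: path_space_def topspace_compact_open_topology pathin_def)

definition path_ends :: "(real \<Rightarrow> 'a) \<Rightarrow> 'a \<times> 'a" where
  "path_ends \<gamma> = (\<gamma> 0, \<gamma> 1)"

definition free_loop_space :: "'a topology \<Rightarrow> (real \<Rightarrow> 'a) topology" where
  "free_loop_space X = subtopology (path_space X) {\<gamma>. \<gamma> 0 = \<gamma> 1}"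

definition first_half :: "(real \<Rightarrow> 'a) \<Rightarrow> real \<Rightarrow> 'a" where
  "first_half \<gamma> = restrict (\<lambda>s. \<gamma> (s / 2)) {0..1}"

definition second_half_rev :: "(real \<Rightarrow> 'a) \<Rightarrow> real \<Rightarrow> 'a" where
  "second_half_rev \<gamma> = restrict (\<lambda>s. \<gamma> (1 - s / 2)) {0..1}"

lemma path_ends_halves:
  "\<gamma> 0 = \<gamma> 1 \<Longrightarrow> path_ends (first_half \<gamma>) = path_ends (second_half_rev \<gamma>)"
  by (simp add: path_ends_def first_half_def second_half_rev_def)

section \<open>The double mapping cylinder\<close>

text \<open>The class of \<open>x\<close> under the equivalence relation generated by \<open>R\<close>, and the quotient of \<open>S\<close>
  by that relation, with the set of classes as points.\<close>

definition glue_class :: "'b topology \<Rightarrow> ('b \<Rightarrow> 'b \<Rightarrow> bool) \<Rightarrow> 'b \<Rightarrow> 'b set" where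
  "glue_class S R x = {y \<in> topspace S. equivclp R x y}"

definition quotient_topology :: "'b topology \<Rightarrow> ('b \<Rightarrow> 'b \<Rightarrow> bool) \<Rightarrow> 'b set topology" where
  "quotient_topology S R =
     topology (\<lambda>W. W \<subseteq> glue_class S R ` topspace S \<and>
                   openin S {x \<in> topspace S. glue_class S R x \<in> W})"

lemma openin_quotient_topology:
  "openin (quotient_topology S R) W \<longleftrightarrow>
     W \<subseteq> glue_class S R ` topspace S \<and> openin S {x \<in> topspace S. glue_class S R x \<in> W}"
proof -
  let ?q = "glue_class S R"
  have "istopology (\<lambda>W. W \<subseteq> ?q ` topspace S \<and> openin S {x \<in> topspace S. ?q x \<in> W})"
    unfolding istopology_def
  proof (intro conjI allI impI)
    fix V W
    assume "V \<subseteq> ?q ` topspace S \<and> openin S {x \<in> topspace S. ?q x \<in> V}"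
      and "W \<subseteq> ?q ` topspace S \<and> openin S {x \<in> topspace S. ?q x \<in> W}"
    then have "openin S ({x \<in> topspace S. ?q x \<in> V} \<inter> {x \<in> topspace S. ?q x \<in> W})"
      by blast
    moreover have "{x \<in> topspace S. ?q x \<in> V} \<inter> {x \<in> topspace S. ?q x \<in> W} =
                   {x \<in> topspace S. ?q x \<in> V \<inter> W}" by blast
    ultimately show "openin S {x \<in> topspace S. ?q x \<in> V \<inter> W}" by simp
  next
    fix \<K>
    assume "\<forall>K\<in>\<K>. K \<subseteq> ?q ` topspace S \<and> openin S {x \<in> topspace S. ?q x \<in> K}"
    then have "openin S (\<Union>K\<in>\<K>. {x \<in> topspace S. ?q x \<in> K})" by blast
    moreover have "(\<Union>K\<in>\<K>. {x \<in> topspace S. ?q x \<in> K}) = {x \<in> topspace S. ?q x \<in> \<Union>\<K>}" by blast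
    ultimately show "openin S {x \<in> topspace S. ?q x \<in> \<Union>\<K>}" by simp
  qed blast+
  then show ?thesis by (simp add: quotient_topology_def)
qed

lemma topspace_quotient_topology:
  "topspace (quotient_topology S R) = glue_class S R ` topspace S"
proof
  show "topspace (quotient_topology S R) \<subseteq> glue_class S R ` topspace S"
    using openin_quotient_topology[of S R "topspace (quotient_topology S R)"] by simp
  have "{x \<in> topspace S. glue_class S R x \<in> glue_class S R ` topspace S} = topspace S" by blast
  then have "openin (quotient_topology S R) (glue_class S R ` topspace S)"
    by (simp add: openin_quotient_topology)
  then show "glue_class S R ` topspace S \<subseteq> topspace (quotient_topology S R)"
    by (rule openin_subset)
qed

lemma quotient_map_glue_class: "quotient_map S (quotient_topology S R) (glue_class S R)"
  by (auto simp: quotient_map_def topspace_quotient_topology openin_quotient_topology)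

datatype piece = Cylinder | End1 | End2

definition two_path_pieces :: "'a topology \<Rightarrow> (piece \<times> (real \<Rightarrow> 'a) \<times> real) topology" where
  "two_path_pieces X =
     sum_topology
       (\<lambda>i. case i of
              Cylinder \<Rightarrow> prod_topology (free_loop_space X) (top_of_set {1..2})
            | End1 \<Rightarrow> prod_topology (path_space X) (top_of_set {1})
            | End2 \<Rightarrow> prod_topology (path_space X) (top_of_set {2}))
       UNIV"

definition two_path_glue ::
  "'a topology \<Rightarrow> piece \<times> (real \<Rightarrow> 'a) \<times> real \<Rightarrow> piece \<times> (real \<Rightarrow> 'a) \<times> real \<Rightarrow> bool" where
  "two_path_glue X a b \<longleftrightarrow>
     (\<exists>\<gamma> \<in> topspace (free_loop_space X).
        a = (Cylinder, \<gamma>, 1) \<and> b = (End1, first_half \<gamma>, 1) \<or>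
        a = (Cylinder, \<gamma>, 2) \<and> b = (End2, second_half_rev \<gamma>, 2))"

definition two_path_space :: "'a topology \<Rightarrow> (piece \<times> (real \<Rightarrow> 'a) \<times> real) set topology" where
  "two_path_space X = quotient_topology (two_path_pieces X) (two_path_glue X)"

fun two_path_pieces_ends :: "piece \<times> (real \<Rightarrow> 'a) \<times> real \<Rightarrow> 'a \<times> 'a" where
  "two_path_pieces_ends (Cylinder, \<gamma>, t) = (\<gamma> 0, \<gamma> (1/2))"
| "two_path_pieces_ends (End1, \<gamma>, t) = (\<gamma> 0, \<gamma> 1)"
| "two_path_pieces_ends (End2, \<gamma>, t) = (\<gamma> 0, \<gamma> 1)"

text \<open>The map \<open>\<pi>\<^sub>2\<close>, as a function of classes.\<close>

definition two_path_ends :: "(piece \<times> (real \<Rightarrow> 'a) \<times> real) set \<Rightarrow> 'a \<times> 'a" where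
  "two_path_ends w = the_elem (two_path_pieces_ends ` w)"

lemma two_path_glue_ends:
  assumes "equivclp (two_path_glue X) a b"
  shows "two_path_pieces_ends a = two_path_pieces_ends b"
  using assms
proof (induction rule: equivclp_induct)
  case (step y z)
  have "two_path_pieces_ends u = two_path_pieces_ends v" if "two_path_glue X u v" for u v
    using that by (auto simp: two_path_glue_def first_half_def second_half_rev_def free_loop_space_def)
  then show ?case using step by metis
qed simp

lemma two_path_ends_class:
  assumes "a \<in> topspace (two_path_pieces X)"
  shows "two_path_ends (glue_class (two_path_pieces X) (two_path_glue X) a) = two_path_pieces_ends a"
proof -
  have "two_path_pieces_ends ` glue_class (two_path_pieces X) (two_path_glue X) a =
        {two_path_pieces_ends a}"
    using assms two_path_glue_ends[of X a] unfolding glue_class_def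
    by (force simp: equivclp_refl)
  then show ?thesis by (simp add: two_path_ends_def)
qed

section \<open>The cochains associated with a 2-cochain\<close>

definition simplex_vertex :: "nat \<Rightarrow> nat \<Rightarrow> real" where
  "simplex_vertex i = (\<lambda>k. if k = i then 1 else 0)"

text \<open>The affine linear map \<open>\<iota>\<^sub>j : \<Delta>\<^sub>2 \<rightarrow> \<Delta>\<^sub>1 \<times> [0,1]\<close> in barycentric coordinates.\<close>

definition prism_simplex :: "nat \<Rightarrow> (nat \<Rightarrow> real) \<Rightarrow> (nat \<Rightarrow> real) \<times> real" where
  "prism_simplex j x =
     (oriented_simplex 2 (\<lambda>i. if i \<le> j then simplex_vertex i else simplex_vertex (i - 1)) x,
      \<Sum>i\<le>2. (if i \<le> j then 0 else 1) * x i)"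

lemma prism_simplex_vertex:
  assumes "i \<le> 2"
  shows "prism_simplex j (simplex_vertex i) =
           (if i \<le> j then (simplex_vertex i, 0) else (simplex_vertex (i - 1), 1))"
proof -
  have "simplex_vertex i \<in> standard_simplex 2"
    using assms by (simp add: simplex_vertex_def)
  moreover have "(\<Sum>k\<le>2. g k * simplex_vertex i k) = g i" for g :: "nat \<Rightarrow> real"
  proof -
    have "(\<Sum>k\<le>2. g k * simplex_vertex i k) = (\<Sum>k\<le>2. if k = i then g i else 0)"
      by (rule sum.cong) (auto simp: simplex_vertex_def)
    then show ?thesis using assms by simp
  qed
  ultimately show ?thesis
    by (simp add: prism_simplex_def oriented_simplex_def)
qed

definition path_simplex_adjoint ::
  "((nat \<Rightarrow> real) \<Rightarrow> real \<Rightarrow> 'a) \<Rightarrow> (nat \<Rightarrow> real) \<times> real \<Rightarrow> 'a" where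
  "path_simplex_adjoint \<sigma> = (\<lambda>(x, s). \<sigma> x s)"

definition path_prism :: "(real \<Rightarrow> 'a) chain \<Rightarrow> 'a chain" where
  "path_prism =
     frag_extend
       (\<lambda>\<sigma>. frag_of (restrict (path_simplex_adjoint \<sigma> \<circ> prism_simplex 0) (standard_simplex 2))
          - frag_of (restrict (path_simplex_adjoint \<sigma> \<circ> prism_simplex 1) (standard_simplex 2)))"

definition path_cochain ::
  "'a topology \<Rightarrow> ('a chain \<Rightarrow> 'g) \<Rightarrow> (real \<Rightarrow> 'a) chain \<Rightarrow> 'g::ab_group_add" where
  "path_cochain X c =
     (\<lambda>x. if singular_chain 1 (path_space X) x then c (path_prism x) else 0)"

definition loop_cochain ::
  "'a topology \<Rightarrow> ('a chain \<Rightarrow> 'g) \<Rightarrow> (real \<Rightarrow> 'a) chain \<Rightarrow> 'g::ab_group_add" where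
  "loop_cochain X c =
     (\<lambda>x. cochain_pullback 1 (free_loop_space X) first_half (path_cochain X c) x
        - cochain_pullback 1 (free_loop_space X) second_half_rev (path_cochain X c) x)"

definition difference_cochain ::
  "'a topology \<Rightarrow> ('a chain \<Rightarrow> 'g) \<Rightarrow> ('a \<times> 'a) chain \<Rightarrow> 'g::ab_group_add" where
  "difference_cochain X c =
     (\<lambda>x. cochain_pullback 2 (prod_topology X X) snd c x
        - cochain_pullback 2 (prod_topology X X) fst c x)"

section \<open>Atoroidal classes and the TC-weight\<close>

definition torus :: "(complex \<times> complex) topology" where
  "torus = prod_topology (top_of_set (sphere 0 1)) (top_of_set (sphere 0 1))"

definition atoroidal :: "'a topology \<Rightarrow> ('a chain \<Rightarrow> 'g::ab_group_add) set \<Rightarrow> bool" where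
  "atoroidal X u \<longleftrightarrow>
     (\<forall>f. continuous_map torus X f \<longrightarrow>
          cohomology_induced 2 torus f u = \<one>\<^bsub>cohomology_group 2 torus\<^esub>)"

definition path_liftable_cover :: "'a topology \<Rightarrow> 'y topology \<Rightarrow> ('y \<Rightarrow> 'a \<times> 'a) \<Rightarrow> nat \<Rightarrow> bool" where
  "path_liftable_cover X Y f k \<longleftrightarrow>
     (\<exists>U. (\<forall>i\<in>{1..k}. openin Y (U i)) \<and> (\<Union>i\<in>{1..k}. U i) = topspace Y \<and>
          (\<forall>i\<in>{1..k}. \<exists>g. continuous_map (subtopology Y (U i)) (path_space X) g \<and>
                           (\<forall>y\<in>U i. path_ends (g y) = f y)))"

definition weight_at_least ::
  "'y itself \<Rightarrow> 'a topology \<Rightarrow> nat \<Rightarrow> (('a \<times> 'a) chain \<Rightarrow> 'g::ab_group_add) set \<Rightarrow> nat \<Rightarrow> bool" where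
  "weight_at_least (_ :: 'y itself) X p u k \<longleftrightarrow>
     (\<forall>(Y :: 'y topology) f.
        continuous_map Y (prod_topology X X) f \<longrightarrow> path_liftable_cover X Y f k \<longrightarrow>
        cohomology_induced p Y f u = \<one>\<^bsub>cohomology_group p Y\<^esub>)"

text \<open>The TC-weight of a class \<open>u \<in> H\<^sup>p(X \<times> X; A)\<close>, tested on all spaces \<open>Y\<close> whose points are
  taken from the type \<open>'y\<close>: HOL cannot quantify over types inside a definition, so the universe
  of test spaces is a parameter. A larger universe can only lower the value. The set of \<open>k\<close>
  below is downward closed and contains \<open>0\<close>, so the supremum is the largest \<open>k\<close>, or \<open>\<infinity>\<close>.\<close>

definition TC_weight ::
  "'y itself \<Rightarrow> 'a topology \<Rightarrow> nat \<Rightarrow> (('a \<times> 'a) chain \<Rightarrow> 'g::ab_group_add) set \<Rightarrow> enat" where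
  "TC_weight T X p u = Sup {enat k | k. weight_at_least T X p u k}"

text \<open>A universe is large if it has room for a copy of every point of the geometric realization of
  the singular complex of \<open>X\<close>, that is, for pairs of a singular simplex and a point of a
  standard simplex. This is a pure cardinality condition and every type embeds into a large one.\<close>

definition large_universe :: "'y itself \<Rightarrow> 'a topology \<Rightarrow> bool" where
  "large_universe (_ :: 'y itself) (X :: 'a topology) \<longleftrightarrow>
     (\<exists>e :: ((nat \<Rightarrow> real) \<Rightarrow> 'a) \<times> (nat \<Rightarrow> real) \<Rightarrow> 'y. inj e)"

lemma path_liftable_cover_mono:
  assumes "path_liftable_cover X Y f k" "k \<le> l"
  shows "path_liftable_cover X Y f l"
proof -
  obtain U where U: "\<forall>i\<in>{1..k}. openin Y (U i)" "(\<Union>i\<in>{1..k}. U i) = topspace Y"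
    "\<forall>i\<in>{1..k}. \<exists>g. continuous_map (subtopology Y (U i)) (path_space X) g \<and>
                       (\<forall>y\<in>U i. path_ends (g y) = f y)"
    using assms unfolding path_liftable_cover_def by blast
  let ?V = "\<lambda>i. if i \<in> {1..k} then U i else {}"
  have "(\<Union>i\<in>{1..l}. ?V i) = (\<Union>i\<in>{1..k}. U i)"
    using assms(2) by (fastforce split: if_splits)
  then have cover: "(\<Union>i\<in>{1..l}. ?V i) = topspace Y" using U(2) by (rule trans)
  have opens: "\<forall>i\<in>{1..l}. openin Y (?V i)" using U(1) by auto
  have lifts: "\<forall>i\<in>{1..l}. \<exists>g. continuous_map (subtopology Y (?V i)) (path_space X) g \<and>
                       (\<forall>y\<in>?V i. path_ends (g y) = f y)"
  proof
    fix i
    show "\<exists>g. continuous_map (subtopology Y (?V i)) (path_space X) g \<and>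
              (\<forall>y\<in>?V i. path_ends (g y) = f y)"
      using U(3) by (cases "i \<in> {1..k}") (auto simp: continuous_map_def)
  qed
  show ?thesis
    unfolding path_liftable_cover_def
    by (rule exI[of _ ?V]) (intro conjI opens cover lifts)
qed

lemma weight_at_least_antimono:
  "weight_at_least T X p u l \<Longrightarrow> k \<le> l \<Longrightarrow> weight_at_least T X p u k"
  unfolding weight_at_least_def using path_liftable_cover_mono by blast

end

theory Submission
  imports Defs "HOL-Analysis.Abstract_Topological_Spaces"
begin

text \<open>
  A 1-cocycle is a coboundary as soon as it vanishes on closed edges. A closed edge of the free
  loop space is a map of the torus to \<open>X\<close>, and on it \<open>a\<^sub>c\<close> is the value of \<open>c\<close> on the image of a
  2-cycle of the torus, which is zero because \<open>c\<close> is atoroidal.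

  The prism operator gives \<open>\<delta> b\<^sub>c = \<pi>\<^sup>*c'\<close> for the difference cochain \<open>c'\<close>. If a space is covered by two open
  sets on which \<open>f\<close> lifts to the path space, the pullbacks of \<open>b\<^sub>c\<close> along the lifts are primitives of
  \<open>f\<^sup>*c'\<close> whose difference on the overlap is pulled back from \<open>a\<^sub>c\<close>. Hence they can be corrected so as
  to agree there, and by subdivision \<open>f\<^sup>*c'\<close> is a coboundary. The space \<open>P\<^sub>2 X\<close> has such a cover.

  For the upper bound let \<open>Y\<close> be the 2-dimensional realization of the singular complex of \<open>X\<close>, mapped
  to \<open>X \<times> X\<close> by the base point of the component in the first and the canonical map in the second
  coordinate. The points near vertices, near edges, and inside triangles form three open sets, each
  with contractible components, so the map lifts over them, while the canonical map has a
  section on chains and therefore detects the class of \<open>c\<close>.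
\<close>

section \<open>Cochains\<close>

text \<open>The torus hypothesis controls only values on single closed edges of the loop space. In
  degree one such values decide whether a class vanishes, because integrating along chosen paths
  from a base point of each path component then gives a primitive. The upper bound has to hold for
  every topological space. Its test space must carry three local lifts and still detect
  \<open>c\<close>. On \<open>X \<times> X\<close> itself local lifts may fail to exist, since
  \<open>X\<close> need not be locally contractible. The realization of the singular complex is made
  of simplices instead, and a primitive in degree 2 is tested on 2-simplices, so cells up to
  dimension 2 are enough. A point of a 2-dimensional cell has one, two or three positive
  coordinates, which is the origin of the three regions. Keeping the first coordinate at a base
  point turns a lift into a continuous choice of paths from that point, and turns the difference
  cochain into \<open>c\<close> minus its value on constant triangles. Each point of the realization
  has a canonical name, a simplex with an interior point of it. Therefore any type with room for
  these names can carry the quotient.\<close>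

lemma singular_cochains_diff:
  assumes "c \<in> singular_cochains p X" "singular_chain p X x" "singular_chain p X y"
  shows "c (x - y) = c x - c y"
  using singular_cochains_add[OF assms(1) singular_chain_diff[OF assms(2,3)] assms(3)] by simp

lemma singular_cochains_minus:
  assumes "c \<in> singular_cochains p X" "singular_chain p X x"
  shows "c (- x) = - c x"
  using singular_cochains_diff[OF assms(1) singular_chain_0 assms(2)] singular_cochains_0[OF assms(1)]
  by simp

text \<open>Cochains of different spaces can never be compared as functions, because each is cut off
  to zero outside the chains of its own space. The comparison is therefore made on the chains of a
  third space \<open>W\<close>, typically an open subset.\<close>

lemma singular_cochains_agree_on:
  assumes "c \<in> singular_cochains p X" "d \<in> singular_cochains p Z" "singular_chain p W x"
    and "\<And>\<sigma>. singular_simplex p W \<sigma> \<Longrightarrow>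
           singular_simplex p X \<sigma> \<and> singular_simplex p Z \<sigma> \<and> c (frag_of \<sigma>) = d (frag_of \<sigma>)"
  shows "c x = d x"
proof -
  have "singular_chain p X x \<and> singular_chain p Z x \<and> c x = d x"
    using assms(3)[unfolded singular_chain_def]
  proof (induction rule: frag_induction)
    case zero
    then show ?case using assms(1,2) by (simp add: singular_cochains_0)
  next
    case (one \<sigma>)
    then show ?case using assms(4) by (simp add: singular_chain_of)
  next
    case (diff a b)
    then show ?case
      using assms(1,2) by (simp add: singular_cochains_diff singular_chain_diff)
  qed
  then show ?thesis by blast
qed

lemma singular_cochains_agree:
  assumes "c \<in> singular_cochains p X" "d \<in> singular_cochains p X" "singular_chain p X x"
    and "\<And>\<sigma>. singular_simplex p X \<sigma> \<Longrightarrow> c (frag_of \<sigma>) = d (frag_of \<sigma>)"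
  shows "c x = d x"
  using singular_cochains_agree_on[OF assms(1-3)] assms(4) by blast

lemma singular_cocycles_boundary:
  assumes "c \<in> singular_cocycles p X" "singular_chain (Suc p) X x"
  shows "c (chain_boundary (Suc p) x) = 0"
  using assms by (auto simp: singular_cocycles_def coboundary_def dest: fun_cong[where x=x])

lemma singular_cocycles_imp_cochains:
  "c \<in> singular_cocycles p X \<Longrightarrow> c \<in> singular_cochains p X"
  by (simp add: singular_cocycles_def)

lemma singular_coboundariesI:
  assumes "c \<in> singular_cochains (Suc p) X" "b \<in> singular_cochains p X"
    and "\<And>\<sigma>. singular_simplex (Suc p) X \<sigma> \<Longrightarrow> c (frag_of \<sigma>) = b (chain_boundary (Suc p) (frag_of \<sigma>))"
  shows "c \<in> singular_coboundaries (Suc p) X"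
proof -
  have "c x = coboundary p X b x" for x
  proof (cases "singular_chain (Suc p) X x")
    case True
    show ?thesis
      by (rule singular_cochains_agree[OF assms(1) coboundary_in_cochains[OF assms(2)] True])
         (simp add: assms coboundary_def singular_chain_of)
  next
    case False
    then show ?thesis
      using assms(1) by (simp add: singular_cochains_outside coboundary_def)
  qed
  then show ?thesis
    using assms(2) by (auto simp: singular_coboundaries_def)
qed

lemma singular_coboundariesE:
  assumes "c \<in> singular_coboundaries (Suc p) X"
  obtains b where "b \<in> singular_cochains p X"
    "\<And>x. singular_chain (Suc p) X x \<Longrightarrow> c x = b (chain_boundary (Suc p) x)"
  using assms by (auto simp: singular_coboundaries_def coboundary_def)

text \<open>The dual of the linear extension of \<open>h\<close>, cut off as the convention for
  cochains requires. With \<open>h\<close> equal to \<open>frag_of\<close> on some simplices and 0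
  on the others, it extends a cochain by zero.\<close>

definition cochain_compose ::
  "nat \<Rightarrow> 'b topology \<Rightarrow> (((nat \<Rightarrow> real) \<Rightarrow> 'b) \<Rightarrow> 'a chain) \<Rightarrow> ('a chain \<Rightarrow> 'g) \<Rightarrow> 'b chain \<Rightarrow> 'g::ab_group_add"
  where "cochain_compose p Y h c = (\<lambda>x. if singular_chain p Y x then c (frag_extend h x) else 0)"

lemma singular_chain_frag_extend:
  assumes "singular_chain p Y x" "\<And>\<sigma>. singular_simplex p Y \<sigma> \<Longrightarrow> singular_chain q Z (h \<sigma>)"
  shows "singular_chain q Z (frag_extend h x)"
  by (rule singular_chain_extend) (use assms in \<open>auto simp: singular_chain_def\<close>)

lemma cochain_compose_in_cochains:
  assumes "c \<in> singular_cochains q Z" "\<And>\<sigma>. singular_simplex p Y \<sigma> \<Longrightarrow> singular_chain q Z (h \<sigma>)"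
  shows "cochain_compose p Y h c \<in> singular_cochains p Y"
  by (rule singular_cochainsI)
    (auto simp: cochain_compose_def frag_extend_add singular_chain_add
      intro!: singular_cochains_add[OF assms(1)] singular_chain_frag_extend assms(2))

lemma cochain_compose_of:
  "singular_simplex p Y \<sigma> \<Longrightarrow> cochain_compose p Y h c (frag_of \<sigma>) = c (h \<sigma>)"
  by (simp add: cochain_compose_def singular_chain_of)

lemma cohomology_induced_class_eq_zero_iff:
  assumes "continuous_map Y X f"
  shows "cohomology_induced p Y f (cohomology_class p X c) = \<one>\<^bsub>cohomology_group p Y\<^esub> \<longleftrightarrow>
    cochain_pullback p Y f c \<in> singular_coboundaries p Y"
  unfolding cohomology_induced_class[OF assms] by (rule cohomology_class_eq_zero_iff)

lemma shows chain_boundary_of_1: "chain_boundary (Suc 0) (frag_of \<sigma>) =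
      frag_of (singular_face 1 0 \<sigma>) - frag_of (singular_face 1 1 \<sigma>)"
    and chain_boundary_of_2: "chain_boundary 2 (frag_of \<sigma>) =
      frag_of (singular_face 2 0 \<sigma>) - frag_of (singular_face 2 1 \<sigma>) + frag_of (singular_face 2 2 \<sigma>)"
    and chain_boundary_of_3: "chain_boundary 3 (frag_of \<sigma>) =
      frag_of (singular_face 3 0 \<sigma>) - frag_of (singular_face 3 1 \<sigma>) + frag_of (singular_face 3 2 \<sigma>)
       - frag_of (singular_face 3 3 \<sigma>)"
  by (simp_all add: chain_boundary_of numeral_2_eq_2 numeral_3_eq_3)

section \<open>The path space\<close>

abbreviation (input) I01 :: "real topology" where "I01 \<equiv> top_of_set {0..1}"

text \<open>Evaluation of paths is continuous because \<open>[0,1]\<close> is locally compact; the converse is the tube lemma.\<close>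

lemma continuous_map_path_space:
  "continuous_map Z (path_space X) g \<longleftrightarrow>
     continuous_map (prod_topology Z I01) X (\<lambda>(z, s). g z s) \<and>
     (\<forall>z\<in>topspace Z. g z \<in> extensional {0..1})" (is "?L \<longleftrightarrow> ?R")
proof
  assume L: ?L
  then have top: "g z \<in> extensional {0..1}" "continuous_map I01 X (g z)" if "z \<in> topspace Z" for z
    using that by (auto simp: continuous_map_def topspace_path_space pathin_def)
  have nbh: "\<exists>W. openin (prod_topology Z I01) W \<and> (z, s) \<in> W \<and> (\<forall>(z', s')\<in>W. g z' s' \<in> U)"
    if z: "z \<in> topspace Z" and s: "s \<in> {0..1}" and U: "openin X U" and gU: "g z s \<in> U" for z s U
  proof -
    have "openin I01 {s \<in> topspace I01. g z s \<in> U}"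
      using openin_continuous_map_preimage[OF top(2)[OF z] U] .
    then obtain e where e: "e > 0" "\<And>r. r \<in> {0..1} \<Longrightarrow> dist r s < e \<Longrightarrow> g z r \<in> U"
      using s gU unfolding openin_euclidean_subtopology_iff by auto
    \<comment> \<open>Half the radius: the closed ball makes \<open>K\<close> compact and still lies
      inside the open ball of radius \<open>e\<close>.\<close>
    define K where "K = {0..1} \<inter> cball s (e/2)"
    have K: "compactin I01 K"
      by (auto simp: K_def compactin_subtopology intro: compact_Int_closed)
    define V where "V = {f \<in> extensional {0..1}. continuous_map I01 X f \<and> f ` K \<subseteq> U}"
    have "openin (path_space X) V"
      unfolding path_space_def compact_open_topology_def V_def
      by (rule topology_generated_by_Basis) (use K U in auto)
    then have "openin Z {z \<in> topspace Z. g z \<in> V}"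
      using openin_continuous_map_preimage[OF L] by blast
    moreover have "openin I01 ({0..1} \<inter> ball s (e/2))" by blast
    ultimately have "openin (prod_topology Z I01) ({z \<in> topspace Z. g z \<in> V} \<times> ({0..1} \<inter> ball s (e/2)))"
      by (simp add: openin_prod_Times_iff)
    moreover have "g z \<in> V"
      using top[OF z] e by (auto simp: V_def K_def dist_commute)
    ultimately show ?thesis
      using z s e(1) by (intro exI[of _ "{z \<in> topspace Z. g z \<in> V} \<times> ({0..1} \<inter> ball s (e/2))"])
        (auto simp: V_def K_def image_subset_iff)
  qed
  have "continuous_map (prod_topology Z I01) X (\<lambda>(z, s). g z s)"
    unfolding continuous_map_def
  proof (intro conjI allI impI)
    show "(\<lambda>(z, s). g z s) \<in> topspace (prod_topology Z I01) \<rightarrow> topspace X"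
    proof
      fix p assume "p \<in> topspace (prod_topology Z I01)"
      then have "fst p \<in> topspace Z" "snd p \<in> topspace I01" by (simp_all add: mem_Times_iff)
      then show "(case p of (z, s) \<Rightarrow> g z s) \<in> topspace X"
        using continuous_map_image_subset_topspace[OF top(2)] by (simp add: case_prod_unfold image_subset_iff)
    qed
    fix U assume U: "openin X U"
    let ?O = "{p \<in> topspace (prod_topology Z I01). (case p of (z, s) \<Rightarrow> g z s) \<in> U}"
    have "\<exists>W. openin (prod_topology Z I01) W \<and> p \<in> W \<and> W \<subseteq> ?O" if p: "p \<in> ?O" for p
    proof -
      obtain z s where zs: "p = (z, s)" "z \<in> topspace Z" "s \<in> {0..1}" "g z s \<in> U"
        using p by auto
      obtain W where "openin (prod_topology Z I01) W" "p \<in> W" "\<forall>(z', s')\<in>W. g z' s' \<in> U"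
        using nbh[OF zs(2,3) U zs(4)] zs(1) by blast
      moreover from this(1) have "W \<subseteq> topspace (prod_topology Z I01)" by (rule openin_subset)
      ultimately show ?thesis
        using p by (intro exI[of _ W]) auto
    qed
    then show "openin (prod_topology Z I01) ?O"
      by (subst openin_subopen) blast
  qed
  then show ?R
    using top(1) by blast
next
  assume R: ?R
  let ?G = "\<lambda>(z, s). g z s"
  have path: "continuous_map I01 X (g z)" if "z \<in> topspace Z" for z
  proof -
    have "continuous_map I01 (prod_topology Z I01) (\<lambda>s. (z, s))"
      using that by (auto intro: continuous_map_pairedI)
    from continuous_map_compose[OF this R[THEN conjunct1]] show ?thesis
      by (simp add: o_def)
  qed
  show ?L
    unfolding path_space_def compact_open_topology_def
  proof (rule continuous_on_generated_topo)
    show "g ` topspace Z \<subseteq> \<Union> {{f \<in> extensional (topspace I01). continuous_map I01 X f \<and> f ` K \<subseteq> U} |K U.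
           compactin I01 K \<and> openin X U}"
    proof
      fix f assume "f \<in> g ` topspace Z"
      \<comment> \<open>The subbasic set for empty \<open>K\<close> and empty \<open>U\<close> is
        the set of all paths.\<close>
      then have "f \<in> {f \<in> extensional (topspace I01). continuous_map I01 X f \<and> f ` {} \<subseteq> {}}"
        using R path by auto
      then show "f \<in> \<Union> {{f \<in> extensional (topspace I01). continuous_map I01 X f \<and> f ` K \<subseteq> U} |K U.
           compactin I01 K \<and> openin X U}"
        using compactin_empty openin_empty by blast
    qed
  next
    fix W assume "W \<in> {{f \<in> extensional (topspace I01). continuous_map I01 X f \<and> f ` K \<subseteq> U} |K U.
           compactin I01 K \<and> openin X U}"
    then obtain K U where W: "W = {f \<in> extensional {0..1}. continuous_map I01 X f \<and> f ` K \<subseteq> U}"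
      and K: "compactin I01 K" and U: "openin X U" by auto
    define O' where "O' = {p \<in> topspace (prod_topology Z I01). ?G p \<in> U}"
    have O': "openin (prod_topology Z I01) O'"
      unfolding O'_def using openin_continuous_map_preimage R U by blast
    have "\<exists>T. openin Z T \<and> z \<in> T \<and> T \<subseteq> g -` W \<inter> topspace Z" if z: "z \<in> g -` W \<inter> topspace Z" for z
    proof -
      have KI: "K \<subseteq> {0..1}" using compactin_subset_topspace[OF K] by simp
      have "{z} \<times> K \<subseteq> O'" using z W KI by (auto simp: O'_def)
      then obtain A B where AB: "openin Z A" "z \<in> A" "K \<subseteq> B" "A \<times> B \<subseteq> O'"
        using tube_lemma_right[OF O' K, of z] z by auto
      have "A \<subseteq> g -` W \<inter> topspace Z"
      proof
        fix y assume y: "y \<in> A"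
        then have "y \<in> topspace Z" using AB(1) openin_subset by blast
        moreover have "g y s \<in> U" if "s \<in> K" for s
        proof -
          have "(y, s) \<in> O'" using AB(3,4) y that by blast
          then show ?thesis by (simp add: O'_def)
        qed
        ultimately show "y \<in> g -` W \<inter> topspace Z"
          using R path W by auto
      qed
      then show ?thesis using AB(1,2) by (intro exI[of _ A] conjI)
    qed
    then show "openin Z (g -` W \<inter> topspace Z)"
      by (subst openin_subopen) (rule ballI)
  qed
qed

lemma continuous_map_path_spaceI:
  assumes "continuous_map (prod_topology Z I01) X (\<lambda>(z, s). g z s)"
  shows "continuous_map Z (path_space X) (\<lambda>z. restrict (g z) {0..1})"
  unfolding continuous_map_path_space
  by (auto intro!: continuous_map_eq[OF assms])

lemma continuous_map_path_space_eval:
  assumes "continuous_map Z (path_space X) g" "continuous_map Z I01 h"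
  shows "continuous_map Z X (\<lambda>z. g z (h z))"
proof -
  have "continuous_map Z (prod_topology Z I01) (\<lambda>z. (z, h z))"
    using assms(2) by (auto intro: continuous_map_pairedI)
  moreover have "continuous_map (prod_topology Z I01) X (\<lambda>(z, s). g z s)"
    using assms(1) by (simp add: continuous_map_path_space)
  ultimately have "continuous_map Z X ((\<lambda>(z, s). g z s) \<circ> (\<lambda>z. (z, h z)))"
    by (rule continuous_map_compose)
  then show ?thesis
    by (simp add: o_def)
qed

lemma continuous_map_reparam:
  assumes "continuous_map Z (path_space X) g" "continuous_map I01 I01 \<phi>"
  shows "continuous_map Z (path_space X) (\<lambda>z. restrict (\<lambda>s. g z (\<phi> s)) {0..1})"
proof (rule continuous_map_path_spaceI)
  have "continuous_map (prod_topology Z I01) I01 (\<lambda>p. \<phi> (snd p))"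
    using continuous_map_compose[OF continuous_map_snd assms(2)] by (simp add: o_def)
  moreover have "continuous_map (prod_topology Z I01) (path_space X) (\<lambda>p. g (fst p))"
    using continuous_map_compose[OF continuous_map_fst assms(1)] by (simp add: o_def)
  ultimately show "continuous_map (prod_topology Z I01) X (\<lambda>(z, s). g z (\<phi> s))"
    unfolding case_prod_unfold by (rule continuous_map_path_space_eval[rotated])
qed

lemma continuous_map_first_half: "continuous_map (path_space X) (path_space X) first_half"
proof -
  have "continuous_map I01 I01 (\<lambda>s. s / 2)"
    by (auto simp: continuous_map_in_subtopology intro!: continuous_intros)
  from continuous_map_reparam[OF continuous_map_id this, unfolded id_def] show ?thesis
    by (simp add: first_half_def[abs_def])
qed

lemma continuous_map_second_half_rev: "continuous_map (path_space X) (path_space X) second_half_rev"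
proof -
  have "continuous_map I01 I01 (\<lambda>s. 1 - s / 2)"
    by (auto simp: continuous_map_in_subtopology intro!: continuous_intros)
  from continuous_map_reparam[OF continuous_map_id this, unfolded id_def] show ?thesis
    by (simp add: second_half_rev_def[abs_def])
qed

lemma continuous_map_loop_halves:
  "continuous_map (free_loop_space X) (path_space X) first_half"
  "continuous_map (free_loop_space X) (path_space X) second_half_rev"
  by (simp_all add: free_loop_space_def continuous_map_from_subtopology
      continuous_map_first_half continuous_map_second_half_rev)

lemma continuous_map_path_ends: "continuous_map (path_space X) (prod_topology X X) path_ends"
  unfolding path_ends_def[abs_def]
  by (intro continuous_map_pairedI continuous_map_path_space_eval[OF continuous_map_id, unfolded id_def])
     (auto simp: continuous_map_in_subtopology)

definition path_join :: "(real \<Rightarrow> 'a) \<Rightarrow> (real \<Rightarrow> 'a) \<Rightarrow> real \<Rightarrow> 'a" where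
  "path_join \<alpha> \<beta> = restrict (\<lambda>s. if s \<le> 1/2 then \<alpha> (2 * s) else \<beta> (2 * s - 1)) {0..1}"

lemma continuous_map_path_join:
  assumes "continuous_map Z (path_space X) f" "continuous_map Z (path_space X) g"
    and "\<And>z. z \<in> topspace Z \<Longrightarrow> f z 1 = g z 0"
  shows "continuous_map Z (path_space X) (\<lambda>z. path_join (f z) (g z))"
  unfolding path_join_def
proof (rule continuous_map_path_spaceI)
  let ?P = "prod_topology Z I01"
  have fst: "continuous_map (subtopology ?P T) (path_space X) (\<lambda>p. h (fst p))"
    if "continuous_map Z (path_space X) h" for T h
    using continuous_map_from_subtopology[OF continuous_map_compose[OF continuous_map_fst that]]
    by (simp add: o_def)
  have snd: "continuous_map ?P euclideanreal snd"
    using continuous_map_snd[of Z I01] by (auto simp: continuous_map_in_subtopology)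
  have "continuous_map ?P X (\<lambda>p. if snd p \<le> 1/2 then f (fst p) (2 * snd p) else g (fst p) (2 * snd p - 1))"
  proof (rule continuous_map_cases_le[OF snd])
    show "continuous_map (subtopology ?P {x \<in> topspace ?P. snd x \<le> 1 / 2}) X (\<lambda>p. f (fst p) (2 * snd p))"
      by (rule continuous_map_path_space_eval[OF fst[OF assms(1)]])
         (auto simp: continuous_map_in_subtopology intro!: continuous_intros continuous_map_from_subtopology snd)
    show "continuous_map (subtopology ?P {x \<in> topspace ?P. 1 / 2 \<le> snd x}) X (\<lambda>p. g (fst p) (2 * snd p - 1))"
      by (rule continuous_map_path_space_eval[OF fst[OF assms(2)]])
         (auto simp: continuous_map_in_subtopology intro!: continuous_intros continuous_map_from_subtopology snd)
    fix p assume p: "p \<in> topspace ?P" "snd p = 1 / 2"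
    show "f (fst p) (2 * snd p) = g (fst p) (2 * snd p - 1)"
    proof -
      have "fst p \<in> topspace Z" using p(1) by (simp add: mem_Times_iff)
      from assms(3)[OF this] show ?thesis unfolding p(2) by simp
    qed
  qed simp
  then show "continuous_map ?P X (\<lambda>(z, s). if s \<le> 1/2 then f z (2 * s) else g z (2 * s - 1))"
    by (simp add: case_prod_unfold)
qed

section \<open>The prism operator\<close>

abbreviation (input) simplex_top :: "nat \<Rightarrow> (nat \<Rightarrow> real) topology" where
  "simplex_top p \<equiv> subtopology (powertop_real UNIV) (standard_simplex p)"

text \<open>The composite of \<open>\<Phi>\<close> with an affine simplex in \<open>\<Delta>\<^sub>q \<times> [0,1]\<close>, coded by the list of its vertices:
  the pair \<open>(i, t)\<close> stands for \<open>(v\<^sub>i, t)\<close>.\<close>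

definition prism_vertices_simplex ::
  "((nat \<Rightarrow> real) \<times> real \<Rightarrow> 'a) \<Rightarrow> (nat \<times> real) list \<Rightarrow> (nat \<Rightarrow> real) \<Rightarrow> 'a" where
  "prism_vertices_simplex \<Phi> ws =
     restrict (\<lambda>x. \<Phi> (\<lambda>m. \<Sum>i<length ws. if fst (ws ! i) = m then x i else 0,
                      \<Sum>i<length ws. snd (ws ! i) * x i))
       (standard_simplex (length ws - 1))"

lemma continuous_map_simplex_coordinate:
  "continuous_map (simplex_top p) euclideanreal (\<lambda>x. x i)"
  by (intro continuous_map_from_subtopology continuous_map_product_projection) simp

lemma sum_lessThan_standard_simplex:
  "x \<in> standard_simplex p \<Longrightarrow> n = Suc p \<Longrightarrow> sum x {..<n} = 1"
  by (simp add: standard_simplex_def lessThan_Suc_atMost)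

text \<open>Barycentric coordinates are pushed forward along the vertex map \<open>w\<close>.
  Summing over the fibres of \<open>w\<close> preserves the total mass 1, and this also bounds each
  new coordinate.\<close>

lemma standard_simplex_reindex:
  assumes x: "x \<in> standard_simplex p" and n: "n = Suc p" and w: "\<And>i. i < n \<Longrightarrow> w i \<le> q"
  shows "(\<lambda>m. \<Sum>i<n. if w i = m then x i else 0) \<in> standard_simplex q"
proof -
  have x0: "0 \<le> x i" for i
    using x by (simp add: standard_simplex_def)
  have s1: "sum x {..<n} = 1"
    using sum_lessThan_standard_simplex[OF x n] .
  have "(\<Sum>i<n. if w i = m then x i else 0) \<le> sum x {..<n}" for m
    by (rule sum_mono) (simp add: x0)
  moreover have "(\<Sum>m\<le>q. \<Sum>i<n. if w i = m then x i else 0) = (\<Sum>i<n. \<Sum>m\<le>q. if w i = m then x i else 0)"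
    by (rule sum.swap)
  moreover have "\<dots> = sum x {..<n}"
    by (rule sum.cong) (use w in auto)
  moreover have "(\<Sum>i<n. if w i = m then x i else 0) = 0" if "m > q" for m
    by (rule sum.neutral) (use w that in force)
  ultimately show ?thesis
    using s1 by (auto simp: standard_simplex_def x0 intro!: sum_nonneg)
qed

lemma prism_vertices_in_prism:
  assumes ws: "length ws = Suc p" "\<And>w. w \<in> set ws \<Longrightarrow> fst w \<le> q \<and> 0 \<le> snd w \<and> snd w \<le> 1"
    and x: "x \<in> standard_simplex p"
  shows "(\<lambda>m. \<Sum>i<length ws. if fst (ws ! i) = m then x i else 0) \<in> standard_simplex q"
    and "(\<Sum>i<length ws. snd (ws ! i) * x i) \<in> {0..1}"
proof -
  have w: "fst (ws ! i) \<le> q" "0 \<le> snd (ws ! i)" "snd (ws ! i) \<le> 1" if "i < length ws" for i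
    using ws(2)[OF nth_mem[OF that]] by auto
  show "(\<lambda>m. \<Sum>i<length ws. if fst (ws ! i) = m then x i else 0) \<in> standard_simplex q"
    by (rule standard_simplex_reindex[OF x ws(1)]) (use w in auto)
  have x0: "0 \<le> x i" for i
    using x by (simp add: standard_simplex_def)
  have "(\<Sum>i<length ws. snd (ws ! i) * x i) \<le> (\<Sum>i<length ws. x i)"
    by (rule sum_mono) (use w x0 in \<open>auto intro: mult_left_le_one_le\<close>)
  then show "(\<Sum>i<length ws. snd (ws ! i) * x i) \<in> {0..1}"
    using w x0 sum_lessThan_standard_simplex[OF x ws(1)] by (auto intro!: sum_nonneg)
qed

lemma singular_simplex_restrictI:
  assumes "continuous_map (simplex_top p) X f"
  shows "singular_simplex p X (restrict f (standard_simplex p))"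
  unfolding singular_simplex_def using continuous_map_eq[OF assms] by simp

lemma singular_simplex_prism_vertices:
  assumes \<Phi>: "continuous_map (prod_topology (simplex_top q) I01) X \<Phi>"
    and ws: "length ws = Suc p" "\<And>w. w \<in> set ws \<Longrightarrow> fst w \<le> q \<and> 0 \<le> snd w \<and> snd w \<le> 1"
  shows "singular_simplex p X (prism_vertices_simplex \<Phi> ws)"
proof -
  let ?f = "\<lambda>x :: nat \<Rightarrow> real. (\<lambda>m. \<Sum>i<length ws. if fst (ws ! i) = m then x i else 0)"
  let ?g = "\<lambda>x :: nat \<Rightarrow> real. \<Sum>i<length ws. snd (ws ! i) * x i"
  have "?f x \<in> standard_simplex q" "?g x \<in> {0..1}" if "x \<in> standard_simplex p" for x
    using prism_vertices_in_prism[OF ws that] by auto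
  moreover have "continuous_map (simplex_top p) (powertop_real UNIV) ?f"
    unfolding continuous_map_componentwise_UNIV
  proof
    fix m
    have "continuous_map (simplex_top p) euclideanreal (\<lambda>x. if fst (ws ! i) = m then x i else 0)" for i
      by (cases "fst (ws ! i) = m") (simp_all add: continuous_map_simplex_coordinate)
    then show "continuous_map (simplex_top p) euclideanreal (\<lambda>x. ?f x m)"
      by (intro continuous_map_sum) auto
  qed
  moreover have "continuous_map (simplex_top p) euclideanreal ?g"
    by (intro continuous_intros continuous_map_simplex_coordinate) auto
  ultimately have "continuous_map (simplex_top p) (prod_topology (simplex_top q) I01) (\<lambda>x. (?f x, ?g x))"
    by (intro continuous_map_pairedI) (auto simp: continuous_map_in_subtopology)
  from singular_simplex_restrictI[OF continuous_map_compose[OF this \<Phi>]] show ?thesis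
    by (simp add: prism_vertices_simplex_def ws(1) o_def)
qed

lemma prism_vertices_simplex_eqI:
  assumes "length ws = Suc p" "length us = Suc p"
    "\<And>x. x \<in> standard_simplex p \<Longrightarrow>
        \<Phi> (\<lambda>m. \<Sum>i<Suc p. if fst (ws ! i) = m then x i else 0, \<Sum>i<Suc p. snd (ws ! i) * x i) =
        \<Psi> (\<lambda>m. \<Sum>i<Suc p. if fst (us ! i) = m then x i else 0, \<Sum>i<Suc p. snd (us ! i) * x i)"
  shows "prism_vertices_simplex \<Phi> ws = prism_vertices_simplex \<Psi> us"
  using assms by (auto simp: prism_vertices_simplex_def restrict_def)

text \<open>The face map inserts a zero at place \<open>k\<close>. This removes the summand of the
  \<open>k\<close>-th vertex from both defining sums, and the other summands are reindexed.\<close>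

lemma singular_face_prism_vertices:
  assumes "length ws = Suc p" "1 \<le> p" "k \<le> p"
  shows "singular_face p k (prism_vertices_simplex \<Phi> ws) =
    prism_vertices_simplex \<Phi> (take k ws @ drop (Suc k) ws)"
proof -
  let ?us = "take k ws @ drop (Suc k) ws"
  have len: "length ?us = p" using assms by simp
  \<comment> \<open>\<open>F\<close> stands for the summands of the simplex coordinates and of the
    height alike; what matters is that a zero coordinate contributes nothing.\<close>
  have *: "(\<Sum>i<Suc p. F (ws ! i) (simplical_face k x i)) = (\<Sum>i<p. F (?us ! i) (x i))"
    if F: "\<And>w. F w 0 = (0::real)" for F and x :: "nat \<Rightarrow> real"
  proof -
    have "(\<Sum>i<Suc p. F (ws ! i) (simplical_face k x i)) =
        (\<Sum>i\<in>{..<Suc p} - {k}. F (ws ! i) (simplical_face k x i))"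
      by (rule sum.mono_neutral_right) (auto simp: simplical_face_def F)
    also have "\<dots> = (\<Sum>i<p. F (?us ! i) (x i))"
      by (rule sum.reindex_bij_witness[of _ "\<lambda>i. if i < k then i else Suc i" "\<lambda>i. if i < k then i else i - 1"])
         (use assms in \<open>auto simp: simplical_face_def nth_append split: if_splits\<close>)
    finally show ?thesis .
  qed
  show ?thesis
  proof
    fix x
    show "singular_face p k (prism_vertices_simplex \<Phi> ws) x = prism_vertices_simplex \<Phi> ?us x"
    proof (cases "x \<in> standard_simplex (p - Suc 0)")
      case True
      then show ?thesis
        using *[of "\<lambda>w t. snd w * t" x] *[of "\<lambda>w t. if fst w = m then t else 0" x for m] assms len
        by (simp add: singular_face_def prism_vertices_simplex_def simplical_face_in_standard_simplex
            del: sum.lessThan_Suc)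
    next
      case False
      then show ?thesis
        using len by (simp add: singular_face_def prism_vertices_simplex_def)
    qed
  qed
qed

lemma chain_boundary_prism_vertices_2:
  "chain_boundary 2 (frag_of (prism_vertices_simplex \<Phi> [u, v, w])) =
     frag_of (prism_vertices_simplex \<Phi> [v, w]) - frag_of (prism_vertices_simplex \<Phi> [u, w])
      + frag_of (prism_vertices_simplex \<Phi> [u, v])"
  by (simp add: chain_boundary_of_2 singular_face_prism_vertices)

lemma chain_boundary_prism_vertices_3:
  "chain_boundary 3 (frag_of (prism_vertices_simplex \<Phi> [u, v, w, z])) =
     frag_of (prism_vertices_simplex \<Phi> [v, w, z]) - frag_of (prism_vertices_simplex \<Phi> [u, w, z])
      + frag_of (prism_vertices_simplex \<Phi> [u, v, z]) - frag_of (prism_vertices_simplex \<Phi> [u, v, w])"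
  unfolding chain_boundary_of_3 by (simp add: singular_face_prism_vertices eval_nat_numeral)

definition prism_chain :: "((nat \<Rightarrow> real) \<times> real \<Rightarrow> 'a) \<Rightarrow> 'a chain" where
  "prism_chain \<Phi> = frag_of (prism_vertices_simplex \<Phi> [(0,0), (0,1), (1,1)])
     - frag_of (prism_vertices_simplex \<Phi> [(0,0), (1,0), (1,1)])"

text \<open>Both affine maps are determined by their three vertices. From here on triangles are
  handled as vertex lists, where taking a face means deleting an entry.\<close>

lemma restrict_prism_simplex:
  "restrict (\<Phi> \<circ> prism_simplex 0) (standard_simplex 2) = prism_vertices_simplex \<Phi> [(0,0), (0,1), (1,1)]"
  "restrict (\<Phi> \<circ> prism_simplex 1) (standard_simplex 2) = prism_vertices_simplex \<Phi> [(0,0), (1,0), (1,1)]"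
proof -
  have "prism_simplex 0 x = (\<lambda>m. \<Sum>i<3. if fst ([(0,0), (0,1), (1,1)] ! i) = m then x i else 0,
          \<Sum>i<3. snd ([(0::nat,0::real), (0,1), (1,1)] ! i) * x i)"
       "prism_simplex 1 x = (\<lambda>m. \<Sum>i<3. if fst ([(0,0), (1,0), (1,1)] ! i) = m then x i else 0,
          \<Sum>i<3. snd ([(0::nat,0::real), (1,0), (1,1)] ! i) * x i)"
    if "x \<in> standard_simplex 2" for x
    using that
    by (auto simp: prism_simplex_def oriented_simplex_def simplex_vertex_def fun_eq_iff
        eval_nat_numeral)
  then show "restrict (\<Phi> \<circ> prism_simplex 0) (standard_simplex 2) = prism_vertices_simplex \<Phi> [(0,0), (0,1), (1,1)]"
    "restrict (\<Phi> \<circ> prism_simplex 1) (standard_simplex 2) = prism_vertices_simplex \<Phi> [(0,0), (1,0), (1,1)]"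
    by (auto simp: prism_vertices_simplex_def restrict_def fun_eq_iff eval_nat_numeral)
qed

lemma path_prism_of: "path_prism (frag_of \<sigma>) = prism_chain (path_simplex_adjoint \<sigma>)"
  unfolding path_prism_def prism_chain_def frag_extend_of restrict_prism_simplex ..

lemma singular_chain_prism_chain:
  assumes "continuous_map (prod_topology (simplex_top 1) I01) X \<Phi>"
  shows "singular_chain 2 X (prism_chain \<Phi>)"
  unfolding prism_chain_def
  by (intro singular_chain_diff singular_chain_of[THEN iffD2] singular_simplex_prism_vertices[OF assms])
     auto

lemma continuous_map_path_simplex_adjoint:
  assumes "singular_simplex p (path_space X) \<sigma>"
  shows "continuous_map (prod_topology (simplex_top p) I01) X (path_simplex_adjoint \<sigma>)"
  using assms by (simp add: singular_simplex_def continuous_map_path_space path_simplex_adjoint_def)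

text \<open>The face map is affine and sends vertices to vertices, so precomposing with it only
  renames the first components of the list and leaves the heights alone.\<close>

lemma prism_vertices_simplex_face_adjoint:
  assumes "length ws = Suc p" "k \<le> Suc q" "\<And>w. w \<in> set ws \<Longrightarrow> fst w \<le> q"
  shows "prism_vertices_simplex (path_simplex_adjoint (singular_face (Suc q) k \<sigma>)) ws =
    prism_vertices_simplex (path_simplex_adjoint \<sigma>) (map (\<lambda>(i, t). (if i < k then i else Suc i, t)) ws)"
proof (rule prism_vertices_simplex_eqI[OF assms(1)])
  fix x :: "nat \<Rightarrow> real" assume x: "x \<in> standard_simplex p"
  let ?us = "map (\<lambda>(i, t). (if i < k then i else Suc i, t)) ws"
  let ?y = "\<lambda>m. \<Sum>i<Suc p. if fst (ws ! i) = m then x i else 0"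
  have y: "?y \<in> standard_simplex q"
    by (rule standard_simplex_reindex[OF x]) (use assms in \<open>auto simp: nth_mem\<close>)
  have us: "?us ! i = (if fst (ws ! i) < k then fst (ws ! i) else Suc (fst (ws ! i)), snd (ws ! i))"
    if "i < Suc p" for i
    using that assms(1) by (simp add: case_prod_unfold)
  have "simplical_face k ?y = (\<lambda>m. \<Sum>i<Suc p. if fst (?us ! i) = m then x i else 0)"
  proof
    fix m
    have "(\<Sum>i<Suc p. if fst (?us ! i) = m then x i else 0) =
      (\<Sum>i<Suc p. if (if fst (ws ! i) < k then fst (ws ! i) else Suc (fst (ws ! i))) = m then x i else 0)"
      by (rule sum.cong) (simp_all add: us)
    \<comment> \<open>A renamed vertex is never \<open>k\<close>. It equals \<open>m\<close> exactly
      when the old vertex is \<open>m\<close>, for \<open>m\<close> below \<open>k\<close>, or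
      \<open>m - 1\<close>, for \<open>m\<close> above \<open>k\<close>.\<close>
    also have "\<dots> = (\<Sum>i<Suc p. if m < k then if fst (ws ! i) = m then x i else 0
       else if m = k then 0 else if fst (ws ! i) = m - 1 then x i else 0)"
      by (rule sum.cong) auto
    also have "\<dots> = simplical_face k ?y m"
      by (simp add: simplical_face_def del: sum.lessThan_Suc)
    finally show "simplical_face k ?y m = (\<Sum>i<Suc p. if fst (?us ! i) = m then x i else 0)"
      by (rule sym)
  qed
  moreover have "(\<Sum>i<Suc p. snd (?us ! i) * x i) = (\<Sum>i<Suc p. snd (ws ! i) * x i)"
    by (rule sum.cong) (simp_all add: us)
  ultimately show "path_simplex_adjoint (singular_face (Suc q) k \<sigma>) (?y, \<Sum>i<Suc p. snd (ws ! i) * x i) =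
     path_simplex_adjoint \<sigma> (\<lambda>m. \<Sum>i<Suc p. if fst (?us ! i) = m then x i else 0,
         \<Sum>i<Suc p. snd (?us ! i) * x i)"
    using y by (simp only: path_simplex_adjoint_def prod.case singular_face_def diff_Suc_Suc diff_zero
        restrict_apply' o_def)
qed (use assms in simp)

text \<open>For vertices at one common height the first component is the identity, and the height is
  constantly \<open>s\<close> because the coordinates sum to 1.\<close>

lemma prism_vertices_simplex_end:
  assumes "s \<in> {0..1}"
  shows "prism_vertices_simplex (path_simplex_adjoint \<sigma>) [(0,s), (1,s), (2,s)] = simplex_map 2 (\<lambda>\<gamma>. \<gamma> s) \<sigma>"
proof -
  have "(\<lambda>m. \<Sum>i<3. if fst ([(0,s), (1,s), (2,s)] ! i) = m then x i else 0) = x"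
    and "(\<Sum>i<3. snd ([(0::nat,s), (1,s), (2,s)] ! i) * x i) = s"
    if "x \<in> standard_simplex 2" for x
  proof -
    have "x m = 0" if "m \<noteq> 0" "m \<noteq> Suc 0" "m \<noteq> Suc (Suc 0)" for m
      using \<open>x \<in> standard_simplex 2\<close> that by (simp add: standard_simplex_def)
    then show "(\<lambda>m. \<Sum>i<3. if fst ([(0,s), (1,s), (2,s)] ! i) = m then x i else 0) = x"
      by (auto simp: fun_eq_iff eval_nat_numeral)
    have "s * x 0 + s * x 1 + s * x 2 = s * (x 0 + x 1 + x 2)" by (simp add: algebra_simps)
    moreover have "x 0 + x 1 + x 2 = 1"
      using sum_lessThan_standard_simplex[OF \<open>x \<in> standard_simplex 2\<close>, of 3] by (simp add: eval_nat_numeral)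
    ultimately show "(\<Sum>i<3. snd ([(0::nat,s), (1,s), (2,s)] ! i) * x i) = s"
      by (simp add: eval_nat_numeral)
  qed
  then show ?thesis
    by (auto simp: prism_vertices_simplex_def simplex_map_def restrict_def fun_eq_iff
        path_simplex_adjoint_def eval_nat_numeral)
qed

text \<open>The prism over a triangle is cut into three tetrahedra, one for each vertex at which a
  monotone edge path climbs from bottom to top. With alternating signs the inner faces cancel; the
  top, the bottom and the prisms over the three edges remain.\<close>

lemma path_prism_boundary:
  fixes \<sigma> :: "(nat \<Rightarrow> real) \<Rightarrow> real \<Rightarrow> 'a"
  shows "path_prism (chain_boundary 2 (frag_of \<sigma>)) =
    frag_of (simplex_map 2 (\<lambda>\<gamma>. \<gamma> 1) \<sigma>) - frag_of (simplex_map 2 (\<lambda>\<gamma>. \<gamma> 0) \<sigma>) -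
    chain_boundary 3
      (frag_of (prism_vertices_simplex (path_simplex_adjoint \<sigma>) [(0,0), (0,1), (1,1), (2,1)])
       - frag_of (prism_vertices_simplex (path_simplex_adjoint \<sigma>) [(0,0), (1,0), (1,1), (2,1)])
       + frag_of (prism_vertices_simplex (path_simplex_adjoint \<sigma>) [(0,0), (1,0), (2,0), (2,1)]))"
proof -
  have *: "prism_vertices_simplex (path_simplex_adjoint (singular_face (Suc (Suc 0)) k \<sigma>)) [a, b, d] =
     prism_vertices_simplex (path_simplex_adjoint \<sigma>) (map (\<lambda>(i, t). (if i < k then i else Suc i, t)) [a, b, d])"
    if "k \<le> 2" "fst a \<le> 1" "fst b \<le> 1" "fst d \<le> 1" for k a b d
    using prism_vertices_simplex_face_adjoint[of "[a, b, d]" 2 k 1 \<sigma>] that by auto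
  have "path_prism (chain_boundary 2 (frag_of \<sigma>)) =
     path_prism (frag_of (singular_face 2 0 \<sigma>)) - path_prism (frag_of (singular_face 2 1 \<sigma>))
     + path_prism (frag_of (singular_face 2 2 \<sigma>))"
    by (simp add: chain_boundary_of_2 path_prism_def frag_extend_diff frag_extend_add)
  then show ?thesis
    by (simp add: path_prism_of prism_chain_def * chain_boundary_diff chain_boundary_add
        chain_boundary_prism_vertices_3 numeral_2_eq_2
        prism_vertices_simplex_end[symmetric, unfolded numeral_2_eq_2 One_nat_def])
qed

lemma singular_chain_path_prism:
  assumes "singular_chain 1 (path_space X) x"
  shows "singular_chain 2 X (path_prism x)"
  unfolding path_prism_def
  by (rule singular_chain_frag_extend[OF assms])
     (unfold restrict_prism_simplex prism_chain_def[symmetric],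
      intro singular_chain_prism_chain continuous_map_path_simplex_adjoint)

lemma path_cochain_in_cochains:
  assumes "c \<in> singular_cochains 2 X"
  shows "path_cochain X c \<in> singular_cochains 1 (path_space X)"
  by (rule singular_cochainsI)
    (auto simp: path_cochain_def singular_chain_add path_prism_def frag_extend_add
      simp flip: One_nat_def intro!: singular_cochains_add[OF assms] singular_chain_path_prism[unfolded path_prism_def])

lemma difference_cochain_in_cocycles:
  assumes "c \<in> singular_cocycles 2 X"
  shows "difference_cochain X c \<in> singular_cocycles 2 (prod_topology X X)"
  unfolding difference_cochain_def
  by (intro cocycles_diff cochain_pullback_in_cocycles[OF _ assms] continuous_map_fst continuous_map_snd)

text \<open>In the chain homotopy formula the tetrahedra enter through a boundary, on which the
  cocycle \<open>c\<close> vanishes. What is left is \<open>c\<close> at the end points of the paths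
  minus \<open>c\<close> at their starting points.\<close>

lemma coboundary_path_cochain:
  assumes "c \<in> singular_cocycles 2 X"
  shows "coboundary 1 (path_space X) (path_cochain X c) =
    cochain_pullback 2 (path_space X) path_ends (difference_cochain X c)" (is "?L = ?R")
proof
  note c = singular_cocycles_imp_cochains[OF assms]
  have L: "?L \<in> singular_cochains 2 (path_space X)"
    using coboundary_in_cochains[OF path_cochain_in_cochains[OF c]] by (simp add: numeral_2_eq_2)
  have R: "?R \<in> singular_cochains 2 (path_space X)"
    by (intro cochain_pullback_in_cochains[OF continuous_map_path_ends]
        singular_cocycles_imp_cochains difference_cochain_in_cocycles assms)
  fix x
  show "?L x = ?R x"
  proof (cases "singular_chain 2 (path_space X) x")
    case True
    show ?thesis
    proof (rule singular_cochains_agree[OF L R True])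
      fix \<sigma> assume \<sigma>: "singular_simplex 2 (path_space X) \<sigma>"
      let ?\<Phi> = "path_simplex_adjoint \<sigma>"
      define W where "W = frag_of (prism_vertices_simplex ?\<Phi> [(0,0), (0,1), (1,1), (2,1)])
       - frag_of (prism_vertices_simplex ?\<Phi> [(0,0), (1,0), (1,1), (2,1)])
       + frag_of (prism_vertices_simplex ?\<Phi> [(0,0), (1,0), (2,0), (2,1)])"
      have W: "singular_chain 3 X W"
        unfolding W_def by (intro singular_chain_add singular_chain_diff singular_chain_of[THEN iffD2]
            singular_simplex_prism_vertices[OF continuous_map_path_simplex_adjoint[OF \<sigma>]]) auto
      have cW: "c (chain_boundary 3 W) = 0"
        using singular_cocycles_boundary[OF assms, of W] W by (simp add: numeral_3_eq_3 numeral_2_eq_2)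
      have ends: "singular_simplex 2 X (simplex_map 2 (\<lambda>\<gamma>. \<gamma> s) \<sigma>)" if "s \<in> {0..1}" for s
        using singular_simplex_prism_vertices[OF continuous_map_path_simplex_adjoint[OF \<sigma>], of "[(0,s), (1,s), (2,s)]" 2]
          that unfolding prism_vertices_simplex_end[OF that] by force
      have "?L (frag_of \<sigma>) = c (path_prism (chain_boundary 2 (frag_of \<sigma>)))"
        using \<sigma> singular_chain_boundary_alt[of 1 "path_space X" "frag_of \<sigma>"]
        by (simp add: coboundary_def singular_chain_of path_cochain_def numeral_2_eq_2)
      also have "\<dots> = c (frag_of (simplex_map 2 (\<lambda>\<gamma>. \<gamma> 1) \<sigma>)) - c (frag_of (simplex_map 2 (\<lambda>\<gamma>. \<gamma> 0) \<sigma>))"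
        unfolding path_prism_boundary W_def[symmetric]
        using ends singular_chain_boundary[OF W]
        by (simp add: singular_cochains_diff[OF c] singular_chain_diff singular_chain_of cW)
      also have "\<dots> = ?R (frag_of \<sigma>)"
        using \<sigma> singular_simplex_simplex_map[OF \<sigma> continuous_map_path_ends]
        by (simp add: cochain_pullback_def difference_cochain_def singular_chain_of
            simplex_map_def path_ends_def o_def restrict_def cong: if_cong)
      finally show "?L (frag_of \<sigma>) = ?R (frag_of \<sigma>)" .
    qed
  next
    case False
    then show ?thesis by (simp add: coboundary_def cochain_pullback_def numeral_2_eq_2)
  qed
qed

section \<open>Functoriality of pullbacks, and the loop cochain as a cocycle\<close>

lemma cochain_pullback_compose:
  assumes "continuous_map Z Y g"
  shows "cochain_pullback p Z g (cochain_pullback p Y f c) = cochain_pullback p Z (f \<circ> g) c"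
  using singular_chain_chain_map[OF _ assms]
  by (auto simp: cochain_pullback_def chain_map_compose)

lemma cochain_pullback_cong:
  assumes "\<And>z. z \<in> topspace Z \<Longrightarrow> f z = g z"
  shows "cochain_pullback p Z f c = cochain_pullback p Z g c"
  unfolding cochain_pullback_def using chain_map_eq[of p Z _ f g] assms by (metis (no_types))

lemma path_ends_loop_halves:
  "\<gamma> \<in> topspace (free_loop_space X) \<Longrightarrow> path_ends (first_half \<gamma>) = path_ends (second_half_rev \<gamma>)"
  by (rule path_ends_halves) (simp add: free_loop_space_def)

lemma loop_cochain_in_cochains:
  assumes "c \<in> singular_cochains 2 X"
  shows "loop_cochain X c \<in> singular_cochains 1 (free_loop_space X)"
  unfolding loop_cochain_def
  by (intro cochains_diff cochain_pullback_in_cochains[OF _ path_cochain_in_cochains[OF assms]]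
      continuous_map_loop_halves)

text \<open>The two halves of a loop have the same ends, so the coboundaries of both pullbacks are
  the pullback of the difference cochain along one and the same map.\<close>

lemma loop_cochain_in_cocycles:
  assumes "c \<in> singular_cocycles 2 X"
  shows "loop_cochain X c \<in> singular_cocycles 1 (free_loop_space X)"
proof -
  let ?L = "free_loop_space X" and ?P = "path_space X"
  let ?b = "path_cochain X c" and ?d = "difference_cochain X c"
  have "coboundary 1 ?L (loop_cochain X c) =
      (\<lambda>x. coboundary 1 ?L (cochain_pullback 1 ?L first_half ?b) x
         - coboundary 1 ?L (cochain_pullback 1 ?L second_half_rev ?b) x)"
    by (auto simp: coboundary_def loop_cochain_def)
  also have "\<dots> = (\<lambda>x. cochain_pullback 2 ?L (path_ends \<circ> first_half) ?d x
         - cochain_pullback 2 ?L (path_ends \<circ> second_half_rev) ?d x)"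
    using coboundary_path_cochain[OF assms]
    by (simp add: coboundary_cochain_pullback[OF continuous_map_loop_halves(1)]
        coboundary_cochain_pullback[OF continuous_map_loop_halves(2)]
        cochain_pullback_compose[OF continuous_map_loop_halves(1)]
        cochain_pullback_compose[OF continuous_map_loop_halves(2)] numeral_2_eq_2)
  also have "\<dots> = (\<lambda>x. 0)"
  proof -
    have "cochain_pullback 2 ?L (path_ends \<circ> first_half) ?d =
        cochain_pullback 2 ?L (path_ends \<circ> second_half_rev) ?d"
      by (rule cochain_pullback_cong) (simp add: path_ends_loop_halves)
    then show ?thesis by simp
  qed
  finally show ?thesis
    using loop_cochain_in_cochains[OF singular_cocycles_imp_cochains[OF assms]]
    by (simp add: singular_cocycles_def)
qed

section \<open>One-cocycles and closed edges\<close>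

definition edge_point :: "real \<Rightarrow> nat \<Rightarrow> real" where
  "edge_point t = (\<lambda>i. if i = 0 then 1 - t else if i = 1 then t else 0)"

lemma edge_point_in_standard_simplex: "0 \<le> t \<Longrightarrow> t \<le> 1 \<Longrightarrow> edge_point t \<in> standard_simplex 1"
  by (auto simp: edge_point_def standard_simplex_def)

lemma standard_simplex_1_eq: "x \<in> standard_simplex 1 \<Longrightarrow> x = edge_point (x 1)"
  by (auto simp: edge_point_def standard_simplex_def fun_eq_iff)

lemma standard_simplex_coord: "x \<in> standard_simplex p \<Longrightarrow> 0 \<le> x i \<and> x i \<le> 1"
  by (simp add: standard_simplex_def)

lemma continuous_map_edge_point:
  assumes "continuous_map Z euclideanreal f" "\<And>z. z \<in> topspace Z \<Longrightarrow> 0 \<le> f z \<and> f z \<le> 1"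
  shows "continuous_map Z (simplex_top 1) (\<lambda>z. edge_point (f z))"
proof -
  have "continuous_map Z euclideanreal (\<lambda>z. edge_point (f z) i)" for i
    unfolding edge_point_def using assms(1)
    by (cases "i = 0"; cases "i = 1") (auto intro!: continuous_intros)
  then show ?thesis
    using assms(2) edge_point_in_standard_simplex
    by (auto simp: continuous_map_in_subtopology continuous_map_componentwise_UNIV)
qed

lemma singular_simplex_1_continuous_map:
  assumes "singular_simplex 1 Z \<alpha>" "continuous_map W euclideanreal f"
    "\<And>w. w \<in> topspace W \<Longrightarrow> 0 \<le> f w \<and> f w \<le> 1"
  shows "continuous_map W Z (\<lambda>w. \<alpha> (edge_point (f w)))"
  using continuous_map_compose[OF continuous_map_edge_point[OF assms(2,3)], of Z \<alpha>] assms(1)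
  by (simp add: singular_simplex_def o_def)

lemma singular_face_1_eq:
  "singular_face 1 0 \<sigma> = restrict (\<lambda>x. \<sigma> (edge_point 1)) (standard_simplex 0)"
  "singular_face 1 1 \<sigma> = restrict (\<lambda>x. \<sigma> (edge_point 0)) (standard_simplex 0)"
proof -
  have "simplical_face 0 (\<lambda>j. if j = 0 then 1 else 0) = edge_point 1"
    "simplical_face 1 (\<lambda>j. if j = 0 then 1 else 0) = edge_point 0"
    by (auto simp: simplical_face_def edge_point_def fun_eq_iff)
  then show "singular_face 1 0 \<sigma> = restrict (\<lambda>x. \<sigma> (edge_point 1)) (standard_simplex 0)"
    "singular_face 1 1 \<sigma> = restrict (\<lambda>x. \<sigma> (edge_point 0)) (standard_simplex 0)"
    by (auto simp: singular_face_def standard_simplex_0)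
qed

text \<open>The formula is a retraction of the triangle onto its two edges at \<open>v\<^sub>0\<close>.\<close>

definition horn_filler ::
  "((nat \<Rightarrow> real) \<Rightarrow> 'a) \<Rightarrow> ((nat \<Rightarrow> real) \<Rightarrow> 'a) \<Rightarrow> (nat \<Rightarrow> real) \<Rightarrow> 'a" where
  "horn_filler \<alpha> \<beta> = restrict (\<lambda>x. if x 2 \<le> x 1 then \<alpha> (edge_point (x 1 - x 2))
     else \<beta> (edge_point (x 2 - x 1))) (standard_simplex 2)"

text \<open>On the line where coordinates 1 and 2 agree both branches sit at the common starting
  point. Faces 2 and 1 are the loci where coordinate 2 or 1 vanishes. Face 0 runs back along
  \<open>\<alpha>\<close> and then forward along \<open>\<beta>\<close>.\<close>

lemma horn_filler:
  assumes \<alpha>: "singular_simplex 1 Z \<alpha>" and \<beta>: "singular_simplex 1 Z \<beta>"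
    and 0: "\<alpha> (edge_point 0) = \<beta> (edge_point 0)"
  shows singular_simplex_horn_filler: "singular_simplex 2 Z (horn_filler \<alpha> \<beta>)"
    and singular_face_horn_filler_2: "singular_face 2 2 (horn_filler \<alpha> \<beta>) = \<alpha>"
    and singular_face_horn_filler_1: "singular_face 2 1 (horn_filler \<alpha> \<beta>) = \<beta>"
    and "singular_face 2 0 (horn_filler \<alpha> \<beta>) (edge_point 0) = \<alpha> (edge_point 1)"
    and "singular_face 2 0 (horn_filler \<alpha> \<beta>) (edge_point 1) = \<beta> (edge_point 1)"
proof -
  let ?T = "simplex_top 2"
  have c: "continuous_map (subtopology ?T S) euclideanreal (\<lambda>x. x i)" for S i
    by (intro continuous_map_from_subtopology[OF continuous_map_simplex_coordinate])
  have "continuous_map ?T Z (\<lambda>x. if x 2 \<le> x 1 then \<alpha> (edge_point (x 1 - x 2)) else \<beta> (edge_point (x 2 - x 1)))"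
  proof (rule continuous_map_cases_le)
    show "continuous_map (subtopology ?T {x \<in> topspace ?T. x 2 \<le> x 1}) Z (\<lambda>x. \<alpha> (edge_point (x 1 - x 2)))"
    proof (rule singular_simplex_1_continuous_map[OF \<alpha>])
      fix x assume "x \<in> topspace (subtopology ?T {x \<in> topspace ?T. x 2 \<le> x 1})"
      then show "0 \<le> x 1 - x 2 \<and> x 1 - x 2 \<le> 1"
        using standard_simplex_coord[of x 2 1] standard_simplex_coord[of x 2 2] by auto
    qed (intro continuous_intros c)
    show "continuous_map (subtopology ?T {x \<in> topspace ?T. x 1 \<le> x 2}) Z (\<lambda>x. \<beta> (edge_point (x 2 - x 1)))"
    proof (rule singular_simplex_1_continuous_map[OF \<beta>])
      fix x assume "x \<in> topspace (subtopology ?T {x \<in> topspace ?T. x 1 \<le> x 2})"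
      then show "0 \<le> x 2 - x 1 \<and> x 2 - x 1 \<le> 1"
        using standard_simplex_coord[of x 2 1] standard_simplex_coord[of x 2 2] by auto
    qed (intro continuous_intros c)
    show "\<alpha> (edge_point (x 1 - x 2)) = \<beta> (edge_point (x 2 - x 1))" if "x 2 = x 1" for x
      using 0 that by simp
  qed (rule continuous_map_simplex_coordinate)+
  then show "singular_simplex 2 Z (horn_filler \<alpha> \<beta>)"
    unfolding horn_filler_def by (rule singular_simplex_restrictI)
  \<comment> \<open>Equality of the faces with \<open>\<alpha>\<close> and \<open>\<beta>\<close> as
    functions includes the points outside the simplex, where singular simplices are
    \<open>undefined\<close>.\<close>
  have ext: "\<alpha> x = undefined" "\<beta> x = undefined" if "x \<notin> standard_simplex 1" for x
    using \<alpha> \<beta> that by (meson extensional_arb singular_simplex_def)+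
  have face: "simplical_face k x \<in> standard_simplex 2" if "x \<in> standard_simplex 1" "k \<le> 2" for k x
    using simplical_face_in_standard_simplex[of 2 k x] that by simp
  show "singular_face 2 2 (horn_filler \<alpha> \<beta>) = \<alpha>"
  proof
    fix x
    show "singular_face 2 2 (horn_filler \<alpha> \<beta>) x = \<alpha> x"
    proof (cases "x \<in> standard_simplex 1")
      case True
      then show ?thesis
        using face[OF True, of 2] standard_simplex_1_eq[OF True] standard_simplex_coord[OF True, of 1]
        by (simp add: singular_face_def horn_filler_def simplical_face_def)
    next
      case False
      then show ?thesis using ext by (simp add: singular_face_def)
    qed
  qed
  show "singular_face 2 1 (horn_filler \<alpha> \<beta>) = \<beta>"
  proof
    fix x
    show "singular_face 2 1 (horn_filler \<alpha> \<beta>) x = \<beta> x"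
    proof (cases "x \<in> standard_simplex 1")
      case True
      have x1: "simplical_face 1 x 1 = 0" "simplical_face 1 x 2 = x 1"
        by (simp_all add: simplical_face_def)
      have "singular_face 2 1 (horn_filler \<alpha> \<beta>) x = horn_filler \<alpha> \<beta> (simplical_face 1 x)"
        using True by (simp add: singular_face_def)
      also have "\<dots> = (if x 1 \<le> 0 then \<alpha> (edge_point (- x 1)) else \<beta> (edge_point (x 1)))"
        using face[OF True, of 1] x1 by (simp add: horn_filler_def)
      also have "\<dots> = \<beta> (edge_point (x 1))"
        using 0 standard_simplex_coord[OF True, of 1] by (cases "x 1 = 0") auto
      finally show ?thesis
        using standard_simplex_1_eq[OF True] by simp
    next
      case False
      then show ?thesis using ext by (simp add: singular_face_def)
    qed
  qed
  have "edge_point 0 \<in> standard_simplex 1" "edge_point 1 \<in> standard_simplex 1"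
    using edge_point_in_standard_simplex[of 0] edge_point_in_standard_simplex[of 1] by simp_all
  moreover have "simplical_face 0 (edge_point t) 1 = 1 - t" "simplical_face 0 (edge_point t) 2 = t" for t
    by (simp_all add: simplical_face_def edge_point_def)
  ultimately show "singular_face 2 0 (horn_filler \<alpha> \<beta>) (edge_point 0) = \<alpha> (edge_point 1)"
    "singular_face 2 0 (horn_filler \<alpha> \<beta>) (edge_point 1) = \<beta> (edge_point 1)"
    using face[of "edge_point 0" 0] face[of "edge_point 1" 0]
    by (simp_all add: singular_face_def horn_filler_def del: One_nat_def)
qed

text \<open>The third side of the filled horn, with the cocycle condition read off on the filling
  triangle. Reversal and concatenation of paths are both instances, and the side
  \<open>\<theta>\<close> serves all cocycles at once.\<close>

lemma singular_simplex_complete_triangle: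
  assumes "singular_simplex 1 Z \<alpha>" "singular_simplex 1 Z \<beta>" "\<alpha> (edge_point 0) = \<beta> (edge_point 0)"
  obtains \<theta> where "singular_simplex 1 Z \<theta>" "\<theta> (edge_point 0) = \<alpha> (edge_point 1)"
    "\<theta> (edge_point 1) = \<beta> (edge_point 1)"
    "\<And>a. a \<in> singular_cocycles 1 Z \<Longrightarrow> a (frag_of \<theta>) = a (frag_of \<beta>) - a (frag_of \<alpha>)"
proof
  let ?\<rho> = "horn_filler \<alpha> \<beta>" let ?\<theta> = "singular_face 2 0 ?\<rho>"
  note \<rho> = singular_simplex_horn_filler[OF assms]
  show \<theta>: "singular_simplex 1 Z ?\<theta>"
    using singular_simplex_singular_face[OF \<rho>, of 0] by simp
  show "?\<theta> (edge_point 0) = \<alpha> (edge_point 1)" "?\<theta> (edge_point 1) = \<beta> (edge_point 1)"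
    using horn_filler(4,5)[OF assms] by auto
  show "a (frag_of ?\<theta>) = a (frag_of \<beta>) - a (frag_of \<alpha>)" if a: "a \<in> singular_cocycles 1 Z" for a
  proof -
    have "chain_boundary 2 (frag_of ?\<rho>) = frag_of ?\<theta> - frag_of \<beta> + frag_of \<alpha>"
      unfolding chain_boundary_of_2 singular_face_horn_filler_1[OF assms] singular_face_horn_filler_2[OF assms] ..
    moreover have "a (chain_boundary 2 (frag_of ?\<rho>)) = 0"
      using singular_cocycles_boundary[OF a, of "frag_of ?\<rho>"] \<rho> by (simp add: singular_chain_of numeral_2_eq_2)
    ultimately have "a (frag_of ?\<theta> - frag_of \<beta> + frag_of \<alpha>) = 0" by simp
    moreover have "a (frag_of ?\<theta> - frag_of \<beta> + frag_of \<alpha>) = a (frag_of ?\<theta>) - a (frag_of \<beta>) + a (frag_of \<alpha>)"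
      using assms(1,2) \<theta> singular_cocycles_imp_cochains[OF a]
      by (simp add: singular_cochains_diff singular_cochains_add singular_chain_of singular_chain_diff)
    ultimately show ?thesis by (simp add: algebra_simps)
  qed
qed

section \<open>Path components, with singular edges as paths\<close>

definition joined_in :: "'a topology \<Rightarrow> 'a \<Rightarrow> 'a \<Rightarrow> bool" where
  "joined_in Z x y \<longleftrightarrow> (\<exists>p. singular_simplex 1 Z p \<and> p (edge_point 0) = x \<and> p (edge_point 1) = y)"

definition component_point :: "'a topology \<Rightarrow> 'a \<Rightarrow> 'a" where
  "component_point Z x = (SOME y. joined_in Z y x)"

definition component_path :: "'a topology \<Rightarrow> 'a \<Rightarrow> (nat \<Rightarrow> real) \<Rightarrow> 'a" where
  "component_path Z x =
     (SOME p. singular_simplex 1 Z p \<and> p (edge_point 0) = component_point Z x \<and> p (edge_point 1) = x)"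

lemma singular_simplex_const:
  "x \<in> topspace Z \<Longrightarrow> singular_simplex p Z (restrict (\<lambda>_. x) (standard_simplex p))"
  by (rule singular_simplex_restrictI) simp

lemma joined_in_refl: "x \<in> topspace Z \<Longrightarrow> joined_in Z x x"
  unfolding joined_in_def
  by (intro exI[of _ "restrict (\<lambda>_. x) (standard_simplex 1)"] conjI singular_simplex_const)
     (simp_all add: edge_point_in_standard_simplex del: One_nat_def)

text \<open>This is the form of transitivity that a horn at the common starting point provides;
  together with reflexivity it also gives symmetry.\<close>

lemma joined_in_euclidean: "joined_in Z x y \<Longrightarrow> joined_in Z x z \<Longrightarrow> joined_in Z y z"
  unfolding joined_in_def by (metis singular_simplex_complete_triangle)

lemma singular_simplex_1_topspace:
  "singular_simplex 1 Z p \<Longrightarrow> 0 \<le> t \<Longrightarrow> t \<le> 1 \<Longrightarrow> p (edge_point t) \<in> topspace Z"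
  using edge_point_in_standard_simplex[of t]
  by (auto simp: singular_simplex_def continuous_map_def)

lemma joined_in_topspace: "joined_in Z x y \<Longrightarrow> x \<in> topspace Z \<and> y \<in> topspace Z"
  unfolding joined_in_def using singular_simplex_1_topspace[of Z _ 0] singular_simplex_1_topspace[of Z _ 1]
  by auto

lemma joined_in_sym: "joined_in Z x y \<Longrightarrow> joined_in Z y x"
  using joined_in_euclidean joined_in_refl joined_in_topspace by metis

text \<open>Joined points satisfy the same selection predicate, so the choice operator returns the
  same point for both.\<close>

lemma component_point_eq:
  assumes "joined_in Z x y"
  shows "component_point Z x = component_point Z y"
proof -
  have "joined_in Z z x \<longleftrightarrow> joined_in Z z y" for z
    using assms joined_in_euclidean joined_in_sym by metis
  then show ?thesis by (simp add: component_point_def)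
qed

lemma component_path:
  assumes "x \<in> topspace Z"
  shows "singular_simplex 1 Z (component_path Z x)"
    "component_path Z x (edge_point 0) = component_point Z x"
    "component_path Z x (edge_point 1) = x"
proof -
  have "joined_in Z (component_point Z x) x"
    unfolding component_point_def by (rule someI) (rule joined_in_refl[OF assms])
  then have "\<exists>p. singular_simplex 1 Z p \<and> p (edge_point 0) = component_point Z x \<and> p (edge_point 1) = x"
    by (simp add: joined_in_def)
  from someI_ex[OF this] show "singular_simplex 1 Z (component_path Z x)"
    "component_path Z x (edge_point 0) = component_point Z x" "component_path Z x (edge_point 1) = x"
    by (simp_all add: component_path_def)
qed

text \<open>The primitive integrates \<open>a\<close> along the chosen path from the base point of
  the component. Completing two triangles shows that the error on an edge is the value of
  \<open>a\<close> on a closed edge.\<close>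

lemma singular_coboundaries_1I:
  assumes a: "a \<in> singular_cocycles 1 Z"
    and loops: "\<And>\<tau>. singular_simplex 1 Z \<tau> \<Longrightarrow> \<tau> (edge_point 0) = \<tau> (edge_point 1) \<Longrightarrow> a (frag_of \<tau>) = 0"
  shows "a \<in> singular_coboundaries 1 Z"
proof -
  \<comment> \<open>The only point of the standard 0-simplex, so \<open>s ?v\<close> is the point of
    \<open>Z\<close> that \<open>s\<close> represents.\<close>
  let ?v = "\<lambda>k::nat. if k = 0 then 1 else 0::real"
  let ?e = "cochain_compose 0 Z (\<lambda>s. frag_of (component_path Z (s ?v))) a"
  note ac = singular_cocycles_imp_cochains[OF a]
  have v: "s ?v \<in> topspace Z" if "singular_simplex 0 Z s" for s
    using that by (auto simp: singular_simplex_def continuous_map_def standard_simplex_0)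
  have e: "?e \<in> singular_cochains 0 Z"
    using component_path(1)[OF v] by (intro cochain_compose_in_cochains[OF ac]) (simp add: singular_chain_of)
  have "a (frag_of \<sigma>) = ?e (chain_boundary 1 (frag_of \<sigma>))" if \<sigma>: "singular_simplex 1 Z \<sigma>" for \<sigma>
  proof -
    let ?P = "\<lambda>t. component_path Z (\<sigma> (edge_point t))"
    have top: "\<sigma> (edge_point 0) \<in> topspace Z" "\<sigma> (edge_point 1) \<in> topspace Z"
      using singular_simplex_1_topspace[OF \<sigma>] by auto
    have start: "?P 0 (edge_point 0) = ?P 1 (edge_point 0)"
      using component_point_eq[of Z "\<sigma> (edge_point 0)" "\<sigma> (edge_point 1)"] \<sigma>
      by (simp add: component_path top) (auto simp: joined_in_def)
    obtain \<theta> where \<theta>: "singular_simplex 1 Z \<theta>" "\<theta> (edge_point 0) = \<sigma> (edge_point 0)"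
      "\<theta> (edge_point 1) = \<sigma> (edge_point 1)" "a (frag_of \<theta>) = a (frag_of (?P 1)) - a (frag_of (?P 0))"
      using singular_simplex_complete_triangle[OF component_path(1)[OF top(1)] component_path(1)[OF top(2)] start]
        a component_path(3)[OF top(1)] component_path(3)[OF top(2)] by metis
    \<comment> \<open>Since \<open>\<theta>\<close> and \<open>\<sigma>\<close> share both end
      points, the third side \<open>\<kappa>\<close> of their triangle is closed, and it measures
      the difference of their values.\<close>
    obtain \<kappa> where \<kappa>: "singular_simplex 1 Z \<kappa>" "\<kappa> (edge_point 0) = \<theta> (edge_point 1)"
      "\<kappa> (edge_point 1) = \<sigma> (edge_point 1)" "a (frag_of \<kappa>) = a (frag_of \<sigma>) - a (frag_of \<theta>)"
      using singular_simplex_complete_triangle[OF \<theta>(1) \<sigma> \<theta>(2)] a by metis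
    have faces: "singular_simplex 0 Z (singular_face 1 k \<sigma>)" if "k \<le> 1" for k
      using singular_simplex_singular_face[OF \<sigma> _ that] by simp
    have "?e (chain_boundary 1 (frag_of \<sigma>)) =
        ?e (frag_of (singular_face 1 0 \<sigma>)) - ?e (frag_of (singular_face 1 1 \<sigma>))"
      unfolding chain_boundary_of_1[folded One_nat_def]
      using faces by (intro singular_cochains_diff[OF e]) (simp_all add: singular_chain_of)
    also have "\<dots> = a (frag_of (?P 1)) - a (frag_of (?P 0))"
      unfolding cochain_compose_of[OF faces[OF zero_le_one]] cochain_compose_of[OF faces[OF order_refl]]
      unfolding singular_face_1_eq by (simp add: standard_simplex_0)
    also have "\<dots> = a (frag_of \<sigma>)"
      using loops[OF \<kappa>(1)] \<kappa> \<theta> by simp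
    finally show ?thesis by (rule sym)
  qed
  then show ?thesis
    using singular_coboundariesI[of a 0 Z ?e] ac e by simp
qed

section \<open>Closed edges of the free loop space\<close>

definition torus_param :: "(nat \<Rightarrow> real) \<times> real \<Rightarrow> complex \<times> complex" where
  "torus_param = (\<lambda>(x, s). (cis (2 * pi * x 1), cis (2 * pi * s)))"

lemma cis_2pi_eq:
  assumes "cis (2 * pi * a) = cis (2 * pi * b)" "a \<in> {0..1}" "b \<in> {0..1}"
  shows "a = b \<or> a = 0 \<and> b = 1 \<or> a = 1 \<and> b = 0"
proof -
  have "sin (2 * pi * a) = sin (2 * pi * b) \<and> cos (2 * pi * a) = cos (2 * pi * b)"
    using assms(1) by (simp add: complex_eq_iff)
  then obtain n :: int where "2 * pi * a = 2 * pi * b + 2 * pi * n"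
    using sin_cos_eq_iff by blast
  then have "2 * pi * a = 2 * pi * (b + n)" by (simp add: algebra_simps)
  then have n: "a = b + n" by simp
  then have "real_of_int n < 2" "real_of_int n > -2" using assms by auto
  then have "n = -1 \<or> n = 0 \<or> n = 1" by linarith
  then show ?thesis using n assms by auto
qed

lemma cis_2pi_surj:
  assumes "norm z = 1"
  obtains t where "t \<in> {0..1}" "z = cis (2 * pi * t)"
proof -
  obtain t where t: "0 \<le> t" "t < 2 * pi" "z = Complex (cos t) (sin t)"
    using complex_unimodular_polar[OF assms] .
  show ?thesis
    by (rule that[of "t / (2 * pi)"]) (use t in \<open>auto simp: cis.ctr\<close>)
qed

lemma continuous_map_torus_param: "continuous_map (prod_topology (simplex_top 1) I01) torus torus_param"
proof -
  let ?P = "prod_topology (simplex_top 1) I01"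
  have 1: "continuous_map ?P euclideanreal (\<lambda>p. fst p 1)"
    using continuous_map_compose[OF continuous_map_fst continuous_map_simplex_coordinate[of 1 1]]
    by (simp add: o_def)
  have 2: "continuous_map ?P euclideanreal snd"
    using continuous_map_snd[of "simplex_top 1" I01] by (simp add: continuous_map_in_subtopology)
  have cis: "continuous_map euclideanreal (top_of_set (sphere 0 1)) (\<lambda>t. cis (2 * pi * t))"
    by (auto simp: continuous_map_in_subtopology intro!: continuous_intros)
  show ?thesis
    unfolding torus_def torus_param_def case_prod_unfold
    using continuous_map_compose[OF 1 cis] continuous_map_compose[OF 2 cis]
    by (intro continuous_map_pairedI) (simp_all add: o_def)
qed

lemma torus_param_surj: "torus_param ` topspace (prod_topology (simplex_top 1) I01) = topspace torus"
proof
  show "torus_param ` topspace (prod_topology (simplex_top 1) I01) \<subseteq> topspace torus"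
    using continuous_map_image_subset_topspace[OF continuous_map_torus_param] .
  show "topspace torus \<subseteq> torus_param ` topspace (prod_topology (simplex_top 1) I01)"
  proof
    fix w :: "complex \<times> complex" assume "w \<in> topspace torus"
    then have "norm (fst w) = 1" "norm (snd w) = 1" by (auto simp: torus_def)
    then obtain a b where ab: "a \<in> {0..1}" "fst w = cis (2 * pi * a)" "b \<in> {0..1}" "snd w = cis (2 * pi * b)"
      by (metis cis_2pi_surj)
    have "w = torus_param (edge_point a, b)"
      using ab by (simp add: torus_param_def edge_point_def prod_eq_iff)
    moreover have "(edge_point a, b) \<in> topspace (prod_topology (simplex_top 1) I01)"
      using ab edge_point_in_standard_simplex[of a] by simp
    ultimately show "w \<in> torus_param ` topspace (prod_topology (simplex_top 1) I01)"
      by blast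
  qed
qed

lemma quotient_map_torus_param: "quotient_map (prod_topology (simplex_top 1) I01) torus torus_param"
proof (rule continuous_imp_quotient_map[OF continuous_map_torus_param _ _ torus_param_surj])
  show "compact_space (prod_topology (simplex_top 1) I01)"
    by (simp add: compact_space_prod_topology compact_space_subtopology compactin_standard_simplex)
  show "Hausdorff_space torus"
    by (simp add: torus_def Hausdorff_space_prod_topology Hausdorff_space_subtopology Hausdorff_space_euclidean)
qed

lemma prism_vertices_simplex_compose:
  assumes "length ws = Suc p" "\<And>w. w \<in> set ws \<Longrightarrow> fst w \<le> q \<and> 0 \<le> snd w \<and> snd w \<le> 1"
    and "\<And>x s. x \<in> standard_simplex q \<Longrightarrow> s \<in> {0..1} \<Longrightarrow> \<Phi> (x, s) = F (\<Psi> (x, s))"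
  shows "prism_vertices_simplex \<Phi> ws = simplex_map p F (prism_vertices_simplex \<Psi> ws)"
  using prism_vertices_in_prism[OF assms(1,2)] assms(3)
  by (auto simp: prism_vertices_simplex_def simplex_map_def assms(1) fun_eq_iff)

text \<open>The adjoint of \<open>\<tau>\<close> agrees on opposite sides of the square: in one
  direction because every value of \<open>\<tau>\<close> is a loop, in the other because
  \<open>\<tau>\<close> is closed. It descends to a map \<open>F\<close> of the torus. The pulled
  back cocycle has a primitive there, which gets evaluated at the boundary of a cycle.\<close>

lemma loop_cochain_closed:
  assumes c: "c \<in> singular_cocycles 2 X" and at: "atoroidal X (cohomology_class 2 X c)"
    and \<tau>: "singular_simplex 1 (free_loop_space X) \<tau>" and closed: "\<tau> (edge_point 0) = \<tau> (edge_point 1)"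
  shows "loop_cochain X c (frag_of \<tau>) = 0"
proof -
  let ?P = "prod_topology (simplex_top 1) I01"
  have loop: "\<tau> x 0 = \<tau> x 1" if "x \<in> standard_simplex 1" for x
    using \<tau> that unfolding free_loop_space_def singular_simplex_subtopology by auto
  have \<tau>P: "singular_simplex 1 (path_space X) \<tau>"
    using \<tau> unfolding free_loop_space_def singular_simplex_subtopology by auto
  have well: "path_simplex_adjoint \<tau> p = path_simplex_adjoint \<tau> r"
    if pr: "p \<in> topspace ?P" "r \<in> topspace ?P" "torus_param p = torus_param r" for p r
  proof -
    obtain x s y t where xs: "p = (x, s)" "r = (y, t)" by (cases p, cases r)
    then have x: "x \<in> standard_simplex 1" "y \<in> standard_simplex 1" "s \<in> {0..1}" "t \<in> {0..1}"
      using pr by auto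
    have "x 1 = y 1 \<or> x 1 = 0 \<and> y 1 = 1 \<or> x 1 = 1 \<and> y 1 = 0"
      by (rule cis_2pi_eq)
         (use pr xs standard_simplex_coord[OF x(1)] standard_simplex_coord[OF x(2)] in \<open>auto simp: torus_param_def\<close>)
    then have "\<tau> x = \<tau> y"
      using standard_simplex_1_eq[OF x(1)] standard_simplex_1_eq[OF x(2)] closed by metis
    moreover have "s = t \<or> s = 0 \<and> t = 1 \<or> s = 1 \<and> t = 0"
      by (rule cis_2pi_eq) (use pr xs x in \<open>auto simp: torus_param_def\<close>)
    ultimately show ?thesis
      using loop[OF x(2)] by (auto simp: xs path_simplex_adjoint_def)
  qed
  obtain F where F: "continuous_map torus X F"
    "\<And>p. p \<in> topspace ?P \<Longrightarrow> F (torus_param p) = path_simplex_adjoint \<tau> p"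
  proof (rule quotient_map_lift_exists[OF quotient_map_torus_param continuous_map_path_simplex_adjoint[OF \<tau>P]])
    fix p r assume "p \<in> topspace ?P" "r \<in> topspace ?P" "torus_param p = torus_param r"
    then show "path_simplex_adjoint \<tau> p = path_simplex_adjoint \<tau> r" by (rule well)
  next
    fix g assume "continuous_map torus X g"
      "\<And>p. p \<in> topspace ?P \<Longrightarrow> g (torus_param p) = path_simplex_adjoint \<tau> p"
    then show thesis by (rule that)
  qed
  \<comment> \<open>The two halves of the torus, parametrized like the two halves of a loop: both
    end on the circle at height 1/2, and they start at heights 0 and 1, which are the same
    circle.\<close>
  define q1 q2 where "q1 = (\<lambda>(x, s). torus_param (x, s / 2))" and "q2 = (\<lambda>(x, s). torus_param (x, 1 - s / 2))"
  have half: "continuous_map ?P torus (\<lambda>p. torus_param (fst p, \<phi> (snd p)))" if "continuous_map I01 I01 \<phi>" for \<phi>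
  proof -
    have "continuous_map ?P ?P (\<lambda>p. (fst p, \<phi> (snd p)))"
      using continuous_map_compose[OF continuous_map_snd that]
      by (intro continuous_map_pairedI continuous_map_fst) (simp add: o_def)
    from continuous_map_compose[OF this continuous_map_torus_param] show ?thesis by (simp add: o_def)
  qed
  have q1: "continuous_map ?P torus q1" and q2: "continuous_map ?P torus q2"
    unfolding q1_def q2_def case_prod_unfold
    by (rule half; auto simp: continuous_map_in_subtopology intro!: continuous_intros)+
  have simps: "singular_simplex 1 (path_space X) (simplex_map 1 first_half \<tau>)"
    "singular_simplex 1 (path_space X) (simplex_map 1 second_half_rev \<tau>)"
    using singular_simplex_simplex_map[OF \<tau>] continuous_map_loop_halves by blast+
  have comp1: "prism_vertices_simplex (path_simplex_adjoint (simplex_map 1 first_half \<tau>)) ws =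
      simplex_map 2 F (prism_vertices_simplex q1 ws)"
    and comp2: "prism_vertices_simplex (path_simplex_adjoint (simplex_map 1 second_half_rev \<tau>)) ws =
      simplex_map 2 F (prism_vertices_simplex q2 ws)"
    if "ws \<in> {[(0,0), (0,1), (1,1)], [(0,0), (1,0), (1,1)]}" for ws
    by (rule prism_vertices_simplex_compose[where q=1];
        use that in \<open>auto simp: path_simplex_adjoint_def simplex_map_def q1_def q2_def F(2)
          first_half_def second_half_rev_def\<close>)+
  have maps: "path_prism (frag_of (simplex_map 1 first_half \<tau>)) = chain_map 2 F (prism_chain q1)"
    "path_prism (frag_of (simplex_map 1 second_half_rev \<tau>)) = chain_map 2 F (prism_chain q2)"
    by (simp_all add: path_prism_of prism_chain_def chain_map_diff comp1[unfolded One_nat_def] comp2[unfolded One_nat_def])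
  have \<zeta>: "singular_chain 2 torus (prism_chain q1 - prism_chain q2)"
    by (intro singular_chain_diff singular_chain_prism_chain q1 q2)
  have cyc: "chain_boundary 2 (prism_chain q1 - prism_chain q2) = 0"
  proof -
    \<comment> \<open>The diagonal cancels within each prism chain. The two vertical sides of each
      half coincide on the torus, and the halves share their top and bottom edges.\<close>
    have "prism_vertices_simplex q1 [(0,0),(0,1)] = prism_vertices_simplex q1 [(1,0),(1,1)]"
      "prism_vertices_simplex q2 [(0,0),(0,1)] = prism_vertices_simplex q2 [(1,0),(1,1)]"
      "prism_vertices_simplex q1 [(0,1),(1,1)] = prism_vertices_simplex q2 [(0,1),(1,1)]"
      "prism_vertices_simplex q1 [(0,0),(1,0)] = prism_vertices_simplex q2 [(0,0),(1,0)]"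
      by (rule prism_vertices_simplex_eqI[where p=1];
          auto simp: q1_def q2_def torus_param_def eval_nat_numeral standard_simplex_def)+
    then show ?thesis
      by (simp add: prism_chain_def chain_boundary_diff chain_boundary_prism_vertices_2)
  qed
  note cc = singular_cocycles_imp_cochains[OF c]
  have "cochain_pullback 2 torus F c \<in> singular_coboundaries 2 torus"
    unfolding cohomology_induced_class_eq_zero_iff[OF F(1), symmetric] using at F(1)
    unfolding atoroidal_def by blast
  then obtain e where e: "e \<in> singular_cochains 1 torus"
    "\<And>x. singular_chain 2 torus x \<Longrightarrow> cochain_pullback 2 torus F c x = e (chain_boundary 2 x)"
    using singular_coboundariesE[of _ 1] by (metis Suc_1)
  have "loop_cochain X c (frag_of \<tau>) =
      c (chain_map 2 F (prism_chain q1)) - c (chain_map 2 F (prism_chain q2))"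
    using \<tau> simps by (simp add: loop_cochain_def cochain_pullback_def path_cochain_def singular_chain_of
        flip: maps)
  also have "\<dots> = c (chain_map 2 F (prism_chain q1 - prism_chain q2))"
    using singular_chain_chain_map[OF singular_chain_prism_chain[OF q1] F(1)]
      singular_chain_chain_map[OF singular_chain_prism_chain[OF q2] F(1)]
    by (simp add: chain_map_diff singular_cochains_diff[OF cc])
  also have "\<dots> = e 0"
    using e(2)[OF \<zeta>] \<zeta> cyc by (simp add: cochain_pullback_def)
  also have "\<dots> = 0" by (rule singular_cochains_0[OF e(1)])
  finally show ?thesis .
qed

lemma loop_cochain_in_coboundaries:
  assumes "c \<in> singular_cocycles 2 X" "atoroidal X (cohomology_class 2 X c)"
  shows "loop_cochain X c \<in> singular_coboundaries 1 (free_loop_space X)"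
  by (rule singular_coboundaries_1I[OF loop_cochain_in_cocycles[OF assms(1)] loop_cochain_closed[OF assms]])

section \<open>Gluing primitives over two open sets\<close>

lemma singular_chain_subtopology_imp: "singular_chain p (subtopology X S) x \<Longrightarrow> singular_chain p X x"
  by (simp add: singular_chain_subtopology)

definition small_chain :: "nat \<Rightarrow> 'a topology \<Rightarrow> 'a set \<Rightarrow> 'a set \<Rightarrow> 'a chain \<Rightarrow> bool" where
  "small_chain p Y U V x \<longleftrightarrow>
     (\<exists>y z. singular_chain p (subtopology Y U) y \<and> singular_chain p (subtopology Y V) z \<and> x = y + z)"

lemma small_chainI:
  "singular_chain p (subtopology Y U) y \<Longrightarrow> singular_chain p (subtopology Y V) z \<Longrightarrow> small_chain p Y U V (y + z)"
  by (auto simp: small_chain_def)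

lemma small_chain_0: "small_chain p Y U V 0"
  using small_chainI[of p Y U 0 V 0] by simp

lemma small_chain_diff:
  assumes "small_chain p Y U V x" "small_chain p Y U V y"
  shows "small_chain p Y U V (x - y)"
proof -
  obtain a b a' b' where "singular_chain p (subtopology Y U) a" "singular_chain p (subtopology Y V) b" "x = a + b"
    "singular_chain p (subtopology Y U) a'" "singular_chain p (subtopology Y V) b'" "y = a' + b'"
    using assms unfolding small_chain_def by blast
  then show ?thesis
    using small_chainI[of p Y U "a - a'" V "b - b'"] by (simp add: singular_chain_diff algebra_simps)
qed

lemma small_chain_dimension_0:
  assumes "topspace Y \<subseteq> U \<union> V" "singular_chain 0 Y x"
  shows "small_chain 0 Y U V x"
  using assms(2)[unfolded singular_chain_def]
proof (induction rule: frag_induction)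
  case (one \<sigma>)
  then have \<sigma>: "singular_simplex 0 Y \<sigma>" by simp
  then obtain v where "\<sigma> ` standard_simplex 0 = {v}" "v \<in> topspace Y"
    by (auto simp: singular_simplex_def continuous_map_def standard_simplex_0)
  then have "singular_simplex 0 (subtopology Y U) \<sigma> \<or> singular_simplex 0 (subtopology Y V) \<sigma>"
    using \<sigma> assms(1) by (auto simp: singular_simplex_subtopology)
  then show ?case
    using small_chainI[of 0 Y U "frag_of \<sigma>" V 0] small_chainI[of 0 Y U 0 V "frag_of \<sigma>"]
    by (auto simp: singular_chain_of)
qed (simp_all add: small_chain_0 small_chain_diff)

text \<open>Iterated subdivision makes \<open>x\<close> small. The homotopy \<open>h\<close> from
  the identity to subdivision maps chains of a subspace to chains of that subspace, so its value on
  the small boundary is small as well, and \<open>- h x\<close> is the required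
  \<open>w\<close>.\<close>

lemma small_chain_relative_cycle:
  assumes UV: "openin Y U" "openin Y V" "U \<union> V = topspace Y"
    and x: "singular_chain (Suc p) Y x" and small: "small_chain p Y U V (chain_boundary (Suc p) x)"
  obtains w where "singular_chain (Suc (Suc p)) Y w"
    "small_chain (Suc p) Y U V (x - chain_boundary (Suc (Suc p)) w)"
proof -
  \<comment> \<open>Excision is applied to the closed set complementary to \<open>U\<close>: one
    part of the subdivided chain then avoids that set, hence lies in \<open>U\<close>, and the other
    lies in \<open>V\<close>.\<close>
  have "Y closure_of (topspace Y - U) \<subseteq> Y interior_of V"
    using UV closure_of_closedin[of Y "topspace Y - U"] by (auto simp: interior_of_openin)
  moreover have "V \<subseteq> topspace Y" using UV(2) openin_subset by blast
  ultimately obtain n d e where d: "singular_chain (Suc p) (subtopology Y (topspace Y - (topspace Y - U))) d"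
    and e: "singular_chain (Suc p) (subtopology Y V) e"
    and sd: "(singular_subdivision (Suc p) ^^ n) x = d + e"
    by (rule excised_chain_exists[of Y "topspace Y - U" V "topspace Y" "Suc p" x])
       (use x in \<open>auto intro: that\<close>)
  have "topspace Y - (topspace Y - U) = U" using openin_subset[OF UV(1)] by auto
  with d have d: "singular_chain (Suc p) (subtopology Y U) d" by simp
  obtain h :: "nat \<Rightarrow> 'a chain \<Rightarrow> 'a chain" where h0: "\<And>p. h p 0 = 0"
    and hd: "\<And>p c1 c2. h p (c1 - c2) = h p c1 - h p c2"
    and hc: "\<And>p X c. singular_chain p X c \<Longrightarrow> singular_chain (Suc p) X (h p c)"
    and hb: "\<And>p X c. singular_chain p X c \<Longrightarrow>
        chain_boundary (Suc p) (h p c) + h (p - Suc 0) (chain_boundary p c) = (singular_subdivision p ^^ n) c - c"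
    using chain_homotopic_iterated_singular_subdivision[where n=n] by blast
  obtain y z where yz: "singular_chain p (subtopology Y U) y" "singular_chain p (subtopology Y V) z"
    "chain_boundary (Suc p) x = y + z"
    using small unfolding small_chain_def by blast
  \<comment> \<open>The homotopy is known to respect differences, so the sum is written as a
    difference.\<close>
  have "h p (y - (0 - z)) = h p y + h p z" unfolding hd h0 by simp
  then have hyz: "h p (chain_boundary (Suc p) x) = h p y + h p z" using yz(3) by simp
  have hb': "chain_boundary (Suc (Suc p)) (h (Suc p) x) + h p (chain_boundary (Suc p) x) = d + e - x"
    using hb[OF x] sd by simp
  have "x - chain_boundary (Suc (Suc p)) (- h (Suc p) x) = (d + e) - (h p y + h p z)"
    using hb' unfolding hyz chain_boundary_minus by (simp add: algebra_simps)
  also have "small_chain (Suc p) Y U V \<dots>"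
    by (intro small_chain_diff small_chainI d e hc yz)
  finally show ?thesis
    using that[of "- h (Suc p) x"] hc[OF x] by (simp add: singular_chain_minus)
qed

lemma cocycle_zero_on_small_chain:
  assumes "\<phi> \<in> singular_cochains p Y"
    and "\<And>x. singular_chain p (subtopology Y U) x \<Longrightarrow> \<phi> x = 0"
    and "\<And>x. singular_chain p (subtopology Y V) x \<Longrightarrow> \<phi> x = 0"
    and "small_chain p Y U V x"
  shows "\<phi> x = 0"
proof -
  obtain y z where yz: "singular_chain p (subtopology Y U) y" "singular_chain p (subtopology Y V) z" "x = y + z"
    using assms(4) unfolding small_chain_def by blast
  then show ?thesis
    using assms(2,3) singular_cochains_add[OF assms(1), of y z]
    by (simp add: singular_chain_subtopology_imp)
qed

text \<open>An explicit form of the vanishing of cohomology relative to the small chains. With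
  \<open>H t\<close> a 2-chain whose boundary moves the 1-chain \<open>t\<close> to a small one, the
  primitive is \<open>\<phi>\<close> composed with \<open>H\<close>.\<close>

lemma cocycle_zero_on_cover_imp_coboundary:
  assumes UV: "openin Y U" "openin Y V" "U \<union> V = topspace Y"
    and \<phi>: "\<phi> \<in> singular_cocycles 2 Y"
    and "\<And>x. singular_chain 2 (subtopology Y U) x \<Longrightarrow> \<phi> x = 0"
    and "\<And>x. singular_chain 2 (subtopology Y V) x \<Longrightarrow> \<phi> x = 0"
  shows "\<phi> \<in> singular_coboundaries 2 Y"
proof -
  note \<phi>c = singular_cocycles_imp_cochains[OF \<phi>]
  have zero: "\<phi> x = 0" if "small_chain 2 Y U V x" for x
    by (rule cocycle_zero_on_small_chain[OF \<phi>c _ _ that]) (simp_all add: assms(5,6))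
  have "\<exists>w. singular_chain 2 Y w \<and> small_chain 1 Y U V (frag_of \<sigma> - chain_boundary 2 w)"
    if \<sigma>: "singular_simplex 1 Y \<sigma>" for \<sigma>
  proof -
    have "singular_chain 1 Y (frag_of \<sigma>)" using \<sigma> by (simp add: singular_chain_of)
    moreover from this have "small_chain 0 Y U V (chain_boundary 1 (frag_of \<sigma>))"
      using singular_chain_boundary_alt[of 0 Y "frag_of \<sigma>"] UV by (intro small_chain_dimension_0) auto
    ultimately show ?thesis
      using small_chain_relative_cycle[OF UV, of 0 "frag_of \<sigma>"] by (metis One_nat_def Suc_1)
  qed
  \<comment> \<open>\<open>h\<close> is the degree 1 part of a contraction of the singular chains modulo the small ones.\<close>
  then obtain h where h: "\<And>\<sigma>. singular_simplex 1 Y \<sigma> \<Longrightarrow>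
      singular_chain 2 Y (h \<sigma>) \<and> small_chain 1 Y U V (frag_of \<sigma> - chain_boundary 2 (h \<sigma>))"
    by metis
  let ?H = "frag_extend h"
  have H: "singular_chain 2 Y (?H t)" if "singular_chain 1 Y t" for t
    using singular_chain_frag_extend[OF that] h by blast
  have small: "small_chain 1 Y U V (t - chain_boundary 2 (?H t))" if "singular_chain 1 Y t" for t
    using that[unfolded singular_chain_def]
  proof (induction rule: frag_induction)
    case (diff a b)
    have "a - b - chain_boundary 2 (?H (a - b)) = (a - chain_boundary 2 (?H a)) - (b - chain_boundary 2 (?H b))"
      by (simp add: frag_extend_diff chain_boundary_diff)
    then show ?case by (simp only:) (rule small_chain_diff[OF diff])
  next
    case (one \<sigma>)
    then show ?case using h by simp
  qed (simp add: small_chain_0)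
  let ?\<psi> = "cochain_compose 1 Y h \<phi>"
  have \<psi>: "?\<psi> \<in> singular_cochains 1 Y"
    using h by (intro cochain_compose_in_cochains[OF \<phi>c]) blast
  have "\<phi> (frag_of \<sigma>) = ?\<psi> (chain_boundary 2 (frag_of \<sigma>))" if \<sigma>: "singular_simplex 2 Y \<sigma>" for \<sigma>
  proof -
    have s: "singular_chain 2 Y (frag_of \<sigma>)" using \<sigma> by (simp add: singular_chain_of)
    then have ds: "singular_chain 1 Y (chain_boundary 2 (frag_of \<sigma>))"
      using singular_chain_boundary by fastforce
    \<comment> \<open>Subtracting the chosen 2-chain makes the boundary small. Hence
      \<open>?y\<close> differs from a small chain by a boundary, and \<open>\<phi>\<close> vanishes
      on both.\<close>
    let ?y = "frag_of \<sigma> - ?H (chain_boundary 2 (frag_of \<sigma>))"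
    have y: "singular_chain 2 Y ?y" by (intro singular_chain_diff s H ds)
    have "small_chain 1 Y U V (chain_boundary 2 ?y)"
      using small[OF ds] by (simp add: chain_boundary_diff)
    then obtain w where w: "singular_chain 3 Y w" "small_chain 2 Y U V (?y - chain_boundary 3 w)"
      using small_chain_relative_cycle[OF UV, of 1 ?y] y by (metis Suc_1 numeral_3_eq_3 numeral_2_eq_2 One_nat_def)
    have "\<phi> (chain_boundary 3 w) = 0"
      using singular_cocycles_boundary[OF \<phi>, of w] w(1) by (simp add: numeral_3_eq_3 numeral_2_eq_2)
    moreover have "singular_chain 2 Y (chain_boundary 3 w)" using singular_chain_boundary[OF w(1)] by simp
    ultimately have "\<phi> ?y = 0"
      using zero[OF w(2)] singular_cochains_diff[OF \<phi>c y] by simp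
    then show ?thesis
      using singular_cochains_diff[OF \<phi>c s H[OF ds]] ds by (simp add: cochain_compose_def)
  qed
  then show ?thesis
    using singular_coboundariesI[of \<phi> 1 Y ?\<psi>] \<phi>c \<psi> by (simp add: numeral_2_eq_2)
qed

text \<open>The connecting argument of Mayer-Vietoris on cochains. The 0-cochain \<open>e\<close> is
  extended by zero from the overlap to \<open>U\<close>, and \<open>b1\<close> is changed by the
  coboundary of this extension. It then agrees with \<open>b2\<close> on the overlap without
  changing its own coboundary.\<close>

lemma glue_coboundaries:
  assumes UV: "openin Y U" "openin Y V" "U \<union> V = topspace Y"
    and \<phi>: "\<phi> \<in> singular_cocycles 2 Y"
    and b1: "b1 \<in> singular_cochains 1 (subtopology Y U)"
    and b2: "b2 \<in> singular_cochains 1 (subtopology Y V)"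
    and \<phi>1: "\<And>x. singular_chain 2 (subtopology Y U) x \<Longrightarrow> \<phi> x = b1 (chain_boundary 2 x)"
    and \<phi>2: "\<And>x. singular_chain 2 (subtopology Y V) x \<Longrightarrow> \<phi> x = b2 (chain_boundary 2 x)"
    and e: "e \<in> singular_cochains 0 (subtopology Y (U \<inter> V))"
    and b12: "\<And>x. singular_chain 1 (subtopology Y (U \<inter> V)) x \<Longrightarrow> b1 x - b2 x = e (chain_boundary 1 x)"
  shows "\<phi> \<in> singular_coboundaries 2 Y"
proof -
  let ?YU = "subtopology Y U" and ?YV = "subtopology Y V" and ?YI = "subtopology Y (U \<inter> V)"
  define E where "E = cochain_compose 0 ?YU (\<lambda>\<sigma>. if singular_simplex 0 ?YI \<sigma> then frag_of \<sigma> else 0) e"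
  have E: "E \<in> singular_cochains 0 ?YU"
    unfolding E_def by (intro cochain_compose_in_cochains[OF e]) (simp add: singular_chain_of)
  have IU: "singular_simplex p ?YU \<sigma>" "singular_simplex p ?YV \<sigma>" if "singular_simplex p ?YI \<sigma>" for p \<sigma>
    using that by (auto intro: singular_simplex_mono)
  have Ee: "E x = e x" if "singular_chain 0 ?YI x" for x
    by (rule singular_cochains_agree_on[OF E e that]) (simp add: IU E_def cochain_compose_of)
  define b1' where "b1' = (\<lambda>x. b1 x - coboundary 0 ?YU E x)"
  have b1': "b1' \<in> singular_cochains 1 ?YU"
    unfolding b1'_def using cochains_diff[OF b1] coboundary_in_cochains[OF E] by simp
  \<comment> \<open>Edges in \<open>U\<close> take the value of \<open>b1'\<close>, edges in
    \<open>V\<close> but not in \<open>U\<close> that of \<open>b2\<close>, all others 0. The two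
    minus signs cancel; they let the sum be treated as a difference of cochains.\<close>
  define B where "B = (\<lambda>x. cochain_compose 1 Y (\<lambda>\<sigma>. if singular_simplex 1 ?YU \<sigma> then frag_of \<sigma> else 0) b1' x
     - cochain_compose 1 Y (\<lambda>\<sigma>. if singular_simplex 1 ?YV \<sigma> \<and> \<not> singular_simplex 1 ?YU \<sigma> then - frag_of \<sigma> else 0) b2 x)"
  have B: "B \<in> singular_cochains 1 Y"
    unfolding B_def
    by (intro cochains_diff cochain_compose_in_cochains[OF b1'] cochain_compose_in_cochains[OF b2])
       (auto simp: singular_chain_of singular_chain_minus)
  have UY: "singular_simplex 1 Y \<sigma>" if "singular_simplex 1 (subtopology Y S) \<sigma>" for \<sigma> S
    using that by (simp add: singular_simplex_subtopology)
  have B1: "B x = b1' x" if "singular_chain 1 ?YU x" for x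
    by (rule singular_cochains_agree_on[OF B b1' that])
       (simp add: UY B_def cochain_compose_of singular_cochains_0[OF b2] del: One_nat_def)
  have B2: "B x = b2 x" if "singular_chain 1 ?YV x" for x
  proof (rule singular_cochains_agree_on[OF B b2 that])
    fix \<sigma> assume \<sigma>: "singular_simplex 1 ?YV \<sigma>"
    have "B (frag_of \<sigma>) = b2 (frag_of \<sigma>)"
    proof (cases "singular_simplex 1 ?YU \<sigma>")
      case True
      then have I: "singular_chain 1 ?YI (frag_of \<sigma>)"
        using \<sigma> by (auto simp: singular_chain_of singular_simplex_subtopology)
      have "b1' (frag_of \<sigma>) = b1 (frag_of \<sigma>) - E (chain_boundary 1 (frag_of \<sigma>))"
        using True by (simp add: b1'_def coboundary_def singular_chain_of)
      also have "\<dots> = b2 (frag_of \<sigma>)"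
        using b12[OF I] Ee[OF singular_chain_boundary_alt[OF I[unfolded One_nat_def]]] by (simp add: algebra_simps)
      finally show ?thesis
        using B1[of "frag_of \<sigma>"] True by (simp add: singular_chain_of)
    next
      case False
      then show ?thesis
        using \<sigma> singular_cochains_minus[OF b2, of "frag_of \<sigma>"]
        by (simp add: UY B_def cochain_compose_of singular_cochains_0[OF b1'] singular_chain_of del: One_nat_def)
    qed
    then show "singular_simplex 1 Y \<sigma> \<and> singular_simplex 1 ?YV \<sigma> \<and> B (frag_of \<sigma>) = b2 (frag_of \<sigma>)"
      using \<sigma> UY by blast
  qed
  let ?\<phi>' = "\<lambda>x. \<phi> x - coboundary 1 Y B x"
  have dB: "coboundary 1 Y B \<in> singular_coboundaries 2 Y"
    using B by (auto simp: singular_coboundaries_def numeral_2_eq_2)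
  have "?\<phi>' \<in> singular_coboundaries 2 Y"
  proof (rule cocycle_zero_on_cover_imp_coboundary[OF UV])
    show "?\<phi>' \<in> singular_cocycles 2 Y"
      using dB coboundaries_subset_cocycles by (intro cocycles_diff \<phi>) blast
    have eq: "?\<phi>' x = \<phi> x - B (chain_boundary 2 x)" if "singular_chain 2 (subtopology Y S) x" for x S
      using singular_chain_subtopology_imp[OF that] by (simp add: coboundary_def numeral_2_eq_2)
    have bd: "singular_chain 1 (subtopology Y S) (chain_boundary 2 x)" if "singular_chain 2 (subtopology Y S) x" for x S
      using singular_chain_boundary[OF that] by simp
    show "?\<phi>' x = 0" if x: "singular_chain 2 ?YU x" for x
    proof -
      have "coboundary 0 ?YU E (chain_boundary 2 x) = 0"
        using chain_boundary_boundary[OF x] bd[OF x] singular_cochains_0[OF E] by (simp add: coboundary_def)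
      then show ?thesis
        unfolding eq[OF x] B1[OF bd[OF x]] using \<phi>1[OF x] by (simp add: b1'_def)
    qed
    show "?\<phi>' x = 0" if x: "singular_chain 2 ?YV x" for x
      unfolding eq[OF x] B2[OF bd[OF x]] using \<phi>2[OF x] by simp
  qed
  from coboundaries_plus[OF this dB] show ?thesis by simp
qed

text \<open>Running along one path and back along another inverts the passage from a loop to its two
  halves. Thus two lifts with the same ends are the halves of a single map to the loop
  space.\<close>

lemma path_join_halves:
  assumes "\<alpha> \<in> extensional {0..1}" "\<beta> \<in> extensional {0..1}" "\<alpha> 1 = \<beta> 1"
  shows "first_half (path_join \<alpha> (restrict (\<lambda>s. \<beta> (1 - s)) {0..1})) = \<alpha>"
    and "second_half_rev (path_join \<alpha> (restrict (\<lambda>s. \<beta> (1 - s)) {0..1})) = \<beta>"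
proof -
  have "\<alpha> s = undefined" "\<beta> s = undefined" if "s \<notin> {0..1}" for s
    using assms that by (meson extensional_arb)+
  then show "first_half (path_join \<alpha> (restrict (\<lambda>s. \<beta> (1 - s)) {0..1})) = \<alpha>"
    by (auto simp: fun_eq_iff first_half_def path_join_def)
  show "second_half_rev (path_join \<alpha> (restrict (\<lambda>s. \<beta> (1 - s)) {0..1})) = \<beta>"
  proof
    fix s :: real
    \<comment> \<open>At \<open>s = 1\<close> the join is evaluated at its midpoint, where the first
      branch applies; there the common end point of the paths is used.\<close>
    consider "s \<notin> {0..1}" | "s = 1" | "s \<in> {0..1}" "s \<noteq> 1" by blast
    then show "second_half_rev (path_join \<alpha> (restrict (\<lambda>s. \<beta> (1 - s)) {0..1})) s = \<beta> s"
      using assms(3) \<open>\<And>s. s \<notin> {0..1} \<Longrightarrow> \<beta> s = undefined\<close>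
      by cases (auto simp: second_half_rev_def path_join_def)
  qed
qed

lemma continuous_map_free_loop_join:
  assumes "continuous_map Z (path_space X) f" "continuous_map Z (path_space X) g"
    and ends: "\<And>z. z \<in> topspace Z \<Longrightarrow> path_ends (f z) = path_ends (g z)"
  shows "continuous_map Z (free_loop_space X) (\<lambda>z. path_join (f z) (restrict (\<lambda>s. g z (1 - s)) {0..1}))"
proof -
  have "continuous_map I01 I01 (\<lambda>s. 1 - s)"
    by (auto simp: continuous_map_in_subtopology intro!: continuous_intros)
  from continuous_map_reparam[OF assms(2) this]
  have "continuous_map Z (path_space X) (\<lambda>z. path_join (f z) (restrict (\<lambda>s. g z (1 - s)) {0..1}))"
    by (rule continuous_map_path_join[OF assms(1)]) (use ends in \<open>simp add: path_ends_def\<close>)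
  then show ?thesis
    using ends by (auto simp: free_loop_space_def continuous_map_in_subtopology path_join_def path_ends_def)
qed

lemma pullback_difference_cochain_in_coboundaries:
  assumes c: "c \<in> singular_cocycles 2 X"
    and loop: "loop_cochain X c \<in> singular_coboundaries 1 (free_loop_space X)"
    and f: "continuous_map Y (prod_topology X X) f" and cover: "path_liftable_cover X Y f 2"
  shows "cochain_pullback 2 Y f (difference_cochain X c) \<in> singular_coboundaries 2 Y"
proof -
  let ?b = "path_cochain X c" and ?d = "difference_cochain X c"
  have b: "?b \<in> singular_cochains 1 (path_space X)"
    by (rule path_cochain_in_cochains[OF singular_cocycles_imp_cochains[OF c]])
  have "{1..2::nat} = {1, 2}" by auto
  then obtain U V g1 g2 where UV: "openin Y U" "openin Y V" "U \<union> V = topspace Y"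
    and g1: "continuous_map (subtopology Y U) (path_space X) g1" "\<And>y. y \<in> U \<Longrightarrow> path_ends (g1 y) = f y"
    and g2: "continuous_map (subtopology Y V) (path_space X) g2" "\<And>y. y \<in> V \<Longrightarrow> path_ends (g2 y) = f y"
    using cover unfolding path_liftable_cover_def by auto
  let ?I = "subtopology Y (U \<inter> V)"
  \<comment> \<open>Where \<open>g\<close> lifts \<open>f\<close>, pulling back along
    \<open>f\<close> factors through the path space, in which the difference cochain already has the
    primitive \<open>?b\<close>.\<close>
  have local: "cochain_pullback 2 Y f ?d x = cochain_pullback 1 (subtopology Y S) g ?b (chain_boundary 2 x)"
    if g: "continuous_map (subtopology Y S) (path_space X) g" "\<And>y. y \<in> S \<Longrightarrow> path_ends (g y) = f y"
      and x: "singular_chain 2 (subtopology Y S) x" for S g x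
  proof -
    have "cochain_pullback 2 Y f ?d x = cochain_pullback 2 (subtopology Y S) f ?d x"
      using x singular_chain_subtopology_imp[OF x] by (simp add: cochain_pullback_def)
    also have "\<dots> = cochain_pullback 2 (subtopology Y S) (path_ends \<circ> g) ?d x"
      by (subst cochain_pullback_cong[where g="path_ends \<circ> g"]) (use g(2) in auto)
    also have "\<dots> = coboundary 1 (subtopology Y S) (cochain_pullback 1 (subtopology Y S) g ?b) x"
      unfolding coboundary_cochain_pullback[OF g(1)] coboundary_path_cochain[OF c]
      by (simp add: cochain_pullback_compose[OF g(1), symmetric] numeral_2_eq_2)
    finally show ?thesis using x by (simp add: coboundary_def numeral_2_eq_2)
  qed
  \<comment> \<open>Forward along the first lift and back along the second. Pulling the loop cochain
    back along \<open>h\<close> gives the difference of the two local primitives.\<close>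
  define h where "h y = path_join (g1 y) (restrict (\<lambda>s. g2 y (1 - s)) {0..1})" for y
  have gI: "continuous_map ?I (path_space X) g1" "continuous_map ?I (path_space X) g2"
    using continuous_map_from_subtopology_mono[OF g1(1)] continuous_map_from_subtopology_mono[OF g2(1)] by auto
  have ends: "path_ends (g1 y) = path_ends (g2 y)" if "y \<in> topspace ?I" for y
    using that g1(2) g2(2) by auto
  have h: "continuous_map ?I (free_loop_space X) h"
    unfolding h_def[abs_def] by (rule continuous_map_free_loop_join[OF gI ends])
  have halves: "(first_half \<circ> h) y = g1 y" "(second_half_rev \<circ> h) y = g2 y" if "y \<in> topspace ?I" for y
  proof -
    have "g1 y \<in> topspace (path_space X)" "g2 y \<in> topspace (path_space X)"
      using gI that by (auto simp: continuous_map_def)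
    then show "(first_half \<circ> h) y = g1 y" "(second_half_rev \<circ> h) y = g2 y"
      using ends[OF that] path_join_halves[of "g1 y" "g2 y"]
      by (auto simp: h_def topspace_path_space path_ends_def)
  qed
  obtain \<epsilon> where \<epsilon>: "\<epsilon> \<in> singular_cochains 0 (free_loop_space X)"
    "\<And>x. singular_chain 1 (free_loop_space X) x \<Longrightarrow> loop_cochain X c x = \<epsilon> (chain_boundary 1 x)"
    using singular_coboundariesE[OF loop[unfolded One_nat_def]] by (metis One_nat_def)
  show ?thesis
  proof (rule glue_coboundaries[OF UV])
    show "cochain_pullback 2 Y f ?d \<in> singular_cocycles 2 Y"
      by (rule cochain_pullback_in_cocycles[OF f difference_cochain_in_cocycles[OF c]])
    show "cochain_pullback 1 (subtopology Y U) g1 ?b \<in> singular_cochains 1 (subtopology Y U)"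
      "cochain_pullback 1 (subtopology Y V) g2 ?b \<in> singular_cochains 1 (subtopology Y V)"
      "cochain_pullback 0 ?I h \<epsilon> \<in> singular_cochains 0 ?I"
      by (rule cochain_pullback_in_cochains[OF g1(1) b] cochain_pullback_in_cochains[OF g2(1) b]
          cochain_pullback_in_cochains[OF h \<epsilon>(1)])+
    show "cochain_pullback 2 Y f ?d x = cochain_pullback 1 (subtopology Y U) g1 ?b (chain_boundary 2 x)"
      if "singular_chain 2 (subtopology Y U) x" for x
      by (rule local[OF g1 that])
    show "cochain_pullback 2 Y f ?d x = cochain_pullback 1 (subtopology Y V) g2 ?b (chain_boundary 2 x)"
      if "singular_chain 2 (subtopology Y V) x" for x
      by (rule local[OF g2 that])
    fix x assume x: "singular_chain 1 ?I x"
    have xUV: "singular_chain 1 (subtopology Y U) x" "singular_chain 1 (subtopology Y V) x"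
      using x by (auto intro: singular_chain_mono)
    have hx: "singular_chain 1 (free_loop_space X) (chain_map 1 h x)"
      by (rule singular_chain_chain_map[OF x h])
    have "loop_cochain X c (chain_map 1 h x) = ?b (chain_map 1 (first_half \<circ> h) x) - ?b (chain_map 1 (second_half_rev \<circ> h) x)"
      using hx by (simp add: loop_cochain_def cochain_pullback_def chain_map_compose)
    moreover have "chain_map 1 (first_half \<circ> h) x = chain_map 1 g1 x" "chain_map 1 (second_half_rev \<circ> h) x = chain_map 1 g2 x"
      by (rule chain_map_eq[OF x halves(1)] chain_map_eq[OF x halves(2)]; assumption)+
    moreover have "loop_cochain X c (chain_map 1 h x) = \<epsilon> (chain_map 0 h (chain_boundary 1 x))"
      unfolding \<epsilon>(2)[OF hx] using chain_boundary_chain_map[OF x, of h] by simp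
    ultimately show "cochain_pullback 1 (subtopology Y U) g1 ?b x - cochain_pullback 1 (subtopology Y V) g2 ?b x =
        cochain_pullback 0 ?I h \<epsilon> (chain_boundary 1 x)"
      using xUV singular_chain_boundary[OF x] by (simp add: cochain_pullback_def)
  qed
qed

section \<open>The double mapping cylinder\<close>

lemma continuous_map_from_sum_topology:
  assumes "\<And>i. i \<in> I \<Longrightarrow> continuous_map (X i) Y (\<lambda>x. f (i, x))"
  shows "continuous_map (sum_topology X I) Y f"
  unfolding continuous_map_def
proof (intro conjI allI impI)
  show "f \<in> topspace (sum_topology X I) \<rightarrow> topspace Y"
    using continuous_map_image_subset_topspace[OF assms] by fastforce
  fix U assume U: "openin Y U"
  have "{x. (i, x) \<in> {p \<in> topspace (sum_topology X I). f p \<in> U}} = {x \<in> topspace (X i). f (i, x) \<in> U}"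
    if "i \<in> I" for i
    using that by auto
  then show "openin (sum_topology X I) {p \<in> topspace (sum_topology X I). f p \<in> U}"
    unfolding openin_sum_topology using openin_continuous_map_preimage[OF assms U] by auto
qed

lemma openin_quotient_map_image:
  assumes q: "quotient_map S Q q" and T: "openin S T"
    and sat: "\<forall>x\<in>T. \<forall>y\<in>topspace S. q x = q y \<longrightarrow> y \<in> T"
  shows "openin Q (q ` T)" and "{x \<in> topspace S. q x \<in> q ` T} = T"
proof -
  have TS: "T \<subseteq> topspace S" using T by (rule openin_subset)
  show eq: "{x \<in> topspace S. q x \<in> q ` T} = T" using TS sat by auto
  have "q ` T \<subseteq> topspace Q" using TS q by (auto simp: quotient_map_def)
  then show "openin Q (q ` T)" using q T eq unfolding quotient_map_def by metis
qed

text \<open>Over an open saturated set the projection is again a quotient map, so continuity may be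
  checked upstairs.\<close>

lemma continuous_map_quotient_local_lift:
  assumes q: "quotient_map S Q q" and T: "openin S T"
    and sat: "\<forall>x\<in>T. \<forall>y\<in>topspace S. q x = q y \<longrightarrow> y \<in> T"
    and l: "continuous_map (subtopology S T) Z l" and g: "\<And>x. x \<in> T \<Longrightarrow> g (q x) = l x"
  shows "continuous_map (subtopology Q (q ` T)) Z g"
proof -
  note im = openin_quotient_map_image[OF q T sat]
  have "quotient_map (subtopology S T) (subtopology Q (q ` T)) q"
    by (rule quotient_map_restriction[OF q im(2)]) (rule disjI1[OF im(1)])
  then show ?thesis
    by (rule continuous_compose_quotient_map) (rule continuous_map_eq[OF l], use g in auto)
qed

text \<open>Local lifts of \<open>\<pi>\<^sub>2\<close>. The first is compatible with the gluing only where the cylinder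
  coordinate is less than 2, the second only where it is greater than 1.\<close>

fun two_path_lift1 :: "piece \<times> (real \<Rightarrow> 'a) \<times> real \<Rightarrow> real \<Rightarrow> 'a" where
  "two_path_lift1 (i, \<gamma>, t) = (if i = Cylinder then first_half \<gamma> else \<gamma>)"

fun two_path_lift2 :: "piece \<times> (real \<Rightarrow> 'a) \<times> real \<Rightarrow> real \<Rightarrow> 'a" where
  "two_path_lift2 (i, \<gamma>, t) = (if i = Cylinder then second_half_rev \<gamma> else \<gamma>)"

lemma two_path_glue_invariants:
  assumes "equivclp (two_path_glue X) a b"
  shows "snd (snd a) = snd (snd b) \<and> (snd (snd a) < 2 \<longrightarrow> two_path_lift1 a = two_path_lift1 b) \<and>
    (snd (snd a) > 1 \<longrightarrow> two_path_lift2 a = two_path_lift2 b)"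
  using assms
proof (induction rule: equivclp_induct)
  case (step y z)
  have "snd (snd u) = snd (snd v) \<and> (snd (snd u) < 2 \<longrightarrow> two_path_lift1 u = two_path_lift1 v) \<and>
    (snd (snd u) > 1 \<longrightarrow> two_path_lift2 u = two_path_lift2 v)" if "two_path_glue X u v" for u v
    using that by (auto simp: two_path_glue_def)
  \<comment> \<open>A step of the generated equivalence relation may use a glued pair in either
    direction.\<close>
  from step.hyps(2) this[of y z] this[of z y] step.IH show ?case by auto
qed simp

lemma continuous_map_two_path_pieces:
  fixes X :: "'a topology"
  shows "continuous_map (two_path_pieces X) (path_space X) two_path_lift1"
    "continuous_map (two_path_pieces X) (path_space X) two_path_lift2"
    "continuous_map (two_path_pieces X) euclideanreal (\<lambda>x. snd (snd x))"
proof -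
  have f: "continuous_map (prod_topology A B) (path_space X) (\<lambda>p. h (fst p))"
    if "continuous_map A (path_space X) h" for A :: "(real \<Rightarrow> 'a) topology" and B :: "real topology" and h
    using continuous_map_compose[OF continuous_map_fst that] by (simp add: o_def)
  have s: "continuous_map (prod_topology A (top_of_set B)) euclideanreal snd"
    for A :: "(real \<Rightarrow> 'a) topology" and B :: "real set"
    using continuous_map_snd[of A "top_of_set B"] by (simp add: continuous_map_in_subtopology)
  have l: "two_path_lift1 (i, p) = (if i = Cylinder then first_half (fst p) else fst p)"
    "two_path_lift2 (i, p) = (if i = Cylinder then second_half_rev (fst p) else fst p)"
    for i and p :: "(real \<Rightarrow> 'a) \<times> real"
    by (cases p; simp)+
  show "continuous_map (two_path_pieces X) (path_space X) two_path_lift1"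
    unfolding two_path_pieces_def
    by (rule continuous_map_from_sum_topology)
       (auto simp: l split: piece.split intro: f[OF continuous_map_loop_halves(1)] continuous_map_fst)
  show "continuous_map (two_path_pieces X) (path_space X) two_path_lift2"
    unfolding two_path_pieces_def
    by (rule continuous_map_from_sum_topology)
       (auto simp: l split: piece.split intro: f[OF continuous_map_loop_halves(2)] continuous_map_fst)
  show "continuous_map (two_path_pieces X) euclideanreal (\<lambda>x. snd (snd x))"
    unfolding two_path_pieces_def
    by (rule continuous_map_from_sum_topology) (auto split: piece.split intro: s)
qed

lemma path_ends_two_path_lift:
  assumes "x \<in> topspace (two_path_pieces X)"
  shows "path_ends (two_path_lift1 x) = two_path_pieces_ends x"
    "path_ends (two_path_lift2 x) = two_path_pieces_ends x"
  using assms
  by (cases x rule: two_path_pieces_ends.cases;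
      auto simp: two_path_pieces_def path_ends_def first_half_def second_half_rev_def free_loop_space_def)+

lemma continuous_map_two_path_ends:
  "continuous_map (two_path_space X) (prod_topology X X) two_path_ends"
  unfolding two_path_space_def
proof (rule continuous_compose_quotient_map[OF quotient_map_glue_class])
  have "continuous_map (two_path_pieces X) (prod_topology X X) (path_ends \<circ> two_path_lift1)"
    by (rule continuous_map_compose[OF continuous_map_two_path_pieces(1) continuous_map_path_ends])
  then show "continuous_map (two_path_pieces X) (prod_topology X X)
     (two_path_ends \<circ> glue_class (two_path_pieces X) (two_path_glue X))"
    by (rule continuous_map_eq) (simp add: two_path_ends_class path_ends_two_path_lift)
qed

lemma path_liftable_cover_two_path_space:
  "path_liftable_cover X (two_path_space X) two_path_ends 2"
proof -
  let ?S = "two_path_pieces X" and ?Q = "two_path_space X"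
  let ?q = "glue_class ?S (two_path_glue X)"
  have q: "quotient_map ?S ?Q ?q"
    unfolding two_path_space_def by (rule quotient_map_glue_class)
  have self: "x \<in> ?q x" if "x \<in> topspace ?S" for x
    using that by (simp add: glue_class_def equivclp_refl)
  have eqv: "equivclp (two_path_glue X) x y" if "y \<in> topspace ?S" "?q x = ?q y" for x y
    using self[OF that(1)] unfolding that(2)[symmetric] by (simp add: glue_class_def)
  \<comment> \<open>The cylinder coordinate is constant on classes, so removing one end of the
    cylinder leaves an open saturated set on which the corresponding lift is well defined.\<close>
  define T1 where "T1 = {x \<in> topspace ?S. snd (snd x) \<in> {..<2::real}}"
  define T2 where "T2 = {x \<in> topspace ?S. snd (snd x) \<in> {1::real<..}}"
  have T: "openin ?S T1" "openin ?S T2"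
    unfolding T1_def T2_def
    by (rule openin_continuous_map_preimage[OF continuous_map_two_path_pieces(3)]; simp)+
  have sat1: "\<forall>x\<in>T1. \<forall>y\<in>topspace ?S. ?q x = ?q y \<longrightarrow> y \<in> T1"
  proof (intro ballI impI)
    fix x y assume xy: "x \<in> T1" "y \<in> topspace ?S" "?q x = ?q y"
    show "y \<in> T1"
      using two_path_glue_invariants[OF eqv[OF xy(2,3)]] xy(1,2) by (simp add: T1_def)
  qed
  have sat2: "\<forall>x\<in>T2. \<forall>y\<in>topspace ?S. ?q x = ?q y \<longrightarrow> y \<in> T2"
  proof (intro ballI impI)
    fix x y assume xy: "x \<in> T2" "y \<in> topspace ?S" "?q x = ?q y"
    show "y \<in> T2"
      using two_path_glue_invariants[OF eqv[OF xy(2,3)]] xy(1,2) by (simp add: T2_def)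
  qed
  \<comment> \<open>The lift is evaluated at an arbitrary representative of the class; on the image
    of \<open>T1\<close> the choice does not matter.\<close>
  define g1 :: "(piece \<times> (real \<Rightarrow> 'a) \<times> real) set \<Rightarrow> real \<Rightarrow> 'a"
    where "g1 w = two_path_lift1 (SOME y. y \<in> w)" for w
  define g2 :: "(piece \<times> (real \<Rightarrow> 'a) \<times> real) set \<Rightarrow> real \<Rightarrow> 'a"
    where "g2 w = two_path_lift2 (SOME y. y \<in> w)" for w
  have some: "equivclp (two_path_glue X) x (SOME y. y \<in> ?q x)" if "x \<in> topspace ?S" for x
    using someI[of "\<lambda>y. y \<in> ?q x", OF self[OF that]] by (simp add: glue_class_def)
  have g1: "g1 (?q x) = two_path_lift1 x" if "x \<in> T1" for x
    using two_path_glue_invariants[OF some, of x] that by (auto simp: T1_def g1_def)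
  have g2: "g2 (?q x) = two_path_lift2 x" if "x \<in> T2" for x
    using two_path_glue_invariants[OF some, of x] that by (auto simp: T2_def g2_def)
  have c1: "continuous_map (subtopology ?Q (?q ` T1)) (path_space X) g1"
    by (rule continuous_map_quotient_local_lift[OF q T(1) sat1, of _ two_path_lift1])
       (simp_all add: g1 continuous_map_from_subtopology continuous_map_two_path_pieces)
  have c2: "continuous_map (subtopology ?Q (?q ` T2)) (path_space X) g2"
    by (rule continuous_map_quotient_local_lift[OF q T(2) sat2, of _ two_path_lift2])
       (simp_all add: g2 continuous_map_from_subtopology continuous_map_two_path_pieces)
  have e1: "path_ends (g1 w) = two_path_ends w" if "w \<in> ?q ` T1" for w
  proof -
    obtain x where x: "w = ?q x" "x \<in> T1" using \<open>w \<in> ?q ` T1\<close> by blast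
    then have "x \<in> topspace ?S" by (simp add: T1_def)
    then show ?thesis
      unfolding x(1) g1[OF x(2)] by (simp only: two_path_ends_class path_ends_two_path_lift)
  qed
  have e2: "path_ends (g2 w) = two_path_ends w" if "w \<in> ?q ` T2" for w
  proof -
    obtain x where x: "w = ?q x" "x \<in> T2" using \<open>w \<in> ?q ` T2\<close> by blast
    then have "x \<in> topspace ?S" by (simp add: T2_def)
    then show ?thesis
      unfolding x(1) g2[OF x(2)] by (simp only: two_path_ends_class path_ends_two_path_lift)
  qed
  have "T1 \<union> T2 = topspace ?S"
    by (auto simp: T1_def T2_def)
  then have cover: "?q ` T1 \<union> ?q ` T2 = topspace ?Q"
    using q by (auto simp: quotient_map_def simp flip: image_Un)
  have "{1..2::nat} = {1, 2}" by auto
  then show ?thesis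
    unfolding path_liftable_cover_def
    using openin_quotient_map_image(1)[OF q T(1) sat1] openin_quotient_map_image(1)[OF q T(2) sat2]
      cover c1 c2 e1 e2
    by (intro exI[of _ "\<lambda>i::nat. if i = 1 then ?q ` T1 else ?q ` T2"]) auto
qed

section \<open>The realization of the singular complex\<close>

text \<open>In contrast to \<open>quotient_topology\<close>, whose points are classes, the topology
  lives on the values of \<open>q\<close>. This lets a prescribed type carry the quotient.\<close>

lemma quotient_map_exists: "\<exists>Q. quotient_map S Q q"
proof -
  let ?open = "\<lambda>W. W \<subseteq> q ` topspace S \<and> openin S {x \<in> topspace S. q x \<in> W}"
  have "istopology ?open"
    unfolding istopology_def
  proof (intro conjI allI impI)
    fix V W assume VW: "?open V" "?open W"
    then show "openin S {x \<in> topspace S. q x \<in> V \<inter> W}"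
      using openin_Int[of S "{x \<in> topspace S. q x \<in> V}" "{x \<in> topspace S. q x \<in> W}"]
      by (simp add: Collect_conj_eq Int_ac)
    show "V \<inter> W \<subseteq> q ` topspace S" using VW by blast
  next
    fix \<K> assume K: "\<forall>K\<in>\<K>. ?open K"
    have "{x \<in> topspace S. q x \<in> \<Union>\<K>} = (\<Union>K\<in>\<K>. {x \<in> topspace S. q x \<in> K})" by blast
    then show "openin S {x \<in> topspace S. q x \<in> \<Union>\<K>}" using K by auto
    show "\<Union>\<K> \<subseteq> q ` topspace S" using K by blast
  qed
  then have op: "openin (topology ?open) = ?open" by simp
  have "{x \<in> topspace S. q x \<in> q ` topspace S} = topspace S" by blast
  then have "openin (topology ?open) (q ` topspace S)" unfolding op by simp
  moreover have "topspace (topology ?open) \<subseteq> q ` topspace S"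
    using openin_topspace[of "topology ?open"] unfolding op by blast
  ultimately have "topspace (topology ?open) = q ` topspace S"
    using openin_subset by blast
  then have "quotient_map S (topology ?open) q"
    unfolding quotient_map_def op by auto
  then show ?thesis ..
qed

section \<open>Face maps and canonical representatives of points\<close>

definition skip :: "nat \<Rightarrow> nat \<Rightarrow> nat" where
  "skip k i = (if i < k then i else Suc i)"

lemma inj_skip: "inj (skip k)"
  by (auto simp: inj_def skip_def split: if_splits)

lemma skip_cases: obtains "b = k" | i where "b = skip k i"
proof -
  have "b = k \<or> (\<exists>i. b = skip k i)"
  proof (cases b k rule: linorder_cases)
    case less
    then have "b = skip k b" by (simp add: skip_def)
    then show ?thesis by blast
  next
    case greater
    then have "b = skip k (b - 1)" by (simp add: skip_def)
    then show ?thesis by blast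
  qed simp
  then show ?thesis using that by blast
qed

lemma simplical_face_skip: "simplical_face k t (skip k i) = t i" "simplical_face k t k = 0" "skip k i \<noteq> k"
  by (auto simp: simplical_face_def skip_def)

definition delete_coord :: "nat \<Rightarrow> (nat \<Rightarrow> real) \<Rightarrow> nat \<Rightarrow> real" where
  "delete_coord k t = (\<lambda>i. if i < k then t i else t (Suc i))"

lemma delete_coord_face: "delete_coord k (simplical_face k t) = t"
  by (auto simp: delete_coord_def simplical_face_def)

lemma face_delete_coord: "t k = 0 \<Longrightarrow> simplical_face k (delete_coord k t) = t"
  by (auto simp: delete_coord_def simplical_face_def fun_eq_iff)

lemma delete_coord_in_standard_simplex:
  assumes t: "t \<in> standard_simplex (Suc p)" and k: "k \<le> Suc p" "t k = 0"
  shows "delete_coord k t \<in> standard_simplex p"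
proof -
  have "(\<Sum>i\<le>p. delete_coord k t i) = (\<Sum>i\<in>{..Suc p} - {k}. t i)"
    by (rule sum.reindex_bij_witness[of _ "\<lambda>i. if i < k then i else i - 1" "\<lambda>i. if i < k then i else Suc i"])
       (use k in \<open>auto simp: delete_coord_def\<close>)
  also have "\<dots> = (\<Sum>i\<le>Suc p. t i)"
    by (rule sum.mono_neutral_left) (use k in auto)
  finally show ?thesis
    using t k by (auto simp: standard_simplex_def delete_coord_def)
qed

lemma singular_face_singular_face:
  assumes "j < k" "k \<le> Suc (Suc p)"
  shows "singular_face (Suc p) (k - 1) (singular_face (Suc (Suc p)) j \<sigma>) =
         singular_face (Suc p) j (singular_face (Suc (Suc p)) k \<sigma>)"
proof
  fix t
  show "singular_face (Suc p) (k - 1) (singular_face (Suc (Suc p)) j \<sigma>) t =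
         singular_face (Suc p) j (singular_face (Suc (Suc p)) k \<sigma>) t"
  proof (cases "t \<in> standard_simplex p")
    case True
    have "simplical_face j (simplical_face (k - 1) t) = simplical_face k (simplical_face j t)"
    proof
      fix i
      consider "i < j" | "i = j" | "j < i" "i < k" | "i = k" | "k < i" by linarith
      then show "simplical_face j (simplical_face (k - 1) t) i = simplical_face k (simplical_face j t) i"
        using assms(1) by cases (auto simp: simplical_face_def)
    qed
    moreover have "simplical_face (k - 1) t \<in> standard_simplex (Suc p)" "simplical_face j t \<in> standard_simplex (Suc p)"
      using simplical_face_in_standard_simplex[of "Suc p" _ t] True assms by auto
    ultimately show ?thesis using True by (simp add: singular_face_def)
  qed (simp add: singular_face_def)
qed

text \<open>The point of the realization of the singular complex given by the point \<open>t\<close> of the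
  \<open>p\<close>-simplex \<open>\<sigma>\<close>: faces are passed to until \<open>t\<close> is an interior point.\<close>

fun realization_point ::
  "nat \<Rightarrow> ((nat \<Rightarrow> real) \<Rightarrow> 'a) \<Rightarrow> (nat \<Rightarrow> real) \<Rightarrow> ((nat \<Rightarrow> real) \<Rightarrow> 'a) \<times> (nat \<Rightarrow> real)" where
  "realization_point 0 \<sigma> t = (\<sigma>, t)"
| "realization_point (Suc p) \<sigma> t =
     (if \<exists>k\<le>Suc p. t k = 0
      then realization_point p (singular_face (Suc p) (LEAST k. t k = 0) \<sigma>) (delete_coord (LEAST k. t k = 0) t)
      else (\<sigma>, t))"

declare realization_point.simps(2) [simp del]

lemma realization_point_least:
  assumes "t k = 0" "\<And>i. i < k \<Longrightarrow> t i \<noteq> 0" "k \<le> Suc p"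
  shows "realization_point (Suc p) \<sigma> t = realization_point p (singular_face (Suc p) k \<sigma>) (delete_coord k t)"
proof -
  have "(LEAST k. t k = 0) = k"
    using assms by (intro Least_equality) (auto simp: not_less[symmetric])
  then show ?thesis using assms by (auto simp: realization_point.simps)
qed

text \<open>The recursion deletes the least vanishing coordinate, and the zero inserted at
  \<open>k\<close> need not be the least. If an earlier coordinate \<open>j\<close> vanishes, it is
  deleted first, the simplicial identity exchanges the two faces, and induction applies.\<close>

lemma realization_point_face:
  "t \<in> standard_simplex p \<Longrightarrow> k \<le> Suc p \<Longrightarrow>
     realization_point (Suc p) \<sigma> (simplical_face k t) = realization_point p (singular_face (Suc p) k \<sigma>) t"
proof (induction p arbitrary: \<sigma> t k)
  case 0
  let ?t = "simplical_face k t"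
  have t: "t 0 = 1" using 0 by (simp add: standard_simplex_0)
  show ?case
  proof (subst realization_point_least[of ?t k])
    show "?t i \<noteq> 0" if "i < k" for i
      using that t 0 by (cases i) (auto simp: simplical_face_def)
  qed (use 0 in \<open>auto simp: simplical_face_skip delete_coord_face\<close>)
next
  case (Suc p)
  let ?t = "simplical_face k t"
  show ?case
  proof (cases "\<exists>j<k. t j = 0")
    case False
    then show ?thesis
      using Suc.prems by (subst realization_point_least[of ?t k])
         (auto simp: delete_coord_face, auto simp: simplical_face_def)
  next
    case True
    then obtain j0 where j0: "j0 < k" "t j0 = 0" by blast
    define j where "j = (LEAST j. t j = 0)"
    have j: "t j = 0" "t i \<noteq> 0 \<or> \<not> i < j" "j < k" for i
      using LeastI[of "\<lambda>j. t j = 0", OF j0(2)] not_less_Least[of i "\<lambda>j. t j = 0"]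
        Least_le[of "\<lambda>j. t j = 0", OF j0(2)] j0(1)
      unfolding j_def by (blast, blast, linarith)
    have del: "delete_coord j ?t = simplical_face (k - 1) (delete_coord j t)"
      using j(3) by (auto simp: delete_coord_def simplical_face_def fun_eq_iff)
    have "realization_point (Suc (Suc p)) \<sigma> ?t =
        realization_point (Suc p) (singular_face (Suc (Suc p)) j \<sigma>) (delete_coord j ?t)"
      by (rule realization_point_least) (use j Suc.prems in \<open>auto simp: simplical_face_def\<close>)
    also have "\<dots> = realization_point p (singular_face (Suc p) (k - 1) (singular_face (Suc (Suc p)) j \<sigma>)) (delete_coord j t)"
      unfolding del
      by (rule Suc.IH) (use j Suc.prems in \<open>auto intro!: delete_coord_in_standard_simplex\<close>)
    also have "\<dots> = realization_point p (singular_face (Suc p) j (singular_face (Suc (Suc p)) k \<sigma>)) (delete_coord j t)"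
      by (simp only: singular_face_singular_face[OF j(3) Suc.prems(2)])
    also have "\<dots> = realization_point (Suc p) (singular_face (Suc (Suc p)) k \<sigma>) t"
      by (rule realization_point_least[symmetric]) (use j Suc.prems in auto)
    finally show ?thesis .
  qed
qed

text \<open>The canonical representative is reached by passing to faces only, so data compatible
  with faces can be read off from it. The map to \<open>X\<close>, the lifts and the regions all
  descend to the realization in this way.\<close>

lemma realization_point_invariant:
  assumes F: "\<And>p \<sigma> t k. t \<in> standard_simplex p \<Longrightarrow> k \<le> Suc p \<Longrightarrow>
      F \<sigma> (simplical_face k t) = F (singular_face (Suc p) k \<sigma>) t"
  shows "t \<in> standard_simplex p \<Longrightarrow> case_prod F (realization_point p \<sigma> t) = F \<sigma> t"
proof (induction p arbitrary: \<sigma> t)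
  case (Suc p)
  show ?case
  proof (cases "\<exists>k\<le>Suc p. t k = 0")
    case True
    define k where "k = (LEAST k. t k = 0)"
    obtain k0 where k0: "k0 \<le> Suc p" "t k0 = 0" using True by blast
    have k: "t k = 0" "k \<le> Suc p"
      using LeastI[of "\<lambda>k. t k = 0", OF k0(2)] Least_le[of "\<lambda>k. t k = 0", OF k0(2)] k0(1)
      unfolding k_def by (blast, linarith)
    note d = delete_coord_in_standard_simplex[OF Suc.prems k(2,1)]
    have "realization_point (Suc p) \<sigma> t = realization_point p (singular_face (Suc p) k \<sigma>) (delete_coord k t)"
      using True by (simp add: realization_point.simps k_def)
    then show ?thesis
      using Suc.IH[OF d] F[OF d k(2), of \<sigma>] face_delete_coord[of t k] k(1) by simp
  next
    case False
    have "realization_point (Suc p) \<sigma> t = (\<sigma>, t)"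
      unfolding realization_point.simps by (rule if_not_P[OF False])
    then show ?thesis by simp
  qed
qed simp

text \<open>For \<open>n = 1, 2, 3\<close> the points with a dominant set form neighbourhoods of the vertices, of the
  open edges and of the open triangles.\<close>

definition dominant :: "nat \<Rightarrow> nat set \<Rightarrow> (nat \<Rightarrow> real) \<Rightarrow> bool" where
  "dominant n A t \<longleftrightarrow> finite A \<and> card A = n \<and> (\<forall>a\<in>A. \<forall>b. b \<notin> A \<longrightarrow> t b < t a)"

definition barycenter :: "nat set \<Rightarrow> nat \<Rightarrow> real" where
  "barycenter A = (\<lambda>i. if i \<in> A then 1 / real (card A) else 0)"

definition dominant_barycenter :: "nat \<Rightarrow> (nat \<Rightarrow> real) \<Rightarrow> nat \<Rightarrow> real" where
  "dominant_barycenter n t = barycenter (THE A. dominant n A t)"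

text \<open>Different sets of equal size each contain an element outside the other, and the two
  coordinates would have to be strictly smaller than each other.\<close>

lemma dominant_unique:
  assumes "dominant n A t" "dominant n B t"
  shows "A = B"
proof (rule ccontr)
  assume "A \<noteq> B"
  have "finite A" "finite B" "card A = card B" using assms by (auto simp: dominant_def)
  then have "\<not> A \<subseteq> B" "\<not> B \<subseteq> A"
    using \<open>A \<noteq> B\<close> card_subset_eq by metis+
  then obtain a b where "a \<in> A" "a \<notin> B" "b \<in> B" "b \<notin> A" by blast
  then show False using assms unfolding dominant_def by (meson less_asym)
qed

lemma dominant_barycenter_eq: "dominant n A t \<Longrightarrow> dominant_barycenter n t = barycenter A"
  unfolding dominant_barycenter_def using dominant_unique by (metis the_equality)

text \<open>A finite set omits some index, and the coordinate there is already nonnegative.\<close>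

lemma dominant_pos:
  assumes "dominant n A t" "\<And>i. 0 \<le> t i" "a \<in> A"
  shows "0 < t a"
proof -
  obtain b where "b \<notin> A" using assms(1) ex_new_if_finite[of A] by (auto simp: dominant_def)
  then have "t b < t a" using assms(1,3) by (auto simp: dominant_def)
  then show ?thesis using assms(2)[of b] by simp
qed

text \<open>The inserted coordinate is zero while dominant coordinates are positive. It therefore
  never enters a dominant set, and the inequalities against it hold automatically.\<close>

lemma dominant_face:
  assumes t: "\<And>i. 0 \<le> t i"
  shows "dominant n B (simplical_face k t) \<longleftrightarrow> (\<exists>A. B = skip k ` A \<and> dominant n A t)"
proof
  assume B: "dominant n B (simplical_face k t)"
  have f: "0 \<le> simplical_face k t i" for i using t by (simp add: simplical_face_def)
  have "k \<notin> B" using dominant_pos[OF B f] by (force simp: simplical_face_skip)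
  have eq: "B = skip k ` {i. skip k i \<in> B}"
  proof
    show "B \<subseteq> skip k ` {i. skip k i \<in> B}"
    proof
      fix b assume "b \<in> B"
      then show "b \<in> skip k ` {i. skip k i \<in> B}"
        using \<open>k \<notin> B\<close> by (cases rule: skip_cases[of b k]) auto
    qed
  qed blast
  have "dominant n {i. skip k i \<in> B} t"
    unfolding dominant_def
  proof (intro conjI ballI allI impI)
    show "finite {i. skip k i \<in> B}"
      using B inj_skip finite_vimageI[of B "skip k"] by (simp add: dominant_def vimage_def)
    show "card {i. skip k i \<in> B} = n"
      using B eq card_image[OF inj_on_subset[OF inj_skip subset_UNIV], of k "{i. skip k i \<in> B}"]
      by (simp add: dominant_def)
    show "t b < t a" if "a \<in> {i. skip k i \<in> B}" "b \<notin> {i. skip k i \<in> B}" for a b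
      using B that simplical_face_skip(1)[of k t] unfolding dominant_def by (metis mem_Collect_eq)
  qed
  then show "\<exists>A. B = skip k ` A \<and> dominant n A t" using eq by blast
next
  assume "\<exists>A. B = skip k ` A \<and> dominant n A t"
  then obtain A where A: "B = skip k ` A" "dominant n A t" by blast
  have "simplical_face k t b < simplical_face k t a" if ab: "a \<in> B" "b \<notin> B" for a b
  proof -
    obtain i where i: "a = skip k i" "i \<in> A" using ab A by blast
    show ?thesis
    proof (cases rule: skip_cases[of b k])
      case 1
      then show ?thesis using dominant_pos[OF A(2) t i(2)] i by (simp add: simplical_face_skip)
    next
      case (2 j)
      then have "j \<notin> A" using ab A by blast
      then show ?thesis using A(2) i 2 by (simp add: simplical_face_skip dominant_def)
    qed
  qed
  then show "dominant n B (simplical_face k t)"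
    using A card_image[OF inj_on_subset[OF inj_skip subset_UNIV], of k A] by (simp add: dominant_def)
qed

lemma barycenter_skip: "barycenter (skip k ` A) = simplical_face k (barycenter A)"
proof
  fix b
  have c: "card (skip k ` A) = card A"
    by (rule card_image[OF inj_on_subset[OF inj_skip subset_UNIV]])
  show "barycenter (skip k ` A) b = simplical_face k (barycenter A) b"
  proof (cases rule: skip_cases[of b k])
    case 1
    have "k \<notin> skip k ` A" by (metis imageE simplical_face_skip(3))
    then show ?thesis using 1 by (simp add: simplical_face_skip barycenter_def)
  next
    case (2 i)
    have "skip k i \<in> skip k ` A \<longleftrightarrow> i \<in> A" using inj_skip by (auto simp: inj_def)
    then show ?thesis unfolding 2 simplical_face_skip by (simp add: barycenter_def c)
  qed
qed

text \<open>Positivity keeps \<open>A\<close> among the vertices of the simplex;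
  \<open>Suc n\<close> makes it nonempty, so that its weights sum to 1.\<close>

lemma barycenter_in_standard_simplex:
  assumes t: "t \<in> standard_simplex p" and A: "dominant (Suc n) A t"
  shows "barycenter A \<in> standard_simplex p"
proof -
  have fin: "finite A" "card A = Suc n" using A by (auto simp: dominant_def)
  have "a \<le> p" if "a \<in> A" for a
  proof (rule ccontr)
    assume "\<not> a \<le> p"
    then have "t a = 0" using t by (simp add: standard_simplex_def)
    then show False using dominant_pos[OF A _ that] t by (simp add: standard_simplex_def)
  qed
  then have sub: "A \<subseteq> {..p}" by blast
  have "(\<Sum>i\<le>p. barycenter A i) = (\<Sum>i\<in>A. 1 / real (card A))"
    unfolding barycenter_def by (rule sum.mono_neutral_cong_right) (use sub in auto)
  also have "\<dots> = 1" using fin by simp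
  finally have "(\<Sum>i\<le>p. barycenter A i) = 1" .
  then show ?thesis
  proof -
    have "barycenter A i = 0" if "i > p" for i
      using sub that by (auto simp: barycenter_def)
    moreover have "0 \<le> barycenter A i \<and> barycenter A i \<le> 1" for i
      using fin by (simp add: barycenter_def)
    ultimately show ?thesis using \<open>(\<Sum>i\<le>p. barycenter A i) = 1\<close> by (simp add: standard_simplex_def)
  qed
qed

lemma openin_dominant:
  assumes "finite A"
  shows "openin (simplex_top p) {t \<in> standard_simplex p. dominant n A t}"
proof (cases "card A = n")
  case True
  \<comment> \<open>Dominance is a condition on infinitely many \<open>b\<close>. On the simplex all
    coordinates beyond \<open>p\<close> are zero, so the single index \<open>M\<close> beyond
    \<open>p\<close> and \<open>A\<close> represents them and finitely many inequalities
    remain.\<close>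
  define M where "M = Suc (Max (insert p A))"
  have "a < M" if "a \<in> insert p A" for a
    unfolding M_def less_Suc_eq_le by (rule Max_ge) (use assms that in auto)
  then have M: "M \<notin> A" "p < M" by blast+
  let ?U = "\<lambda>(a, b). {t \<in> topspace (simplex_top p). t b - t a \<in> {..<0}}"
  have "openin (simplex_top p) (?U q)" for q
    unfolding case_prod_unfold
    by (rule openin_continuous_map_preimage[where Y=euclideanreal])
       (auto intro!: continuous_intros continuous_map_simplex_coordinate)
  then have "openin (simplex_top p) ((\<Inter>q\<in>A \<times> ({..M} - A). ?U q) \<inter> topspace (simplex_top p))"
    using assms by (intro openin_INT) auto
  moreover have "{t \<in> standard_simplex p. dominant n A t} = (\<Inter>q\<in>A \<times> ({..M} - A). ?U q) \<inter> topspace (simplex_top p)"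
    (is "?L = ?R")
  proof
    show "?L \<subseteq> ?R" by (auto simp: dominant_def)
    show "?R \<subseteq> ?L"
    proof
      fix t assume t: "t \<in> ?R"
      then have ts: "t \<in> standard_simplex p" by simp
      have *: "t b < t a" if "a \<in> A" "b \<notin> A" "b \<le> M" for a b
        using t that by force
      have "t b < t a" if ab: "a \<in> A" "b \<notin> A" for a b
      proof (cases "b \<le> M")
        case False
        then have "t b = t M" using ts M(2) by (simp add: standard_simplex_def)
        then show ?thesis using *[OF ab(1) M(1)] by simp
      qed (use * ab in blast)
      then show "t \<in> ?L" using ts assms True by (simp add: dominant_def)
    qed
  qed
  ultimately show ?thesis by simp
qed (simp add: dominant_def)

section \<open>Paths from the base point into the dominant regions\<close>

lemma continuous_map_simplex_segment:
  assumes \<sigma>: "singular_simplex p X \<sigma>"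
    and f: "continuous_map Z (simplex_top p) f" "continuous_map Z (simplex_top p) g"
    and u: "continuous_map Z I01 u"
  shows "continuous_map Z X (\<lambda>z. \<sigma> (\<lambda>i. (1 - u z) * f z i + u z * g z i))"
proof -
  have coord: "continuous_map Z euclideanreal (\<lambda>z. h z i)" if "continuous_map Z (simplex_top p) h" for h i
    using continuous_map_compose[OF that continuous_map_simplex_coordinate] by (simp add: o_def)
  have "continuous_map Z euclideanreal u" using u by (simp add: continuous_map_in_subtopology)
  then have "continuous_map Z (powertop_real UNIV) (\<lambda>z i. (1 - u z) * f z i + u z * g z i)"
    unfolding continuous_map_componentwise_UNIV
    by (intro allI continuous_intros coord[OF f(1)] coord[OF f(2)])
  moreover have "(\<lambda>i. (1 - u z) * f z i + u z * g z i) \<in> standard_simplex p" if "z \<in> topspace Z" for z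
    using f u that by (intro convex_standard_simplex) (auto simp: continuous_map_def Pi_iff)
  ultimately have "continuous_map Z (simplex_top p) (\<lambda>z i. (1 - u z) * f z i + u z * g z i)"
    by (auto simp: continuous_map_in_subtopology)
  from continuous_map_compose[OF this, of X \<sigma>] \<sigma> show ?thesis
    by (simp add: singular_simplex_def o_def)
qed

lemma joined_in_singular_simplex:
  assumes \<sigma>: "singular_simplex p X \<sigma>" and xy: "x \<in> standard_simplex p" "y \<in> standard_simplex p"
  shows "joined_in X (\<sigma> x) (\<sigma> y)"
proof -
  have "continuous_map (simplex_top 1) I01 (\<lambda>z. z 1)"
    using standard_simplex_coord[of _ 1 1] continuous_map_simplex_coordinate[of 1 1]
    by (auto simp: continuous_map_in_subtopology)
  then have "continuous_map (simplex_top 1) X (\<lambda>z. \<sigma> (\<lambda>i. (1 - z 1) * x i + z 1 * y i))"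
    using xy by (intro continuous_map_simplex_segment[OF \<sigma>]) auto
  from singular_simplex_restrictI[OF this] show ?thesis
    unfolding joined_in_def using edge_point_in_standard_simplex[of 0] edge_point_in_standard_simplex[of 1]
    by (intro exI[of _ "restrict (\<lambda>z. \<sigma> (\<lambda>i. (1 - z 1) * x i + z 1 * y i)) (standard_simplex 1)"] conjI)
       (simp_all add: edge_point_def)
qed

text \<open>From the base point of the component to the centre \<open>\<sigma> c\<close>, then along
  a segment of the simplex to \<open>\<sigma> t\<close>. The first piece does not depend on
  \<open>t\<close>, so an arbitrary choice of it is continuous in \<open>t\<close>.\<close>

definition contraction_path :: "'a topology \<Rightarrow> ((nat \<Rightarrow> real) \<Rightarrow> 'a) \<Rightarrow> (nat \<Rightarrow> real) \<Rightarrow> (nat \<Rightarrow> real) \<Rightarrow> real \<Rightarrow> 'a"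
  where "contraction_path X \<sigma> c t =
    path_join (restrict (\<lambda>s. component_path X (\<sigma> c) (edge_point s)) {0..1})
      (restrict (\<lambda>s. \<sigma> (\<lambda>i. (1 - s) * c i + s * t i)) {0..1})"

lemma contraction_path_face:
  assumes "t \<in> standard_simplex p" "c \<in> standard_simplex p"
  shows "contraction_path X \<sigma> (simplical_face k c) (simplical_face k t) =
    contraction_path X (singular_face (Suc p) k \<sigma>) c t"
proof -
  have "\<sigma> (\<lambda>i. (1 - s) * simplical_face k c i + s * simplical_face k t i) =
      singular_face (Suc p) k \<sigma> (\<lambda>i. (1 - s) * c i + s * t i)" if "s \<in> {0..1}" for s
  proof -
    have "(\<lambda>i. (1 - s) * simplical_face k c i + s * simplical_face k t i) =
        simplical_face k (\<lambda>i. (1 - s) * c i + s * t i)"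
      by (auto simp: simplical_face_def fun_eq_iff)
    moreover have "(\<lambda>i. (1 - s) * c i + s * t i) \<in> standard_simplex p"
      using that by (intro convex_standard_simplex assms) auto
    ultimately show ?thesis by (simp add: singular_face_def)
  qed
  moreover have "\<sigma> (simplical_face k c) = singular_face (Suc p) k \<sigma> c"
    using assms by (simp add: singular_face_def)
  ultimately show ?thesis
    unfolding contraction_path_def by (simp cong: restrict_cong)
qed

lemma singular_simplex_in_topspace:
  "singular_simplex p X \<sigma> \<Longrightarrow> t \<in> standard_simplex p \<Longrightarrow> \<sigma> t \<in> topspace X"
  by (auto simp: singular_simplex_def continuous_map_def Pi_iff)

lemma component_point_in_topspace: "x \<in> topspace X \<Longrightarrow> component_point X x \<in> topspace X"
  using singular_simplex_in_topspace[OF component_path(1), of x X "edge_point 0"]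
    edge_point_in_standard_simplex[of 0] by (simp add: component_path(2))

lemma path_ends_contraction_path:
  assumes \<sigma>: "singular_simplex p X \<sigma>" and c: "c \<in> standard_simplex p" and t: "t \<in> standard_simplex p"
  shows "path_ends (contraction_path X \<sigma> c t) = (component_point X (\<sigma> t), \<sigma> t)"
  using component_point_eq[OF joined_in_singular_simplex[OF \<sigma> c t]]
    component_path(2)[OF singular_simplex_in_topspace[OF \<sigma> c]]
  by (simp add: path_ends_def contraction_path_def path_join_def)

lemma continuous_map_contraction_path:
  assumes \<sigma>: "singular_simplex p X \<sigma>" and c: "c \<in> standard_simplex p"
  shows "continuous_map (simplex_top p) (path_space X) (contraction_path X \<sigma> c)"
  unfolding contraction_path_def[abs_def]
proof (rule continuous_map_path_join)
  let ?P = "prod_topology (simplex_top p) I01"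
  have s: "continuous_map ?P euclideanreal snd"
    using continuous_map_snd[of "simplex_top p" I01] by (simp add: continuous_map_in_subtopology)
  have x: "\<sigma> c \<in> topspace X" by (rule singular_simplex_in_topspace[OF \<sigma> c])
  show "continuous_map (simplex_top p) (path_space X)
     (\<lambda>t. restrict (\<lambda>s. component_path X (\<sigma> c) (edge_point s)) {0..1})"
  proof (rule continuous_map_path_spaceI)
    show "continuous_map ?P X (\<lambda>(z, s). component_path X (\<sigma> c) (edge_point s))"
      unfolding case_prod_unfold
      by (rule singular_simplex_1_continuous_map[OF component_path(1)[OF x] s]) auto
  qed
  show "continuous_map (simplex_top p) (path_space X)
     (\<lambda>t. restrict (\<lambda>s. \<sigma> (\<lambda>i. (1 - s) * c i + s * t i)) {0..1})"
  proof (rule continuous_map_path_spaceI)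
    show "continuous_map ?P X (\<lambda>(t, s). \<sigma> (\<lambda>i. (1 - s) * c i + s * t i))"
      unfolding case_prod_unfold
      by (rule continuous_map_simplex_segment[OF \<sigma>, where f="\<lambda>_. c" and g=fst])
         (use c in \<open>auto intro: continuous_map_fst continuous_map_snd\<close>)
  qed
qed (use component_path(3)[OF singular_simplex_in_topspace[OF \<sigma> c]] in simp)

definition dominant_region :: "nat \<Rightarrow> (nat \<Rightarrow> real) set" where
  "dominant_region n = {t. \<exists>A. dominant n A t}"

text \<open>The fixed value outside the region makes compatibility with faces hold at every point of
  the simplex, as the descent to the realization demands.\<close>

definition region_path :: "'a topology \<Rightarrow> nat \<Rightarrow> ((nat \<Rightarrow> real) \<Rightarrow> 'a) \<Rightarrow> (nat \<Rightarrow> real) \<Rightarrow> real \<Rightarrow> 'a" where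
  "region_path X n \<sigma> t =
     (if t \<in> dominant_region n then contraction_path X \<sigma> (dominant_barycenter n t) t else (\<lambda>_. undefined))"

lemma dominant_region_face:
  assumes "t \<in> standard_simplex p"
  shows "simplical_face k t \<in> dominant_region n \<longleftrightarrow> t \<in> dominant_region n"
proof -
  have "\<And>i. 0 \<le> t i" using assms by (simp add: standard_simplex_def)
  from dominant_face[OF this] show ?thesis by (auto simp: dominant_region_def)
qed

lemma region_path_face:
  assumes t: "t \<in> standard_simplex p"
  shows "region_path X (Suc n) \<sigma> (simplical_face k t) = region_path X (Suc n) (singular_face (Suc p) k \<sigma>) t"
proof (cases "t \<in> dominant_region (Suc n)")
  case True
  then obtain A where A: "dominant (Suc n) A t" by (auto simp: dominant_region_def)
  have t0: "\<And>i. 0 \<le> t i" using t by (simp add: standard_simplex_def)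
  have "dominant (Suc n) (skip k ` A) (simplical_face k t)"
    unfolding dominant_face[OF t0] using A by blast
  then have "dominant_barycenter (Suc n) (simplical_face k t) = simplical_face k (barycenter A)"
    using dominant_barycenter_eq barycenter_skip by metis
  then show ?thesis
    using True dominant_region_face[OF t] dominant_barycenter_eq[OF A]
      contraction_path_face[OF t barycenter_in_standard_simplex[OF t A]]
    by (simp add: region_path_def)
qed (simp add: region_path_def dominant_region_face[OF t])

lemma openin_dominant_region: "openin (simplex_top p) (standard_simplex p \<inter> dominant_region n)"
proof -
  have "standard_simplex p \<inter> dominant_region n = (\<Union>A\<in>{A. finite A}. {t \<in> standard_simplex p. dominant n A t})"
    by (auto simp: dominant_region_def dominant_def)
  then show ?thesis by (auto intro!: openin_dominant)
qed

text \<open>The sets on which a given \<open>A\<close> dominates are open and, for a fixed size,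
  disjoint. The centre is constant on each of them, so its jumps between different sets do no
  harm.\<close>

lemma continuous_map_region_path:
  assumes \<sigma>: "singular_simplex p X \<sigma>"
  shows "continuous_map (subtopology (simplex_top p) (dominant_region (Suc n))) (path_space X) (region_path X (Suc n) \<sigma>)"
proof (rule pasting_lemma[where I="{A. \<exists>t\<in>standard_simplex p. dominant (Suc n) A t}"
      and T="\<lambda>A. {t \<in> standard_simplex p. dominant (Suc n) A t}"
      and f="\<lambda>A. contraction_path X \<sigma> (barycenter A)"])
  let ?R = "subtopology (simplex_top p) (dominant_region (Suc n))"
  fix A :: "nat set" assume "A \<in> {A. \<exists>t\<in>standard_simplex p. dominant (Suc n) A t}"
  then obtain t where A: "t \<in> standard_simplex p" "dominant (Suc n) A t" by blast
  then have "openin (simplex_top p) {t \<in> standard_simplex p. dominant (Suc n) A t}"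
    by (intro openin_dominant) (simp add: dominant_def)
  then show "openin ?R {t \<in> standard_simplex p. dominant (Suc n) A t}"
    by (auto simp: openin_subtopology dominant_region_def)
  show "continuous_map (subtopology ?R {t \<in> standard_simplex p. dominant (Suc n) A t}) (path_space X)
      (contraction_path X \<sigma> (barycenter A))"
    by (intro continuous_map_from_subtopology[OF continuous_map_from_subtopology]
        continuous_map_contraction_path[OF \<sigma> barycenter_in_standard_simplex[OF A]])
next
  fix t assume t: "t \<in> topspace (subtopology (simplex_top p) (dominant_region (Suc n)))"
  then obtain A where A: "dominant (Suc n) A t" by (auto simp: dominant_region_def)
  then show "\<exists>A. A \<in> {A. \<exists>t\<in>standard_simplex p. dominant (Suc n) A t} \<and>
      t \<in> {t \<in> standard_simplex p. dominant (Suc n) A t} \<and>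
      region_path X (Suc n) \<sigma> t = contraction_path X \<sigma> (barycenter A) t"
    using t by (intro exI[of _ A]) (auto simp: region_path_def dominant_barycenter_eq[OF A])
qed (auto dest: dominant_unique)

lemma path_ends_region_path:
  assumes "singular_simplex p X \<sigma>" "t \<in> standard_simplex p" "t \<in> dominant_region (Suc n)"
  shows "path_ends (region_path X (Suc n) \<sigma> t) = (component_point X (\<sigma> t), \<sigma> t)"
proof -
  obtain A where A: "dominant (Suc n) A t" using assms(3) by (auto simp: dominant_region_def)
  from path_ends_contraction_path[OF assms(1) barycenter_in_standard_simplex[OF assms(2) A] assms(2)]
  show ?thesis using assms(3) by (simp add: region_path_def dominant_barycenter_eq[OF A])
qed

text \<open>The set of positive coordinates is dominant, and it has between 1 and
  \<open>p + 1\<close> elements.\<close>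

lemma standard_simplex_in_dominant_region:
  assumes t: "t \<in> standard_simplex p"
  obtains n where "n \<le> p" "t \<in> dominant_region (Suc n)"
proof -
  let ?A = "{i. 0 < t i}"
  have sub: "?A \<subseteq> {..p}"
  proof
    fix i assume "i \<in> ?A"
    then show "i \<in> {..p}" using t by (cases "i \<le> p") (auto simp: standard_simplex_def)
  qed
  then have fin: "finite ?A" using finite_subset by blast
  have "?A \<noteq> {}"
  proof
    assume "?A = {}"
    then have "t i = 0" for i using t by (auto simp: standard_simplex_def not_less intro: order_antisym)
    then show False using t by (simp add: standard_simplex_def)
  qed
  then obtain n where n: "card ?A = Suc n" using fin by (metis card_eq_0_iff not0_implies_Suc)
  have "n \<le> p" using n card_mono[OF _ sub] by simp
  moreover have "dominant (Suc n) ?A t"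
    using fin n t by (auto simp: dominant_def standard_simplex_def not_less intro: le_less_trans)
  ultimately show ?thesis using that by (auto simp: dominant_region_def)
qed

text \<open>Here \<open>Y\<close> is the 2-dimensional realization of the singular complex of \<open>X\<close> (degenerate simplices
  are not collapsed), \<open>g\<close> its canonical map to \<open>X\<close> and \<open>\<xi> p \<sigma>\<close> the characteristic map of \<open>\<sigma>\<close>.\<close>

lemma realization_exists:
  fixes X :: "'a topology"
  assumes "large_universe TYPE('y) X"
  obtains Y :: "'y topology" and g :: "'y \<Rightarrow> 'a" and \<xi> :: "nat \<Rightarrow> ((nat \<Rightarrow> real) \<Rightarrow> 'a) \<Rightarrow> (nat \<Rightarrow> real) \<Rightarrow> 'y"
  where "continuous_map Y (prod_topology X X) (\<lambda>y. (component_point X (g y), g y))"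
    and "path_liftable_cover X Y (\<lambda>y. (component_point X (g y), g y)) 3"
    and "\<And>p \<sigma>. p \<le> 2 \<Longrightarrow> singular_simplex p X \<sigma> \<Longrightarrow> continuous_map (simplex_top p) Y (\<xi> p \<sigma>)"
    and "\<And>p \<sigma> t. p \<le> 2 \<Longrightarrow> singular_simplex p X \<sigma> \<Longrightarrow> t \<in> standard_simplex p \<Longrightarrow> g (\<xi> p \<sigma> t) = \<sigma> t"
    and "\<And>p \<sigma> t k. t \<in> standard_simplex p \<Longrightarrow> k \<le> Suc p \<Longrightarrow>
       \<xi> (Suc p) \<sigma> (simplical_face k t) = \<xi> p (singular_face (Suc p) k \<sigma>) t"
proof -
  obtain e :: "((nat \<Rightarrow> real) \<Rightarrow> 'a) \<times> (nat \<Rightarrow> real) \<Rightarrow> 'y" where e: "inj e"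
    using assms by (auto simp: large_universe_def)
  \<comment> \<open>As \<open>e\<close> is injective, two points of the disjoint simplices get the
    same name exactly when their canonical representatives agree; \<open>q\<close> below performs
    this identification.\<close>
  define \<xi> where "\<xi> p \<sigma> t = e (realization_point p \<sigma> t)" for p \<sigma> t
  define I where "I = {(p, \<sigma>). p \<le> 2 \<and> singular_simplex p X \<sigma>}"
  define S where "S = sum_topology (\<lambda>(p, \<sigma> :: (nat \<Rightarrow> real) \<Rightarrow> 'a). simplex_top p) I"
  define q where "q = (\<lambda>((p, \<sigma>), t). \<xi> p \<sigma> t)"
  obtain Y where q: "quotient_map S Y q" using quotient_map_exists by blast
  have topS: "x \<in> topspace S \<longleftrightarrow> (\<exists>p \<sigma> t. x = ((p, \<sigma>), t) \<and> p \<le> 2 \<and> singular_simplex p X \<sigma> \<and> t \<in> standard_simplex p)"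
    for x by (cases x) (auto simp: S_def I_def)
  have face: "\<xi> (Suc p) \<sigma> (simplical_face k t) = \<xi> p (singular_face (Suc p) k \<sigma>) t"
    if "t \<in> standard_simplex p" "k \<le> Suc p" for p \<sigma> t k
    by (simp only: \<xi>_def realization_point_face[OF that])
  \<comment> \<open>Defined through the canonical representative that the name encodes;
    compatibility with faces then yields the value at every other representative.\<close>
  define g where "g y = (case inv_into UNIV e y of (\<sigma>, t) \<Rightarrow> \<sigma> t)" for y
  define l where "l n y = (case inv_into UNIV e y of (\<sigma>, t) \<Rightarrow> region_path X (Suc n) \<sigma> t)" for n y
  have g: "g (\<xi> p \<sigma> t) = \<sigma> t" if t: "t \<in> standard_simplex p" for p \<sigma> t
    using realization_point_invariant[of "\<lambda>\<sigma> t. \<sigma> t", OF _ t]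
    by (simp add: g_def \<xi>_def inv_f_f[OF e] singular_face_def)
  have l: "l n (\<xi> p \<sigma> t) = region_path X (Suc n) \<sigma> t" if t: "t \<in> standard_simplex p" for n p \<sigma> t
    using realization_point_invariant[of "region_path X (Suc n)", OF region_path_face t]
    by (simp add: l_def \<xi>_def inv_f_f[OF e])
  have region: "snd (inv_into UNIV e (\<xi> p \<sigma> t)) \<in> dominant_region n \<longleftrightarrow> t \<in> dominant_region n"
    if t: "t \<in> standard_simplex p" for n p \<sigma> t
    using realization_point_invariant[of "\<lambda>\<sigma> t. t \<in> dominant_region n", OF dominant_region_face t]
    by (simp add: \<xi>_def inv_f_f[OF e] case_prod_unfold)
  let ?f = "\<lambda>y. (component_point X (g y), g y)"
  have \<xi>: "continuous_map (simplex_top p) Y (\<xi> p \<sigma>)" if "p \<le> 2" "singular_simplex p X \<sigma>" for p \<sigma>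
  proof -
    have "continuous_map (simplex_top p) S (\<lambda>t. ((p, \<sigma>), t))"
      using continuous_map_component_injection[of "(p, \<sigma>)" I "\<lambda>(p, \<sigma>). simplex_top p"] that
      by (simp add: S_def I_def)
    from continuous_map_compose[OF this quotient_imp_continuous_map[OF q]] show ?thesis
      by (simp add: o_def q_def)
  qed
  have f: "continuous_map Y (prod_topology X X) ?f"
  proof (rule continuous_compose_quotient_map[OF q])
    have "continuous_map S (prod_topology X X) (\<lambda>((p, \<sigma>), t). (component_point X (\<sigma> t), \<sigma> t))"
      unfolding S_def
    proof (rule continuous_map_from_sum_topology, clarsimp simp: I_def)
      fix p and \<sigma> :: "(nat \<Rightarrow> real) \<Rightarrow> 'a" assume \<sigma>: "singular_simplex p X \<sigma>"
      \<comment> \<open>A simplex stays within one path component, so the base point is constant on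
        it and any \<open>t0\<close> can serve as reference.\<close>
      obtain t0 where t0: "t0 \<in> standard_simplex p" using nonempty_standard_simplex by blast
      have "continuous_map (simplex_top p) X (\<lambda>t. component_point X (\<sigma> t0))"
        using component_point_in_topspace[OF singular_simplex_in_topspace[OF \<sigma> t0]] by simp
      then have "continuous_map (simplex_top p) X (\<lambda>t. component_point X (\<sigma> t))"
        by (rule continuous_map_eq)
           (use component_point_eq[OF joined_in_singular_simplex[OF \<sigma> t0]] in simp)
      then show "continuous_map (simplex_top p) (prod_topology X X) (\<lambda>t. (component_point X (\<sigma> t), \<sigma> t))"
        using \<sigma> by (intro continuous_map_pairedI) (simp_all add: singular_simplex_def)
    qed
    then show "continuous_map S (prod_topology X X) (?f \<circ> q)"
      by (rule continuous_map_eq) (auto simp: topS q_def g)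
  qed
  define T where "T n = {x \<in> topspace S. snd x \<in> dominant_region (Suc n)}" for n
  have T: "openin S (T n)" for n
  proof -
    have "{t. (i, t) \<in> T n} = standard_simplex (fst i) \<inter> dominant_region (Suc n)" if "i \<in> I" for i
      using that by (cases i) (auto simp: T_def topS I_def)
    then show ?thesis
      using openin_dominant_region openin_subset[of S]
      by (auto simp: S_def openin_sum_topology case_prod_unfold T_def)
  qed
  have sat: "\<forall>x\<in>T n. \<forall>y\<in>topspace S. q x = q y \<longrightarrow> y \<in> T n" for n
  proof (intro ballI impI)
    fix x y assume xy: "x \<in> T n" "y \<in> topspace S" "q x = q y"
    have "snd z \<in> dominant_region (Suc n) \<longleftrightarrow> snd (inv_into UNIV e (q z)) \<in> dominant_region (Suc n)"
      if "z \<in> topspace S" for z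
      using that region by (auto simp: topS q_def)
    from this[of x] this[of y] show "y \<in> T n" using xy by (simp add: T_def)
  qed
  have cont: "continuous_map (subtopology Y (q ` T n)) (path_space X) (l n)" for n
  proof (rule continuous_map_quotient_local_lift[OF q T sat])
    have "subtopology S (T n) = subtopology S (Sigma I (\<lambda>_. dominant_region (Suc n)))"
    proof -
      have "topspace S \<inter> T n = topspace S \<inter> Sigma I (\<lambda>_. dominant_region (Suc n))"
        by (auto simp: T_def S_def)
      then show ?thesis by (metis subtopology_restrict)
    qed
    also have "\<dots> = sum_topology (\<lambda>i. subtopology (simplex_top (fst i)) (dominant_region (Suc n))) I"
      unfolding S_def subtopology_sum_topology by (simp add: case_prod_unfold)
    finally have "subtopology S (T n) = sum_topology (\<lambda>i. subtopology (simplex_top (fst i)) (dominant_region (Suc n))) I" .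
    moreover have "continuous_map (sum_topology (\<lambda>i. subtopology (simplex_top (fst i)) (dominant_region (Suc n))) I)
        (path_space X) (\<lambda>((p, \<sigma>), t). region_path X (Suc n) \<sigma> t)"
      by (rule continuous_map_from_sum_topology) (auto simp: I_def intro!: continuous_map_region_path)
    ultimately show "continuous_map (subtopology S (T n)) (path_space X) (\<lambda>((p, \<sigma>), t). region_path X (Suc n) \<sigma> t)"
      by simp
    show "l n (q x) = (case x of (x, xa) \<Rightarrow> (case x of (p, \<sigma>) \<Rightarrow> region_path X (Suc n) \<sigma>) xa)" if "x \<in> T n" for x
      using that l by (auto simp: T_def topS q_def)
  qed
  have ends: "path_ends (l n y) = ?f y" if "y \<in> q ` T n" for n y
    using that by (auto simp: T_def topS q_def l g path_ends_region_path)
  \<comment> \<open>The shift translates the indices 1, 2, 3 of the cover into the parameter of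
    \<open>T\<close>; \<open>T (i - 1)\<close> consists of the points with a dominant set of size
    \<open>i\<close>.\<close>
  have cover: "(\<Union>i\<in>{1..3}. q ` T (i - 1)) = topspace Y"
  proof
    have Y: "topspace Y = q ` topspace S" using q by (simp add: quotient_map_def)
    show "(\<Union>i\<in>{1..3}. q ` T (i - 1)) \<subseteq> topspace Y" unfolding Y by (auto simp: T_def)
    show "topspace Y \<subseteq> (\<Union>i\<in>{1..3}. q ` T (i - 1))"
    proof
      fix y assume "y \<in> topspace Y"
      then obtain p \<sigma> t where y: "y = q ((p, \<sigma>), t)" "p \<le> 2" "singular_simplex p X \<sigma>" "t \<in> standard_simplex p"
        by (auto simp: Y topS)
      obtain n where n: "n \<le> p" "t \<in> dominant_region (Suc n)"
        using standard_simplex_in_dominant_region[OF y(4)] .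
      have "((p, \<sigma>), t) \<in> T n" using y n by (auto simp: T_def topS)
      then show "y \<in> (\<Union>i\<in>{1..3}. q ` T (i - 1))"
        using n y(1,2) by (intro UN_I[of "Suc n"]) auto
    qed
  qed
  have lift: "path_liftable_cover X Y ?f 3"
    unfolding path_liftable_cover_def
    using openin_quotient_map_image(1)[OF q T sat] cover cont ends
    by (intro exI[of _ "\<lambda>i. q ` T (i - 1)"] conjI) blast+
  show ?thesis
    by (rule that[of Y g \<xi>]) (simp_all add: f lift \<xi> g face)
qed

text \<open>The maps \<open>\<xi> p \<sigma>\<close> define a chain map from \<open>X\<close> to \<open>Y\<close>. It pulls a primitive on \<open>Y\<close> back to one on
  \<open>X\<close>, up to the value of \<open>c\<close> on constant triangles, which \<open>b2\<close> accounts for.\<close>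

lemma coboundary_of_weight_at_least_3:
  fixes c :: "'a chain \<Rightarrow> 'g::ab_group_add"
  assumes c: "c \<in> singular_cocycles 2 X" and large: "large_universe TYPE('y) X"
    and wgt: "weight_at_least TYPE('y) X 2 (cohomology_class 2 (prod_topology X X) (difference_cochain X c)) 3"
  shows "c \<in> singular_coboundaries 2 X"
proof -
  obtain Y :: "'y topology" and g \<xi>
    where f: "continuous_map Y (prod_topology X X) (\<lambda>y. (component_point X (g y), g y))"
      and cover: "path_liftable_cover X Y (\<lambda>y. (component_point X (g y), g y)) 3"
      and \<xi>: "\<And>p \<sigma>. p \<le> 2 \<Longrightarrow> singular_simplex p X \<sigma> \<Longrightarrow> continuous_map (simplex_top p) Y (\<xi> p \<sigma>)"
      and g: "\<And>p \<sigma> t. p \<le> 2 \<Longrightarrow> singular_simplex p X \<sigma> \<Longrightarrow> t \<in> standard_simplex p \<Longrightarrow> g (\<xi> p \<sigma> t) = \<sigma> t"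
      and face: "\<And>p \<sigma> t k. t \<in> standard_simplex p \<Longrightarrow> k \<le> Suc p \<Longrightarrow>
         \<xi> (Suc p) \<sigma> (simplical_face k t) = \<xi> p (singular_face (Suc p) k \<sigma>) t"
    by (rule realization_exists[OF large]) (rule that)
  let ?f = "\<lambda>y. (component_point X (g y), g y)"
  let ?d = "difference_cochain X c"
  note cc = singular_cocycles_imp_cochains[OF c]
  have "cohomology_induced 2 Y ?f (cohomology_class 2 (prod_topology X X) ?d) = \<one>\<^bsub>cohomology_group 2 Y\<^esub>"
    using wgt f cover unfolding weight_at_least_def by blast
  then have "cochain_pullback 2 Y ?f ?d \<in> singular_coboundaries 2 Y"
    unfolding cohomology_induced_class_eq_zero_iff[OF f] .
  then obtain e where e: "e \<in> singular_cochains 1 Y"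
    "\<And>x. singular_chain 2 Y x \<Longrightarrow> cochain_pullback 2 Y ?f ?d x = e (chain_boundary 2 x)"
    by (rule singular_coboundariesE[of _ 1, unfolded Suc_1]) (rule that)
  define s where "s p \<sigma> = restrict (\<xi> p \<sigma>) (standard_simplex p)" for p \<sigma>
  \<comment> \<open>The image of a triangle under the first coordinate of \<open>?f\<close>:
    constant at the base point of its component.\<close>
  define \<kappa> where "\<kappa> x = restrict (\<lambda>_. component_point X x) (standard_simplex 2)" for x
  have s: "singular_simplex p Y (s p \<sigma>)" if "p \<le> 2" "singular_simplex p X \<sigma>" for p \<sigma>
    unfolding s_def by (rule singular_simplex_restrictI[OF \<xi>[OF that]])
  have \<kappa>: "singular_simplex 2 X (\<kappa> x)" if "x \<in> topspace X" for x
    unfolding \<kappa>_def by (rule singular_simplex_const[OF component_point_in_topspace[OF that]])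
  have start: "\<tau> (edge_point 0) \<in> topspace X" if "singular_simplex 1 X \<tau>" for \<tau>
    using singular_simplex_1_topspace[OF that, of 0] by simp
  define b1 where "b1 = cochain_compose 1 X (\<lambda>\<tau>. frag_of (s 1 \<tau>)) e"
  \<comment> \<open>All edges of a triangle lie in one component and enter its boundary with signs
    plus, minus, plus. Hence one copy of the value survives, and \<open>b2\<close> turns the
    contribution of the constant triangle into a coboundary.\<close>
  define b2 where "b2 = cochain_compose 1 X (\<lambda>\<tau>. - frag_of (\<kappa> (\<tau> (edge_point 0)))) c"
  have b1: "b1 \<in> singular_cochains 1 X"
    unfolding b1_def using s[of 1] by (intro cochain_compose_in_cochains[OF e(1)]) (simp add: singular_chain_of)
  have b2: "b2 \<in> singular_cochains 1 X"
    unfolding b2_def using \<kappa>[OF start]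
    by (intro cochain_compose_in_cochains[OF cc]) (simp add: singular_chain_of singular_chain_minus)
  have b1_of: "b1 (frag_of \<tau>) = e (frag_of (s 1 \<tau>))" if "singular_simplex 1 X \<tau>" for \<tau>
    unfolding b1_def by (rule cochain_compose_of[OF that])
  have b2_of: "b2 (frag_of \<tau>) = - c (frag_of (\<kappa> (\<tau> (edge_point 0))))" if "singular_simplex 1 X \<tau>" for \<tau>
    unfolding b2_def cochain_compose_of[OF that]
    using \<kappa>[OF start[OF that]] by (intro singular_cochains_minus[OF cc]) (simp add: singular_chain_of)
  have main: "c (frag_of \<sigma>) = (\<lambda>x. b1 x - b2 x) (chain_boundary 2 (frag_of \<sigma>))" if \<sigma>: "singular_simplex 2 X \<sigma>" for \<sigma>
  proof -
    have faces: "singular_simplex 1 X (singular_face 2 k \<sigma>)" if "k \<le> 2" for k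
      using singular_simplex_singular_face[OF \<sigma> _ that] by simp
    have sface: "singular_face 2 k (s 2 \<sigma>) = s 1 (singular_face 2 k \<sigma>)" if "k \<le> 2" for k
      using that face[of _ 1 k \<sigma>] simplical_face_in_standard_simplex[of 2 k]
      by (auto simp: s_def singular_face_def fun_eq_iff numeral_2_eq_2)
    have base: "\<kappa> (\<sigma> t) = \<kappa> (\<sigma> u)" if "t \<in> standard_simplex 2" "u \<in> standard_simplex 2" for t u
      using component_point_eq[OF joined_in_singular_simplex[OF \<sigma> that]] by (simp add: \<kappa>_def)
    obtain t where t: "t \<in> standard_simplex 2" using nonempty_standard_simplex by blast
    have e0: "edge_point 0 \<in> standard_simplex 1" by (rule edge_point_in_standard_simplex) auto
    have fbase: "\<kappa> (singular_face 2 k \<sigma> (edge_point 0)) = \<kappa> (\<sigma> t)" if "k \<le> 2" for k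
      using e0 simplical_face_in_standard_simplex[of 2 k "edge_point 0"] that
      by (simp add: singular_face_def base[OF _ t])
    have s2: "singular_chain 2 Y (frag_of (s 2 \<sigma>))" using s[OF _ \<sigma>] by (simp add: singular_chain_of)
    have sf: "singular_chain 1 Y (frag_of (s 1 (singular_face 2 k \<sigma>)))" if "k \<le> 2" for k
      using s[OF _ faces[OF that]] by (simp add: singular_chain_of)
    have ff: "singular_chain 1 X (frag_of (singular_face 2 k \<sigma>))" if "k \<le> 2" for k
      using faces[OF that] by (simp add: singular_chain_of)
    have expand: "b (chain_boundary 2 (frag_of \<sigma>)) = b (frag_of (singular_face 2 0 \<sigma>))
        - b (frag_of (singular_face 2 1 \<sigma>)) + b (frag_of (singular_face 2 2 \<sigma>))"
      if "b \<in> singular_cochains 1 X" for b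
      unfolding chain_boundary_of_2
      by (simp add: singular_cochains_add[OF that] singular_cochains_diff[OF that] singular_chain_diff ff del: One_nat_def)
    have "cochain_pullback 2 Y ?f ?d (frag_of (s 2 \<sigma>)) =
        c (frag_of (simplex_map 2 snd (simplex_map 2 ?f (s 2 \<sigma>)))) - c (frag_of (simplex_map 2 fst (simplex_map 2 ?f (s 2 \<sigma>))))"
      using s2 singular_chain_chain_map[OF s2 f] by (simp add: cochain_pullback_def difference_cochain_def)
    also have "simplex_map 2 snd (simplex_map 2 ?f (s 2 \<sigma>)) = \<sigma>"
    proof
      fix u
      show "simplex_map 2 snd (simplex_map 2 ?f (s 2 \<sigma>)) u = \<sigma> u"
      proof (cases "u \<in> standard_simplex 2")
        case True
        then show ?thesis using g[OF _ \<sigma> True] by (simp add: simplex_map_def s_def)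
      next
        case False
        then show ?thesis
          using \<sigma> extensional_arb[of \<sigma> "standard_simplex 2" u] by (simp add: simplex_map_def singular_simplex_def)
      qed
    qed
    also have "simplex_map 2 fst (simplex_map 2 ?f (s 2 \<sigma>)) = \<kappa> (\<sigma> t)"
    proof
      fix u
      show "simplex_map 2 fst (simplex_map 2 ?f (s 2 \<sigma>)) u = \<kappa> (\<sigma> t) u"
      proof (cases "u \<in> standard_simplex 2")
        case True
        then show ?thesis
          using g[OF _ \<sigma> True] component_point_eq[OF joined_in_singular_simplex[OF \<sigma> True t]]
          by (simp add: simplex_map_def s_def \<kappa>_def)
      qed (simp add: simplex_map_def \<kappa>_def)
    qed
    finally have "c (frag_of \<sigma>) = e (chain_boundary 2 (frag_of (s 2 \<sigma>))) + c (frag_of (\<kappa> (\<sigma> t)))"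
      using e(2)[OF s2] by (simp add: algebra_simps)
    also have "e (chain_boundary 2 (frag_of (s 2 \<sigma>))) = b1 (chain_boundary 2 (frag_of \<sigma>))"
      unfolding expand[OF b1] unfolding chain_boundary_of_2
      by (simp add: sface b1_of faces singular_cochains_add[OF e(1)] singular_cochains_diff[OF e(1)]
          singular_chain_diff sf del: One_nat_def)
    also have "c (frag_of (\<kappa> (\<sigma> t))) = - b2 (chain_boundary 2 (frag_of \<sigma>))"
      unfolding expand[OF b2] by (simp add: b2_of faces fbase del: One_nat_def)
    finally show ?thesis by simp
  qed
  have "c \<in> singular_coboundaries (Suc 1) X"
  proof (rule singular_coboundariesI)
    show "(\<lambda>x. b1 x - b2 x) \<in> singular_cochains 1 X" by (rule cochains_diff[OF b1 b2])
    show "c \<in> singular_cochains (Suc 1) X" using cc by (simp add: numeral_2_eq_2)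
    show "c (frag_of \<sigma>) = b1 (chain_boundary (Suc 1) (frag_of \<sigma>)) - b2 (chain_boundary (Suc 1) (frag_of \<sigma>))"
      if "singular_simplex (Suc 1) X \<sigma>" for \<sigma>
      using main[of \<sigma>] that by (simp add: numeral_2_eq_2)
  qed
  then show ?thesis by (simp add: numeral_2_eq_2)
qed

text \<open>The zero class pulls back to zero along every map and so has infinite weight, which is
  why the exact value is asserted for a nonzero class. The size of the universe provides the test
  space for the upper bound.\<close>

theorem proposition4p5:
  fixes X :: "'a topology" and c :: "'a chain \<Rightarrow> 'g::ab_group_add"
  assumes "c \<in> singular_cocycles 2 X"
    and "atoroidal X (cohomology_class 2 X c)"
  shows "loop_cochain X c \<in> singular_cocycles 1 (free_loop_space X) \<and>
    cohomology_class 1 (free_loop_space X) (loop_cochain X c) =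
      \<one>\<^bsub>cohomology_group 1 (free_loop_space X)\<^esub> \<and>
    cohomology_induced 2 (two_path_space X) two_path_ends
        (cohomology_class 2 (prod_topology X X) (difference_cochain X c)) =
      \<one>\<^bsub>cohomology_group 2 (two_path_space X)\<^esub> \<and>
    2 \<le> TC_weight TYPE('y) X 2 (cohomology_class 2 (prod_topology X X) (difference_cochain X c)) \<and>
    (cohomology_class 2 (prod_topology X X) (difference_cochain X c) \<noteq>
        \<one>\<^bsub>cohomology_group 2 (prod_topology X X)\<^esub> \<longrightarrow>
     large_universe TYPE('y) X \<longrightarrow>
     TC_weight TYPE('y) X 2 (cohomology_class 2 (prod_topology X X) (difference_cochain X c)) = 2)"
proof -
  let ?u = "cohomology_class 2 (prod_topology X X) (difference_cochain X c)"
  note loop = loop_cochain_in_coboundaries[OF assms]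
  note vanish = pullback_difference_cochain_in_coboundaries[OF assms(1) loop]
  have w2: "weight_at_least TYPE('y) X 2 ?u 2"
    unfolding weight_at_least_def
  proof (intro allI impI)
    fix Y :: "'y topology" and f
    assume f: "continuous_map Y (prod_topology X X) f" and "path_liftable_cover X Y f 2"
    then show "cohomology_induced 2 Y f ?u = \<one>\<^bsub>cohomology_group 2 Y\<^esub>"
      unfolding cohomology_induced_class_eq_zero_iff[OF f] by (rule vanish)
  qed
  then have ge: "2 \<le> TC_weight TYPE('y) X 2 ?u"
    unfolding TC_weight_def by (intro Sup_upper) (auto intro!: exI[of _ "2::nat"] simp: numeral_eq_enat)
  have le: "TC_weight TYPE('y) X 2 ?u \<le> 2"
    if "?u \<noteq> \<one>\<^bsub>cohomology_group 2 (prod_topology X X)\<^esub>" "large_universe TYPE('y) X"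
  proof -
    have "\<not> weight_at_least TYPE('y) X 2 ?u 3"
    proof
      assume "weight_at_least TYPE('y) X 2 ?u 3"
      then have cb: "c \<in> singular_coboundaries 2 X"
        using coboundary_of_weight_at_least_3 assms(1) that(2) by blast
      have "difference_cochain X c \<in> singular_coboundaries 2 (prod_topology X X)"
        unfolding difference_cochain_def
        by (intro coboundaries_diff cochain_pullback_in_coboundaries[OF _ cb] continuous_map_fst continuous_map_snd)
      then show False using that(1) by (simp add: cohomology_class_eq_zero_iff)
    qed
    then have "k \<le> 2" if "weight_at_least TYPE('y) X 2 ?u k" for k
      using weight_at_least_antimono[OF that, of 3] by linarith
    then show ?thesis
      unfolding TC_weight_def by (intro Sup_least) (auto simp: numeral_eq_enat)
  qed
  have "cohomology_class 1 (free_loop_space X) (loop_cochain X c) = \<one>\<^bsub>cohomology_group 1 (free_loop_space X)\<^esub>"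
    using loop by (simp only: cohomology_class_eq_zero_iff)
  moreover have "cohomology_induced 2 (two_path_space X) two_path_ends ?u = \<one>\<^bsub>cohomology_group 2 (two_path_space X)\<^esub>"
    unfolding cohomology_induced_class_eq_zero_iff[OF continuous_map_two_path_ends]
    by (rule vanish[OF continuous_map_two_path_ends path_liftable_cover_two_path_space])
  ultimately show ?thesis
    using loop_cochain_in_cocycles[OF assms(1)] ge le by (blast intro: antisym)
qed

end
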